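(* Let $\lambda>0$ and suppose $\alpha\in DC(\gamma,\sigma)$. Then $\mathcal{H}_\theta$ exhibits Anderson localization in $\sigma^{\mathcal{H}}\setminus[-\lambda,\lambda]$ for every $\theta\in\Theta$, where $$\Theta=\bigcup_{\eta>0}\Big\{\theta\in\mathbb{T}_0:\ \|2\theta-k\alpha\|_{\mathbb{T}}\ge \frac{\eta}{|k|^{\sigma}}\ \ \forall k\in\mathbb{Z}\setminus\{0\}\Big\}.$$
   Context: $\mathbb{T}=\mathbb{R}/\mathbb{Z}$, $\|x\|_{\mathbb{T}}$ the distance to $\mathbb{Z}$. $\alpha\in DC(\gamma,\sigma)$ means $\|k\alpha\|_{\mathbb{T}}\ge\gamma|k|^{-\sigma}$ for all $k\neq0$. Let $\mathbb{T}_0=\{\theta\in\mathbb{T}:\cos 2\pi(n\alpha+\theta)\neq 0\ \forall n\in\mathbb{Z}\}$. For $\theta\in\mathbb{T}$, $n\in\mathbb{Z}$ put $v(\theta,n)=\cos2\pi((n-1)\alpha+\theta)$ if $n$ is odd and $v(\theta,n)=\cos 2\pi(n\alpha+\theta)$ if $n$ is even; $c(\theta,n)=\lambda$ if $n$ is odd and $c(\theta,n)=\cos2\pi(n\alpha+\theta)$ if $n$ is even. For $\theta\in\mathbb{T}_0$, $\mathcal{H}_\theta$ is the operator on $\ell^2(\mathbb{Z})$ given by $(\mathcal{H}_\theta u)(n)=c(\theta,n)u(n+1)+c(\theta,n-1)u(n-1)+v(\theta,n)u(n)$; its spectrum $\sigma^{\mathcal{H}}$ is independent of $\theta$. "Anderson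 localization in $I$" means the spectrum in $I$ is pure point and every eigenfunction with eigenvalue in $I$ decays exponentially. *)

theory Defs
  imports "HOL-Analysis.Analysis"
begin

definition tnorm :: "real \<Rightarrow> real" where
  "tnorm x = \<bar>x - of_int (round x)\<bar>"

definition DC :: "real \<Rightarrow> real \<Rightarrow> real set" where
  "DC \<gamma> \<sigma> = {\<alpha>. \<gamma> > 0 \<and>
     (\<forall>k::int. k \<noteq> 0 \<longrightarrow> tnorm (of_int k * \<alpha>) \<ge> \<gamma> * \<bar>of_int k\<bar> powr (- \<sigma>))}"

definition T0 :: "real \<Rightarrow> real set" where
  "T0 \<alpha> = {\<theta>. \<forall>n::int. cos (2 * pi * (of_int n * \<alpha> + \<theta>)) \<noteq> 0}"

definition vpot :: "real \<Rightarrow> real \<Rightarrow> int \<Rightarrow> real" where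
  "vpot \<alpha> \<theta> n = (if odd n then cos (2 * pi * (of_int (n - 1) * \<alpha> + \<theta>))
                     else cos (2 * pi * (of_int n * \<alpha> + \<theta>)))"

definition cof :: "real \<Rightarrow> real \<Rightarrow> real \<Rightarrow> int \<Rightarrow> real" where
  "cof lam \<alpha> \<theta> n = (if odd n then lam else cos (2 * pi * (of_int n * \<alpha> + \<theta>)))"

definition Hop :: "real \<Rightarrow> real \<Rightarrow> real \<Rightarrow> (int \<Rightarrow> complex) \<Rightarrow> (int \<Rightarrow> complex)" where
  "Hop lam \<alpha> \<theta> u n = complex_of_real (cof lam \<alpha> \<theta> n) * u (n + 1)
                    + complex_of_real (cof lam \<alpha> \<theta> (n - 1)) * u (n - 1)
                    + complex_of_real (vpot \<alpha> \<theta> n) * u n"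

definition l2 :: "(int \<Rightarrow> complex) \<Rightarrow> bool" where
  "l2 u \<longleftrightarrow> (\<lambda>n. (norm (u n))\<^sup>2) summable_on UNIV"

text \<open>Spectrum of a (bounded) operator on l2(Z): E is in the resolvent set iff
  H - E is a bijection of l2(Z) onto itself (bounded inverse is automatic).\<close>
definition spec :: "((int \<Rightarrow> complex) \<Rightarrow> (int \<Rightarrow> complex)) \<Rightarrow> real set" where
  "spec H = {E. \<not> (\<forall>f. l2 f \<longrightarrow>
      (\<exists>!g. l2 g \<and> (\<forall>n. H g n - complex_of_real E * g n = f n)))}"

text \<open>mu is the spectral measure of u for H: a finite Borel measure on R with
  <u, (H - z)^{-1} u> = integral of 1/(x - z) d mu(x) for every non-real z.\<close>
definition is_spectral_measure ::
  "((int \<Rightarrow> complex) \<Rightarrow> (int \<Rightarrow> complex)) \<Rightarrow> (int \<Rightarrow> complex) \<Rightarrow> real measure \<Rightarrow> bool" where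
  "is_spectral_measure H u \<mu> \<longleftrightarrow> finite_measure \<mu> \<and> sets \<mu> = sets borel \<and>
     (\<forall>z v. Im z \<noteq> 0 \<longrightarrow> l2 v \<longrightarrow> (\<forall>n. H v n - z * v n = u n) \<longrightarrow>
        infsum (\<lambda>n. cnj (u n) * v n) UNIV = integral\<^sup>L \<mu> (\<lambda>x. 1 / (complex_of_real x - z)))"

definition pure_point_in :: "((int \<Rightarrow> complex) \<Rightarrow> (int \<Rightarrow> complex)) \<Rightarrow> real set \<Rightarrow> bool" where
  "pure_point_in H I \<longleftrightarrow> (\<forall>u \<mu>. l2 u \<longrightarrow> is_spectral_measure H u \<mu> \<longrightarrow>
      (\<exists>C. countable C \<and> C \<subseteq> I \<and> I - C \<in> sets \<mu> \<and> emeasure \<mu> (I - C) = 0))"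

definition exp_decay :: "(int \<Rightarrow> complex) \<Rightarrow> bool" where
  "exp_decay u \<longleftrightarrow> (\<exists>C c. c > 0 \<and> (\<forall>n. norm (u n) \<le> C * exp (- c * \<bar>of_int n\<bar>)))"

definition anderson_localization :: "((int \<Rightarrow> complex) \<Rightarrow> (int \<Rightarrow> complex)) \<Rightarrow> real set \<Rightarrow> bool" where
  "anderson_localization H I \<longleftrightarrow> pure_point_in H I \<and>
     (\<forall>E\<in>I. \<forall>u. l2 u \<longrightarrow> u \<noteq> (\<lambda>_. 0) \<longrightarrow> (\<forall>n. H u n = complex_of_real E * u n) \<longrightarrow> exp_decay u)"

definition Theta :: "real \<Rightarrow> real \<Rightarrow> real set" where
  "Theta \<alpha> \<sigma> = (\<Union>\<eta>\<in>{\<eta>. \<eta> > 0}. {\<theta>\<in>T0 \<alpha>.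
      \<forall>k::int. k \<noteq> 0 \<longrightarrow> tnorm (2 * \<theta> - of_int k * \<alpha>) \<ge> \<eta> / \<bar>of_int k\<bar> powr \<sigma>})"

end

theory Submission
  imports Defs
begin

text \<open>
  Put \<open>w m = cos (2 \<pi> (2 m \<alpha> + \<theta>))\<close>. Eliminating the constant hopping \<open>\<lambda>\<close> from \<open>H u = E u\<close> leaves, for
  \<open>\<psi> m = w m (u (2 m) + u (2 m + 1))\<close>, the equation
  \<open>w m (\<psi> (m + 1) + \<psi> (m - 1) + e \<psi> m) = g \<psi> m\<close> with \<open>e = 2 E / \<lambda>\<close> and \<open>g = (E\<^sup>2 - \<lambda>\<^sup>2) / \<lambda>\<close>.
  Its block determinants of length \<open>k\<close> are polynomials of degree \<open>k\<close> in the cosine of the phase at the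
  centre of the block. Their leading coefficient grows like \<open>\<rho> ^ k\<close> with \<open>\<rho> + 1 / \<rho> = \<bar>e\<bar>\<close>, and
  \<open>\<rho> > 1\<close> precisely when \<open>\<bar>E\<bar> > \<lambda>\<close>, so they grow at a rate \<open>L\<close> with \<open>L + ln 2 \<ge> ln \<rho> > 0\<close>, while
  products of \<open>k\<close> values of \<open>w\<close> decay like \<open>2 ^ (- k)\<close>. As in Jitomirskaya's argument for the almost
  Mathieu operator, Lagrange interpolation at nonresonant phases shows that a polynomially bounded
  solution decays exponentially. That the spectral measure of \<open>u\<close> is carried by such energies follows
  from the adjoint of the isometry \<open>p \<mapsto> p(H) u\<close> on \<open>L\<^sup>2(\<mu>)\<close>: it maps the unit vectors to functions
  whose values at \<open>\<mu>\<close>-almost every energy form a polynomially bounded solution.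
\<close>

section \<open>Products of sines along a Diophantine rotation\<close>

text \<open>The factors \<open>w m\<close> come arbitrarily close to 0, so transfer matrices, which
  divide by them, have no uniform bound. Determinants involve no division, and in Cramer's rule the
  \<open>w m\<close> stand in the numerator: a Green function entry of a block of length
  \<open>k\<close> is a determinant of length \<open>l\<close>, times \<open>k - l\<close> cosines,
  over a determinant of length \<open>k\<close>. Its exponent is
  \<open>L * l - ln 2 * (k - l) - L * k = - (L + ln 2) * (k - l)\<close>, so \<open>L + ln 2\<close>
  acts as the Lyapunov exponent, and its positivity drives the decay. The rate \<open>L\<close> is
  that of the supremum over all phases. Subadditivity yields it without ergodic theory, and upper
  bounds are then uniform in the phase. A matching lower bound fails at some phases; interpolation
  supplies it at one unknown node, which is why nodes are placed around two sites. All small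
  divisors enter through bounds, up to \<open>exp (\<epsilon> * n)\<close>, for products of
  \<open>chord\<close> along an orbit. These rest on the power series of the logarithm of 1 - z
  inside the unit disc, not on continued fractions.\<close>

definition chord :: "real \<Rightarrow> real" where
  "chord x = 2 * \<bar>sin (pi * x)\<bar>"

lemma norm_one_minus_cis: "norm (1 - cis (2 * pi * x)) = chord x"
proof -
  have "(norm (1 - cis (2 * pi * x)))\<^sup>2 = (1 - cos (2 * pi * x))\<^sup>2 + (sin (2 * pi * x))\<^sup>2"
    by (simp add: cmod_power2)
  also have "\<dots> = 2 - 2 * cos (2 * (pi * x))"
    using sin_cos_squared_add[of "2 * pi * x"]
    by (simp add: power2_eq_square algebra_simps)
  also have "\<dots> = (chord x)\<^sup>2"
    unfolding cos_double_sin chord_def by (simp add: power2_eq_square)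
  finally show ?thesis
    by (rule power2_eq_imp_eq) (auto simp: chord_def)
qed

lemma chord_nonneg [simp]: "0 \<le> chord x"
  by (simp add: chord_def)

lemma chord_le_2: "chord x \<le> 2"
  by (simp add: chord_def)

lemma chord_minus [simp]: "chord (- x) = chord x"
  by (simp add: chord_def)

lemma chord_minus_commute: "chord (x - y) = chord (y - x)"
  using chord_minus[of "y - x"] by (simp del: chord_minus)

lemma chord_triangle: "chord (x - y) \<le> chord x + chord y"
proof -
  have "chord (x - y) = 2 * \<bar>sin (pi*x) * cos (pi*y) - cos (pi*x) * sin (pi*y)\<bar>"
    unfolding chord_def by (simp add: right_diff_distrib sin_diff)
  also have "\<dots> \<le> 2 * (\<bar>sin (pi*x)\<bar> * \<bar>cos (pi*y)\<bar> + \<bar>cos (pi*x)\<bar> * \<bar>sin (pi*y)\<bar>)"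
    using abs_triangle_ineq4[of "sin (pi*x) * cos (pi*y)" "cos (pi*x) * sin (pi*y)"]
    by (simp add: abs_mult)
  also have "\<dots> \<le> 2 * (\<bar>sin (pi*x)\<bar> * 1 + 1 * \<bar>sin (pi*y)\<bar>)"
    by (intro mult_left_mono add_mono mult_right_mono) auto
  finally show ?thesis by (simp add: chord_def)
qed

text \<open>This factorisation decides which arithmetic is needed: at two nodes the sum of the
  phases is controlled by the nonresonance of \<theta>, the difference by the Diophantine
  condition.\<close>

lemma cos_diff_chord: "\<bar>cos (2*pi*x) - cos (2*pi*y)\<bar> = chord (x + y) * chord (x - y) / 2"
proof -
  have "cos (2*pi*x) - cos (2*pi*y) = 2 * sin ((2*pi*x + 2*pi*y)/2) * sin ((2*pi*y - 2*pi*x)/2)"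
    by (rule cos_diff_cos)
  also have "(2*pi*x + 2*pi*y)/2 = pi * (x + y)" by (simp add: field_simps)
  also have "(2*pi*y - 2*pi*x)/2 = - (pi * (x - y))" by (simp add: field_simps)
  finally show ?thesis by (simp add: chord_def abs_mult)
qed

text \<open>The doubled argument is the reason why products of cosines are treated as orbit products
  for twice the frequency.\<close>

lemma abs_two_cos_chord: "2 * \<bar>cos (2*pi*x)\<bar> = chord (2 * x + 1/2)"
proof -
  have "sin (pi * (2 * x + 1/2)) = cos (2*pi*x)"
    by (simp add: distrib_left sin_add mult_ac)
  thus ?thesis by (simp add: chord_def)
qed

text \<open>The squares differ by \<open>(1 - r)\<^sup>2 * (1 + c) / 2\<close> with \<open>c\<close>
  the cosine. The constant is optimal, with equality at \<open>x = 1/2\<close>. It tends to 1 with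
  \<open>r\<close>, so replacing \<open>chord\<close> by the smooth factor costs little per
  site.\<close>

lemma norm_one_minus_scaled_lower:
  fixes r :: real
  assumes "0 \<le> r" "r \<le> 1"
  shows "(1 + r) / 2 * chord x \<le> norm (1 - of_real r * cis (2*pi*x))"
proof -
  define c s where "c = cos (2*pi*x)" and "s = sin (2*pi*x)"
  have cs: "s\<^sup>2 = 1 - c\<^sup>2" by (simp add: c_def s_def sin_squared_eq)
  have c: "- 1 \<le> c" by (simp add: c_def)
  have "((1 + r) / 2 * chord x)\<^sup>2 = ((1 + r)/2)\<^sup>2 * ((1 - c)\<^sup>2 + s\<^sup>2)"
    unfolding norm_one_minus_cis[symmetric] power_mult_distrib
    by (simp add: cmod_power2 c_def s_def)
  also have "\<dots> = (1 - r * c)\<^sup>2 + (r * s)\<^sup>2 - (1 - r)\<^sup>2 * (1 + c) / 2"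
    unfolding power_mult_distrib cs by (simp add: power2_eq_square field_simps)
  also have "\<dots> \<le> (1 - r * c)\<^sup>2 + (r * s)\<^sup>2"
    using c by simp
  also have "\<dots> = (norm (1 - of_real r * cis (2*pi*x)))\<^sup>2"
    by (simp add: cmod_power2 c_def s_def)
  finally show ?thesis by (rule power2_le_imp_le) auto
qed

lemma norm_one_minus_scaled_upper:
  fixes r :: real
  assumes "0 \<le> r" "r \<le> 1"
  shows "norm (1 - of_real r * cis (2*pi*x)) \<le> chord x + (1 - r)"
proof -
  have "norm (1 - of_real r * cis (2*pi*x)) = norm ((1 - cis (2*pi*x)) + of_real (1 - r) * cis (2*pi*x))"
    by (simp add: algebra_simps)
  also have "\<dots> \<le> norm (1 - cis (2*pi*x)) + norm (of_real (1 - r) * cis (2*pi*x))"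
    by (rule norm_triangle_ineq)
  finally show ?thesis using assms by (simp add: norm_one_minus_cis norm_mult del: of_real_diff)
qed

text \<open>The exponent is a natural number; a real exponent is rounded up.\<close>

definition dioph :: "real \<Rightarrow> real \<Rightarrow> nat \<Rightarrow> bool" where
  "dioph \<omega> c N \<longleftrightarrow> c > 0 \<and> N \<ge> 1 \<and> (\<forall>d::int. d \<noteq> 0 \<longrightarrow> c \<le> chord (of_int d * \<omega>) * \<bar>of_int d\<bar> ^ N)"

lemma diophD: "dioph \<omega> c N \<Longrightarrow> d \<noteq> 0 \<Longrightarrow> c \<le> chord (of_int d * \<omega>) * \<bar>of_int d\<bar> ^ N"
  by (simp add: dioph_def)

lemma dioph_pos: "dioph \<omega> c N \<Longrightarrow> d \<noteq> 0 \<Longrightarrow> 0 < chord (of_int d * \<omega>)"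
  using diophD[of \<omega> c N d] by (cases "chord (of_int d * \<omega>) = 0") (auto simp: dioph_def less_le)

lemma summable_power_mult_geometric:
  fixes r :: real
  assumes "0 < r" "r < 1"
  shows "summable (\<lambda>k. real k ^ N * r ^ k)"
proof -
  define s where "s = (1 + r) / 2"
  have s: "r < s" "s < 1" using assms by (auto simp: s_def)
  have "(\<lambda>k. (1 + inverse (real (Suc k))) ^ N * r) \<longlonglongrightarrow> (1 + 0) ^ N * r"
    by (intro tendsto_intros LIMSEQ_inverse_real_of_nat)
  hence "eventually (\<lambda>k. (1 + inverse (real (Suc k))) ^ N * r < s) sequentially"
    using s by (intro order_tendstoD(2)[where y = "(1 + 0) ^ N * r"]) auto
  then obtain K where K: "\<And>k. k \<ge> K \<Longrightarrow> (1 + inverse (real (Suc k))) ^ N * r < s"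
    by (auto simp: eventually_sequentially)
  show ?thesis
  proof (rule summable_ratio_test[OF s(2), where N = "Suc K"])
    fix n assume n: "Suc K \<le> n"
    then obtain k where k: "n = Suc k" "k \<ge> K" by (metis Suc_le_D Suc_le_mono)
    have "real (Suc n) = real n * (1 + inverse (real (Suc k)))"
      unfolding k by (simp add: field_simps)
    hence "real (Suc n) ^ N * r ^ Suc n = (real n ^ N * r ^ n) * ((1 + inverse (real (Suc k))) ^ N * r)"
      by (simp only: power_mult_distrib power_Suc mult_ac)
    also have "\<dots> \<le> (real n ^ N * r ^ n) * s"
      using K[OF k(2)] assms by (intro mult_left_mono) auto
    finally show "norm (real (Suc n) ^ N * r ^ Suc n) \<le> s * norm (real n ^ N * r ^ n)"
      using assms by (simp add: mult_ac norm_mult norm_power)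
  qed
qed

text \<open>Expand each logarithm in powers of its point of modulus \<open>r\<close>. For a fixed
  frequency \<open>k\<close> the sum over the orbit is geometric, at most
  \<open>2 / chord (k * \<omega>)\<close>, hence of order \<open>k ^ N\<close>, and
  \<open>r ^ k\<close> makes the series converge. The bound depends neither on the starting phase
  nor on the length.\<close>

lemma log_prod_scaled_bound:
  assumes D: "dioph \<omega> c N" and r: "0 < r" "r < 1"
  obtains C where "C > 0" "\<And>x n. \<bar>\<Sum>j<n. ln (norm (1 - of_real r * cis (2*pi*(x + of_nat j * \<omega>))))\<bar> \<le> C"
proof -
  define g where "g k = 2 / c * (real k ^ N * r ^ k)" for k :: nat
  have c: "c > 0" and N: "N \<ge> 1" using D by (auto simp: dioph_def)
  have "summable (\<lambda>k. real k ^ N * r ^ k)"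
    using r by (rule summable_power_mult_geometric)
  hence sg: "summable g" unfolding g_def by (rule summable_mult)
  have g0: "g k \<ge> 0" for k using c r by (simp add: g_def)
  have main: "\<bar>\<Sum>j<n. ln (norm (1 - of_real r * cis (2*pi*(x + of_nat j * \<omega>))))\<bar> \<le> suminf g" for x n
  proof -
    let ?w = "\<lambda>j. of_real r * cis (2*pi*(x + of_nat j * \<omega>))"
    have w1: "norm (?w j) < 1" for j using r by (simp add: norm_mult)
    have ln1: "(\<lambda>k. - Re ((?w j)^k) / of_nat k) sums ln (norm (1 - ?w j))" for j
    proof -
      have "(\<lambda>n. (-1) ^ Suc n / of_nat n * (- ?w j)^n) sums Ln (1 + (- ?w j))"
        using w1 by (intro Ln_series) simp
      hence "(\<lambda>n. Re ((-1) ^ Suc n / of_nat n * (- ?w j)^n)) sums Re (Ln (1 + (- ?w j)))"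
        by (rule sums_Re)
      moreover have "(-1) ^ Suc n / of_nat n * (- ?w j)^n = - ((?w j)^n / of_nat n)" for n
        by (simp add: power_minus[of "?w j"])
      moreover have "Re (Ln (1 + (- ?w j))) = ln (norm (1 - ?w j))"
      proof -
        have "1 - ?w j \<noteq> 0" using w1[of j] by auto
        thus ?thesis by (subst Re_Ln) auto
      qed
      ultimately show ?thesis by (simp only: Re_divide_of_nat uminus_complex.simps) simp
    qed
    have s: "(\<lambda>k. \<Sum>j<n. - Re ((?w j)^k) / of_nat k) sums (\<Sum>j<n. ln (norm (1 - ?w j)))"
      by (intro sums_sum ln1)
    have b: "\<bar>\<Sum>j<n. - Re ((?w j)^k) / of_nat k\<bar> \<le> g k" for k
    proof (cases "k = 0")
      case True thus ?thesis using g0 by simp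
    next
      case False
      define q where "q = cis (2*pi*(of_int (int k) * \<omega>))"
      have ch: "norm (1 - q) = chord (of_int (int k) * \<omega>)" unfolding q_def by (rule norm_one_minus_cis)
      have chp: "norm (1 - q) > 0" unfolding ch using False by (intro dioph_pos[OF D]) auto
      have wk: "(?w j)^k = of_real (r^k) * cis (2*pi*real k*x) * q^j" for j
      proof -
        have "real k * (2*pi*(x + of_nat j * \<omega>)) = 2*pi*real k*x + real j * (2*pi*(of_int (int k) * \<omega>))"
          by (simp add: algebra_simps)
        thus ?thesis unfolding q_def power_mult_distrib Complex.DeMoivre by (simp add: cis_mult)
      qed
      have "(\<Sum>j<n. - Re ((?w j)^k) / of_nat k) = - Re (\<Sum>j<n. (?w j)^k) / of_nat k"
        by (simp add: sum_negf sum_divide_distrib)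
      hence "\<bar>\<Sum>j<n. - Re ((?w j)^k) / of_nat k\<bar> \<le> norm (\<Sum>j<n. (?w j)^k) / of_nat k"
        using abs_Re_le_cmod[of "\<Sum>j<n. (?w j)^k"] by (simp add: divide_right_mono)
      also have "\<dots> \<le> norm (\<Sum>j<n. (?w j)^k) / 1"
        using False by (intro divide_left_mono) auto
      also have "(\<Sum>j<n. (?w j)^k) = of_real (r^k) * cis (2*pi*real k*x) * (\<Sum>j<n. q^j)"
        unfolding wk by (simp add: sum_distrib_left)
      also have "norm \<dots> = r^k * norm (\<Sum>j<n. q^j)" using r by (simp add: norm_mult norm_power)
      also have "(\<Sum>j<n. q^j) = (1 - q^n) / (1 - q)"
        using chp by (subst sum_gp_strict) auto
      also have "norm \<dots> \<le> 2 / norm (1 - q)"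
        unfolding norm_divide
        by (intro divide_right_mono order.trans[OF norm_triangle_ineq4]) (auto simp: q_def norm_power)
      also have "2 / norm (1 - q) \<le> 2 * real k ^ N / c"
        using diophD[OF D, of "int k"] False chp c unfolding ch by (simp add: field_simps)
      finally show ?thesis using r by (simp add: g_def mult_ac mult_left_mono)
    qed
    have "norm (suminf (\<lambda>k. \<Sum>j<n. - Re ((?w j)^k) / of_nat k)) \<le> suminf g"
      using b by (intro norm_suminf_le sg) auto
    thus ?thesis using sums_unique[OF s] by simp
  qed
  have "suminf g \<ge> 0" using g0 sg by (intro suminf_nonneg) auto
  hence "0 < suminf g + 1" by simp
  moreover have "\<And>x n. \<bar>\<Sum>j<n. ln (norm (1 - of_real r * cis (2*pi*(x + of_nat j * \<omega>))))\<bar> \<le> suminf g + 1"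
    using main by (meson less_eq_real_def order_trans le_add_same_cancel1 zero_le_one)
  ultimately show ?thesis by (rule that)
qed

text \<open>Here \<open>r\<close> is chosen with \<open>(1 + r) / 2 = exp (- e)\<close>, and
  \<open>e < ln 2\<close> keeps it positive. Each chord is then at most \<open>exp e\<close> times
  the factor of radius \<open>r\<close>, whose full product is bounded. The omitted index costs
  \<open>1 / (1 - r)\<close>, since no such factor is below \<open>1 - r\<close>.\<close>

lemma prod_chord_upper:
  assumes D: "dioph \<omega> c N" and eps: "\<epsilon> > 0"
  obtains C where "C > 0"
    "\<And>x n i. (\<Prod>j\<in>{..<n} - {i}. chord (x + of_nat j * \<omega>)) \<le> C * exp (\<epsilon> * of_nat n)"
proof -
  define e where "e = min \<epsilon> (ln 2 / 2)"
  define r where "r = 2 * exp (- e) - 1"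
  have e: "e > 0" "e < ln 2" "e \<le> \<epsilon>" using eps by (auto simp: e_def min_def)
  have "exp (- ln 2) < exp (- e)" using e by simp
  hence r0: "r > 0" by (simp add: r_def exp_minus)
  have r1: "r < 1" using e by (simp add: r_def)
  have re: "(1 + r) / 2 = exp (- e)" by (simp add: r_def)
  obtain C where C: "C > 0"
    "\<And>x n. \<bar>\<Sum>j<n. ln (norm (1 - of_real r * cis (2*pi*(x + of_nat j * \<omega>))))\<bar> \<le> C"
    using log_prod_scaled_bound[OF D r0 r1] by blast
  show ?thesis
  proof (rule that[of "exp C / (1 - r)"])
    show "0 < exp C / (1 - r)" using r1 by simp
    fix x :: real and n i :: nat
    let ?w = "\<lambda>j. norm (1 - of_real r * cis (2*pi*(x + of_nat j * \<omega>)))"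
    let ?A = "{..<n} - {i}"
    have wge: "1 - r \<le> ?w j" for j
      using norm_triangle_ineq2[of 1 "of_real r * cis (2*pi*(x + of_nat j * \<omega>))"] r0
      by (simp add: norm_mult)
    have wpos: "0 < ?w j" for j using wge[of j] r1 by linarith
    have ch: "chord (x + of_nat j * \<omega>) \<le> exp e * ?w j" for j
      using norm_one_minus_scaled_lower[of r "x + of_nat j * \<omega>"] r0 r1 unfolding re
      by (simp add: exp_minus field_simps)
    have "(\<Prod>j<n. ?w j) = exp (\<Sum>j<n. ln (?w j))"
      using wpos by (simp add: exp_sum)
    also have "\<dots> \<le> exp C" using C(2)[of x n] by simp
    finally have all: "(\<Prod>j<n. ?w j) \<le> exp C" .
    have "(\<Prod>j\<in>?A. ?w j) * (1 - r) \<le> (\<Prod>j<n. ?w j)"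
    proof (cases "i < n")
      case True
      hence "(\<Prod>j<n. ?w j) = ?w i * (\<Prod>j\<in>?A. ?w j)" by (intro prod.remove) auto
      also have "\<dots> \<ge> (1 - r) * (\<Prod>j\<in>?A. ?w j)"
        using wge by (intro mult_right_mono prod_nonneg) auto
      finally show ?thesis by (simp add: mult.commute)
    next
      case False
      hence "?A = {..<n}" by auto
      moreover have "(\<Prod>j\<in>{..<n}. ?w j) * (1 - r) \<le> (\<Prod>j\<in>{..<n}. ?w j) * 1"
        using r0 by (intro mult_left_mono prod_nonneg) auto
      ultimately show ?thesis by simp
    qed
    hence A: "(\<Prod>j\<in>?A. ?w j) \<le> exp C / (1 - r)"
      using all r1 by (simp add: field_simps)
    have "(\<Prod>j\<in>?A. chord (x + of_nat j * \<omega>)) \<le> (\<Prod>j\<in>?A. exp e * ?w j)"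
      using ch by (intro prod_mono) auto
    also have "\<dots> = exp e ^ card ?A * (\<Prod>j\<in>?A. ?w j)" by (simp add: prod.distrib)
    also have "\<dots> \<le> exp e ^ n * (exp C / (1 - r))"
    proof (intro mult_mono A prod_nonneg power_increasing)
      show "card ?A \<le> n" using card_mono[of "{..<n}" ?A] by auto
    qed (use e in auto)
    also have "\<dots> \<le> exp \<epsilon> ^ n * (exp C / (1 - r))"
      using e r1 by (intro mult_right_mono power_mono) auto
    also have "\<dots> = exp C / (1 - r) * exp (\<epsilon> * of_nat n)" by (simp add: exp_of_nat2_mult)
    finally show "(\<Prod>j\<in>?A. chord (x + of_nat j * \<omega>)) \<le> exp C / (1 - r) * exp (\<epsilon> * of_nat n)" .
  qed
qed

text \<open>Two orbit points close to an integer have a difference \<open>d\<close> with \<open>d * \<omega>\<close> close to an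
  integer, so the Diophantine condition forces a gap between them.\<close>

lemma card_near_le:
  assumes D: "dioph \<omega> c N" and m: "2 * (1/2) ^ (N * m) \<le> c" and s: "m \<le> s"
  shows "card {j\<in>{..<n}. chord (x + of_nat j * \<omega>) < (1/2) ^ (N * s)} \<le> n div 2 ^ (s - m) + 1"
    (is "card ?A \<le> _")
proof -
  \<comment> \<open>A window of \<open>?q\<close> consecutive indices holds at most one near point:
    for two of them, at distance \<open>d < ?q\<close>, the product
    \<open>chord (d * \<omega>) * d ^ N\<close> would fall below \<open>c\<close> by the choice of
    \<open>m\<close>.\<close>
  let ?q = "2 ^ (s - m) :: nat"
  have "inj_on (\<lambda>j. j div ?q) ?A"
  proof (rule linorder_inj_onI')
    fix i j assume ij: "i \<in> ?A" "j \<in> ?A" "i < j"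
    show "i div ?q \<noteq> j div ?q"
    proof
      assume eq: "i div ?q = j div ?q"
      define d where "d = j - i"
      have d: "d > 0" using ij by (simp add: d_def)
      have "j = j div ?q * ?q + j mod ?q" "i = i div ?q * ?q + i mod ?q"
        by (simp_all only: div_mult_mod_eq)
      hence "d \<le> j mod ?q" unfolding d_def eq by linarith
      also have "\<dots> < ?q" by simp
      finally have dq: "d < ?q" .
      have "chord (of_int (int d) * \<omega>) = chord ((x + of_nat j * \<omega>) - (x + of_nat i * \<omega>))"
        using ij by (simp add: d_def algebra_simps of_nat_diff)
      also have "\<dots> \<le> chord (x + of_nat j * \<omega>) + chord (x + of_nat i * \<omega>)" by (rule chord_triangle)
      also have "\<dots> < 2 * (1/2) ^ (N * s)" using ij by simp
      finally have lt: "chord (of_int (int d) * \<omega>) < 2 * (1/2) ^ (N * s)" .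
      have "c \<le> chord (of_int (int d) * \<omega>) * \<bar>of_int (int d)\<bar> ^ N"
        using d by (intro diophD[OF D]) auto
      also have "\<dots> < 2 * (1/2) ^ (N * s) * \<bar>of_int (int d)\<bar> ^ N"
        using lt d by (intro mult_strict_right_mono) auto
      also have "\<dots> \<le> 2 * (1/2) ^ (N * s) * (2 ^ (s - m)) ^ N"
      proof (intro mult_left_mono power_mono)
        have "real d \<le> real ?q" using dq by (intro of_nat_mono) simp
        thus "\<bar>of_int (int d)\<bar> \<le> (2 ^ (s - m) :: real)" by simp
      qed auto
      also have "\<dots> = 2 * (1/2) ^ (N * m)"
      proof -
        have "N * s = N * m + (s - m) * N" using s by (metis le_add_diff_inverse distrib_left mult.commute)
        hence "(1/2::real) ^ (N * s) = (1/2) ^ (N * m) * ((1/2) ^ (s - m)) ^ N"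
          by (simp add: power_add power_mult)
        thus ?thesis by (simp add: power_mult_distrib[symmetric] power_one_over)
      qed
      also have "\<dots> \<le> c" by (rule m)
      finally show False by simp
    qed
  qed
  hence "card ?A = card ((\<lambda>j. j div ?q) ` ?A)" by (simp add: card_image)
  also have "\<dots> \<le> card {..n div ?q}"
    by (intro card_mono) (auto intro!: div_le_mono)
  finally show ?thesis by simp
qed

text \<open>A layer-cake count: \<open>- ln\<close> of a factor is at most \<open>N * ln 2\<close>
  times the number of scales \<open>t\<close> with the factor below \<open>(1/2) ^ (N * t)\<close>.
  Exchanging the sums leaves the counts \<open>K t\<close>. For \<open>t < s\<close> they are at
  most \<open>K s\<close>, because all of \<open>A\<close> is near at scale \<open>s\<close>; from
  \<open>s\<close> to \<open>S\<close> they form a geometric series plus 1 per scale.\<close>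

lemma sum_ln_near_lower:
  assumes D: "dioph \<omega> c N" and m: "2 * (1/2) ^ (N * m) \<le> c" and ms: "m \<le> s" "s \<le> S"
    and A: "A \<subseteq> {..<n}"
    and near: "\<And>j. j \<in> A \<Longrightarrow> chord (x + of_nat j * \<omega>) < (1/2) ^ (N * s)"
    and low: "\<And>j. j \<in> A \<Longrightarrow> (1/2) ^ (N * S) \<le> chord (x + of_nat j * \<omega>)"
  shows "(\<Sum>j\<in>A. - ln (chord (x + of_nat j * \<omega>)))
     \<le> N * ln 2 * ((real s + 2) * (n / 2 ^ (s - m)) + s + S)"
proof -
  let ?f = "\<lambda>j. chord (x + of_nat j * \<omega>)"
  have fin: "finite A" using A finite_subset by blast
  define K where "K t = card {j\<in>A. ?f j < (1/2) ^ (N * t)}" for t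
  have K: "real (K t) \<le> n / 2 ^ (t - m) + 1" if "m \<le> t" for t
  proof -
    have "K t \<le> card {j\<in>{..<n}. ?f j < (1/2) ^ (N * t)}"
      unfolding K_def using A by (intro card_mono) auto
    also have "\<dots> \<le> n div 2 ^ (t - m) + 1" using D m that by (rule card_near_le)
    finally have "real (K t) \<le> real (n div 2 ^ (t - m)) + 1" by linarith
    moreover have "real (n div 2 ^ (t - m)) \<le> n / 2 ^ (t - m)"
      using of_nat_div_le_of_nat[of n "2 ^ (t - m)", where 'a = real] by simp
    ultimately show ?thesis by linarith
  qed
  have Ks: "K t \<le> K s" for t
    unfolding K_def using near fin by (intro card_mono) auto
  have one: "- ln (?f j) \<le> N * ln 2 * real (card {t\<in>{..<S}. ?f j < (1/2) ^ (N * t)})" if j: "j \<in> A" for j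
  proof -
    define T where "T = (LEAST t. (1/2) ^ (N * t) \<le> ?f j)"
    have T1: "(1/2) ^ (N * T) \<le> ?f j" unfolding T_def by (rule LeastI[of _ S]) (rule low[OF j])
    have T2: "T \<le> S" unfolding T_def by (rule Least_le) (rule low[OF j])
    have T3: "?f j < (1/2) ^ (N * t)" if "t < T" for t
      using not_less_Least[OF that[unfolded T_def]] by simp
    have "card {..<T} \<le> card {t\<in>{..<S}. ?f j < (1/2) ^ (N * t)}"
      using T2 T3 by (intro card_mono) auto
    hence cT: "real T \<le> real (card {t\<in>{..<S}. ?f j < (1/2) ^ (N * t)})" by simp
    have "ln ((1/2) ^ (N * T)) \<le> ln (?f j)" using T1 by (subst ln_le_cancel_iff) (auto intro: less_le_trans[OF _ T1])
    moreover have "ln ((1/2::real) ^ (N * T)) = - (N * ln 2 * T)"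
      by (subst ln_realpow) (auto simp: ln_div)
    ultimately have "- ln (?f j) \<le> N * ln 2 * T" by simp
    also have "\<dots> \<le> N * ln 2 * real (card {t\<in>{..<S}. ?f j < (1/2) ^ (N * t)})"
      using cT by (intro mult_left_mono) auto
    finally show ?thesis .
  qed
  have "(\<Sum>j\<in>A. real (card {t\<in>{..<S}. ?f j < (1/2) ^ (N * t)}))
      = (\<Sum>j\<in>A. \<Sum>t<S. if ?f j < (1/2) ^ (N * t) then 1 else 0)"
    by (intro sum.cong refl) (simp add: sum.If_cases Int_def)
  also have "\<dots> = (\<Sum>t<S. \<Sum>j\<in>A. if ?f j < (1/2) ^ (N * t) then 1 else 0)" by (rule sum.swap)
  also have "\<dots> = (\<Sum>t<S. real (K t))"
    unfolding K_def using fin by (intro sum.cong refl) (simp add: sum.If_cases Int_def)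
  also have "\<dots> = (\<Sum>t<s. real (K t)) + (\<Sum>t=s..<S. real (K t))"
    using ms sum.atLeastLessThan_concat[of 0 s S "\<lambda>t. real (K t)"] by (simp add: lessThan_atLeast0)
  also have "(\<Sum>t<s. real (K t)) \<le> (\<Sum>t<s. n / 2 ^ (s - m) + 1)"
    using Ks K[OF ms(1)] by (intro sum_mono) (meson of_nat_mono order_trans)
  also have "\<dots> = s * (n / 2 ^ (s - m) + 1)" by simp
  also have "(\<Sum>t=s..<S. real (K t)) \<le> (\<Sum>t=s..<S. n / 2 ^ (t - m) + 1)"
    using K ms by (intro sum_mono) auto
  also have "\<dots> = (\<Sum>i<S-s. n / 2 ^ (s - m) * (1/2) ^ i + 1)"
    by (rule sum.reindex_bij_witness[of _ "\<lambda>i. i + s" "\<lambda>i. i - s"])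
       (use ms in \<open>auto simp: power_one_over power_add[symmetric] simp flip: Nat.add_diff_assoc\<close>)
  also have "\<dots> = n / 2 ^ (s - m) * (\<Sum>i<S-s. (1/2) ^ i) + (S - s)"
    by (simp add: sum.distrib sum_distrib_left)
  also have "\<dots> \<le> n / 2 ^ (s - m) * 2 + S"
  proof (intro add_mono mult_left_mono)
    show "(\<Sum>i<S-s. (1/2::real) ^ i) \<le> 2" by (subst sum_gp_strict) auto
  qed auto
  finally have tot: "(\<Sum>j\<in>A. real (card {t\<in>{..<S}. ?f j < (1/2) ^ (N * t)}))
      \<le> (real s + 2) * (n / 2 ^ (s - m)) + s + S" by (simp add: algebra_simps add_divide_distrib)
  have "(\<Sum>j\<in>A. - ln (?f j)) \<le> (\<Sum>j\<in>A. N * ln 2 * real (card {t\<in>{..<S}. ?f j < (1/2) ^ (N * t)}))"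
    by (intro sum_mono one)
  also have "\<dots> = N * ln 2 * (\<Sum>j\<in>A. real (card {t\<in>{..<S}. ?f j < (1/2) ^ (N * t)}))"
    by (simp add: sum_distrib_left)
  also have "\<dots> \<le> N * ln 2 * ((real s + 2) * (n / 2 ^ (s - m)) + s + S)"
    using tot by (intro mult_left_mono) auto
  finally show ?thesis .
qed

lemma ln_le_linear:
  fixes \<delta> :: real
  assumes "\<delta> > 0" "x > 0"
  shows "ln x \<le> \<delta> * x - ln \<delta>"
  using ln_le_minus_one[of "\<delta> * x"] assms by (simp add: ln_mult)

text \<open>Factors at least \<open>\<delta>\<close> are compared with those of radius \<open>r = 1 - \<delta>\<^sup>2\<close>, whose total product is
  bounded below by \<open>log_prod_scaled_bound\<close>; the few smaller ones are counted on dyadic scales.\<close>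

lemma prod_chord_lower:
  assumes D: "dioph \<omega> c N" and eps: "\<epsilon> > 0" and b: "b > 0"
  obtains C where "C > 0"
    "\<And>x n A. \<lbrakk>A \<subseteq> {..<n}; \<And>j. j \<in> {..<n} - A \<Longrightarrow> chord (x + of_nat j * \<omega>) = 0;
       \<And>j. j \<in> A \<Longrightarrow> b \<le> chord (x + of_nat j * \<omega>) * of_nat n ^ B\<rbrakk>
      \<Longrightarrow> exp (- \<epsilon> * of_nat n) \<le> C * (\<Prod>j\<in>A. chord (x + of_nat j * \<omega>))"
proof -
  have c: "c > 0" and N: "N \<ge> 1" using D by (auto simp: dioph_def)
  obtain m where m: "2 * (1/2) ^ (N * m) \<le> c"
  proof -
    obtain m where "(1/2::real) ^ m < c / 2" using real_arch_pow_inv[of "c/2" "1/2"] c by auto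
    moreover have "(1/2::real) ^ (N * m) \<le> (1/2) ^ m" using N by (intro power_decreasing) auto
    ultimately show ?thesis by (intro that[of m]) linarith
  qed
  \<comment> \<open>This is the cost per site in \<open>sum_ln_near_lower\<close> for
    \<open>s = m + t\<close>. It tends to 0 because the density of near indices is of order
    \<open>(1/2) ^ t\<close>.\<close>
  have "(\<lambda>t. N * ln 2 * ((real m + 2) * (1/2) ^ t + real t * (1/2) ^ t)) \<longlonglongrightarrow> N * ln 2 * ((real m + 2) * 0 + 0)"
    by (intro tendsto_intros LIMSEQ_realpow_zero summable_LIMSEQ_zero
          summable_power_mult_geometric[of "1/2" 1, simplified]) auto
  hence "eventually (\<lambda>t. N * ln 2 * ((real m + 2) * (1/2) ^ t + real t * (1/2) ^ t) < \<epsilon> / 3) sequentially"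
    using eps by (intro order_tendstoD(2)[where y = "N * ln 2 * ((real m + 2) * 0 + 0)"]) auto
  moreover have "eventually (\<lambda>t. (1/2::real) ^ t < \<epsilon> / 3) sequentially"
    using eps by (intro order_tendstoD(2)[where y = 0] LIMSEQ_realpow_zero) auto
  ultimately have "eventually (\<lambda>t. N * ln 2 * ((real m + 2) * (1/2) ^ t + real t * (1/2) ^ t) < \<epsilon> / 3
      \<and> (1/2::real) ^ t < \<epsilon> / 3 \<and> t \<ge> 1) sequentially"
    using eventually_ge_at_top[of 1] by eventually_elim auto
  then obtain t where t: "N * ln 2 * ((real m + 2) * (1/2) ^ t + real t * (1/2) ^ t) < \<epsilon> / 3"
    "(1/2::real) ^ t < \<epsilon> / 3" "t \<ge> 1"
    by (metis (no_types, lifting) eventually_happens' sequentially_bot)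
  define s where "s = m + t"
  define \<delta> :: real where "\<delta> = (1/2) ^ (N * s)"
  \<comment> \<open>Passing to radius \<open>r\<close> adds at most \<open>\<delta>\<^sup>2\<close>
    to a factor, hence a relative error of at most \<delta> where the factor is at least
    \<delta>.\<close>
  define r where "r = 1 - \<delta>\<^sup>2"
  have "N * s \<ge> s" using N by simp
  hence Ns: "N * s \<ge> t" unfolding s_def by linarith
  have \<delta>: "\<delta> > 0" "\<delta> \<le> 1/2" "\<delta> \<le> \<epsilon> / 3"
  proof -
    show "\<delta> > 0" by (simp add: \<delta>_def)
    have "\<delta> \<le> (1/2) ^ t" unfolding \<delta>_def using Ns by (intro power_decreasing) auto
    moreover have "(1/2::real) ^ t \<le> (1/2) ^ 1" using t(3) by (intro power_decreasing) auto
    ultimately show "\<delta> \<le> 1/2" "\<delta> \<le> \<epsilon> / 3" using t(2) by auto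
  qed
  have d2: "\<delta>\<^sup>2 \<le> 1/2 * \<delta>" unfolding power2_eq_square using \<delta> by (intro mult_right_mono) auto
  have r: "0 < r" "r < 1" using d2 \<delta> by (auto simp: r_def)
  obtain C1 where C1: "C1 > 0"
    "\<And>x n. \<bar>\<Sum>j<n. ln (norm (1 - of_real r * cis (2*pi*(x + of_nat j * \<omega>))))\<bar> \<le> C1"
    using log_prod_scaled_bound[OF D r] by blast
  \<comment> \<open>Chosen so that \<open>ln_le_linear\<close> trades \<open>N * B * ln n\<close>
    for \<open>n * \<epsilon> / 3\<close> plus a constant; the \<open>+ 1\<close> covers
    \<open>B = 0\<close>.\<close>
  define \<delta>' where "\<delta>' = \<epsilon> / (3 * (N * B + 1))"
  have "0 < N * B + (1::real)" by (intro add_nonneg_pos) auto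
  hence \<delta>': "\<delta>' > 0" using eps unfolding \<delta>'_def by (intro divide_pos_pos mult_pos_pos) auto
  define C2 where "C2 = N * B * \<bar>ln \<delta>'\<bar> + N * \<bar>ln b\<bar> + N * ln 2 * (2 * s + 1)"
  show ?thesis
  proof (rule that[of "exp (C1 + C2)"])
    fix x :: real and n :: nat and A
    assume A: "A \<subseteq> {..<n}" and zero: "\<And>j. j \<in> {..<n} - A \<Longrightarrow> chord (x + of_nat j * \<omega>) = 0"
      and low: "\<And>j. j \<in> A \<Longrightarrow> b \<le> chord (x + of_nat j * \<omega>) * of_nat n ^ B"
    let ?f = "\<lambda>j. chord (x + of_nat j * \<omega>)"
    let ?w = "\<lambda>j. norm (1 - of_real r * cis (2*pi*(x + of_nat j * \<omega>)))"
    have fin: "finite A" using A finite_subset by blast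
    have pos: "0 < ?f j" if "j \<in> A" for j
      using low[OF that] b by (cases "?f j = 0") (auto simp: less_le)
    have "0 \<le> C2" unfolding C2_def by (intro add_nonneg_nonneg mult_nonneg_nonneg) auto
    have "(\<Sum>j\<in>A. ln (?f j)) \<ge> - \<epsilon> * n - (C1 + C2)"
    proof (cases "n = 0")
      case True
      thus ?thesis using A C1(1) \<open>0 \<le> C2\<close> by simp
    next
      case False
      define F where "F = {j\<in>{..<n}. ?f j \<ge> \<delta>}"
      have FA: "F \<subseteq> A" using zero \<delta>(1) by (force simp: F_def)
      have wpos: "0 < ?w j" for j
      proof -
        have "1 - r \<le> ?w j"
          using norm_triangle_ineq2[of 1 "of_real r * cis (2*pi*(x + of_nat j * \<omega>))"] r
          by (simp add: norm_mult)
        thus ?thesis using r by linarith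
      qed
      have far: "(\<Sum>j\<in>F. ln (?f j)) \<ge> - C1 - n * (\<epsilon> / 3)"
      proof -
        have "ln (?f j) \<ge> ln (?w j) - \<epsilon> / 3" if j: "j \<in> F" for j
        proof -
          have fj: "?f j \<ge> \<delta>" using j by (simp add: F_def)
          have "?w j \<le> ?f j + \<delta>\<^sup>2"
            using norm_one_minus_scaled_upper[of r "x + of_nat j * \<omega>"] r by (simp add: r_def)
          also have "\<dots> \<le> ?f j * (1 + \<delta>)"
            using fj \<delta>(1) by (simp add: algebra_simps power2_eq_square)
          finally have le: "?w j \<le> ?f j * (1 + \<delta>)" .
          have "0 < ?f j * (1 + \<delta>)" using wpos le by (rule order.strict_trans2)
          hence "ln (?w j) \<le> ln (?f j * (1 + \<delta>))" using wpos le by (subst ln_le_cancel_iff)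
          also have "\<dots> = ln (?f j) + ln (1 + \<delta>)" using pos[of j] FA j \<delta>(1) by (subst ln_mult) auto
          also have "ln (1 + \<delta>) \<le> \<delta>" using \<delta>(1) by (intro ln_add_one_self_le_self) auto
          finally show ?thesis using \<delta>(3) by linarith
        qed
        hence "(\<Sum>j\<in>F. ln (?f j)) \<ge> (\<Sum>j\<in>F. ln (?w j) - \<epsilon> / 3)" by (intro sum_mono)
        also have "(\<Sum>j\<in>F. ln (?w j) - \<epsilon> / 3) = (\<Sum>j\<in>F. ln (?w j)) - card F * (\<epsilon> / 3)"
          by (simp add: sum_subtractf)
        finally have 1: "(\<Sum>j\<in>F. ln (?f j)) \<ge> (\<Sum>j\<in>F. ln (?w j)) - card F * (\<epsilon> / 3)" .
        have "card F \<le> card {..<n}" unfolding F_def by (intro card_mono) auto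
        hence 2: "card F * (\<epsilon> / 3) \<le> n * (\<epsilon> / 3)" using eps by (intro mult_right_mono) auto
        \<comment> \<open>The near factors of radius \<open>r\<close> are at most 1, so removing
          them from the total, which is at least \<open>- C1\<close>, can only raise it.\<close>
        have "ln (?w j) \<le> 0" if j: "j \<in> {..<n} - F" for j
        proof -
          have "?w j \<le> ?f j + \<delta>\<^sup>2"
            using norm_one_minus_scaled_upper[of r "x + of_nat j * \<omega>"] r by (simp add: r_def)
          also have "\<dots> \<le> 1" using j d2 \<delta>(2) by (auto simp: F_def)
          finally show ?thesis using wpos[of j] by simp
        qed
        hence "(\<Sum>j\<in>{..<n}-F. ln (?w j)) \<le> 0" by (intro sum_nonpos)
        moreover have "(\<Sum>j<n. ln (?w j)) = (\<Sum>j\<in>{..<n}-F. ln (?w j)) + (\<Sum>j\<in>F. ln (?w j))"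
          by (intro sum.subset_diff) (auto simp: F_def)
        ultimately show ?thesis using C1(2)[of x n] 1 2 by linarith
      qed
      \<comment> \<open>By \<open>low\<close>, \<open>1 / y\<close> bounds every factor from
        \<open>A\<close> from below. Hence \<open>S\<close> is a last scale that suffices, and it
        grows only like \<open>ln n\<close>.\<close>
      define y where "y = of_nat n ^ B / b"
      define S where "S = s + nat \<lceil>ln y / ln 2\<rceil>"
      have ypos: "y > 0" using False b by (simp add: y_def)
      have S1: "ln y \<le> S * ln 2"
      proof -
        have "ln y / ln 2 \<le> S" unfolding S_def by (simp add: real_nat_ceiling_ge add_increasing)
        thus ?thesis by (simp add: field_simps)
      qed
      have S2: "ln 2 * S \<le> ln 2 * (s + 1) + \<bar>ln y\<bar>"
      proof -
        have "real (nat \<lceil>ln y / ln 2\<rceil>) \<le> \<bar>ln y / ln 2\<bar> + 1" by linarith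
        hence "S \<le> s + 1 + \<bar>ln y\<bar> / ln 2" unfolding S_def by simp
        hence "ln 2 * S \<le> ln 2 * (s + 1 + \<bar>ln y\<bar> / ln 2)" by (intro mult_left_mono) auto
        also have "\<dots> = ln 2 * (s + 1) + \<bar>ln y\<bar>" by (simp add: distrib_left)
        finally show ?thesis .
      qed
      have lowS: "(1/2) ^ (N * S) \<le> ?f j" if "j \<in> A" for j
      proof -
        have "(1/2::real) ^ (N * S) \<le> (1/2) ^ S" using N by (intro power_decreasing) auto
        also have "\<dots> = exp (- (S * ln 2))" by (simp add: exp_minus exp_of_nat_mult power_one_over inverse_eq_divide)
        also have "\<dots> \<le> exp (- ln y)" using S1 by simp
        also have "\<dots> = b / of_nat n ^ B" using ypos by (simp add: exp_minus y_def)
        also have "\<dots> \<le> ?f j" using low[OF that] False by (simp add: field_simps)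
        finally show ?thesis .
      qed
      have near0: "(\<Sum>j\<in>A-F. - ln (?f j)) \<le> N * ln 2 * ((real s + 2) * (n / 2 ^ (s - m)) + s + S)"
      proof (rule sum_ln_near_lower[OF D m])
        show "?f j < (1/2) ^ (N * s)" if "j \<in> A - F" for j
          using that A by (auto simp: F_def \<delta>_def)
      qed (use lowS A in \<open>auto simp: s_def S_def\<close>)
      have "N * ln 2 * ((real s + 2) * (n / 2 ^ (s - m)) + s + S)
          = n * (N * ln 2 * ((real m + 2) * (1/2) ^ t + real t * (1/2) ^ t)) + N * ln 2 * s + N * (ln 2 * S)"
        by (simp add: s_def power_one_over field_simps)
      also have "\<dots> \<le> n * (\<epsilon> / 3) + N * ln 2 * s + N * (ln 2 * (s + 1) + \<bar>ln y\<bar>)"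
        using t(1) S2 by (intro add_mono mult_left_mono) auto
      also have "N * (ln 2 * (s + 1) + \<bar>ln y\<bar>) = N * ln 2 * (s + 1) + N * \<bar>ln y\<bar>"
        by (simp add: algebra_simps)
      also have "N * \<bar>ln y\<bar> \<le> n * (\<epsilon> / 3) + N * B * \<bar>ln \<delta>'\<bar> + N * \<bar>ln b\<bar>"
      proof -
        have n1: "ln (real n) \<ge> 0" using False by simp
        have "ln y = B * ln n - ln b" using False b by (simp add: y_def ln_div ln_realpow)
        hence "\<bar>ln y\<bar> \<le> B * ln n + \<bar>ln b\<bar>"
          using n1 abs_triangle_ineq4[of "B * ln n" "ln b"] by (simp add: abs_mult)
        also have "B * ln n \<le> B * (\<delta>' * n + \<bar>ln \<delta>'\<bar>)"
          using ln_le_linear[of \<delta>' "real n"] \<delta>' False by (intro mult_left_mono) auto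
        finally have "N * \<bar>ln y\<bar> \<le> N * (B * (\<delta>' * n + \<bar>ln \<delta>'\<bar>) + \<bar>ln b\<bar>)"
          by (intro mult_left_mono) auto
        also have "\<dots> = n * (N * B * \<delta>') + N * B * \<bar>ln \<delta>'\<bar> + N * \<bar>ln b\<bar>" by (simp add: algebra_simps)
        also have "N * B * \<delta>' \<le> \<epsilon> / 3"
        proof -
          have "N * B * \<delta>' \<le> (N * B + 1) * \<delta>'" using \<delta>' by (simp add: algebra_simps)
          also have "\<dots> = \<epsilon> / 3" unfolding \<delta>'_def by (simp add: add_nonneg_eq_0_iff field_simps)
          finally show ?thesis .
        qed
        finally show ?thesis by (simp add: mult_left_mono)
      qed
      finally have near: "(\<Sum>j\<in>A-F. - ln (?f j)) \<le> n * (2 * \<epsilon> / 3) + C2"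
        using near0 by (simp add: C2_def algebra_simps)
      have "(\<Sum>j\<in>A. ln (?f j)) = (\<Sum>j\<in>A-F. ln (?f j)) + (\<Sum>j\<in>F. ln (?f j))"
        using FA fin by (intro sum.subset_diff) auto
      moreover have "(\<Sum>j\<in>A-F. ln (?f j)) \<ge> - (n * (2 * \<epsilon> / 3) + C2)"
        using near by (simp add: sum_negf)
      ultimately show ?thesis using far by (simp add: algebra_simps)
    qed
    hence "- \<epsilon> * n \<le> (C1 + C2) + (\<Sum>j\<in>A. ln (?f j))" by simp
    hence "exp (- \<epsilon> * n) \<le> exp ((C1 + C2) + (\<Sum>j\<in>A. ln (?f j)))" by (subst exp_le_cancel_iff)
    also have "\<dots> = exp (C1 + C2) * (\<Prod>j\<in>A. ?f j)"
      using pos fin by (simp add: exp_add exp_sum)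
    finally show "exp (- \<epsilon> * of_nat n) \<le> exp (C1 + C2) * (\<Prod>j\<in>A. ?f j)" .
  qed simp
qed

text \<open>\<open>bdet g e w a k\<close> is the determinant of the restriction of \<open>g - W (\<Delta> + e)\<close> to the
  sites \<open>a, \<dots>, a + k - 1\<close>, where \<open>W\<close> is multiplication by \<open>w\<close> and \<open>\<Delta>\<close> is the sum of the two shifts.\<close>

fun bdet :: "real \<Rightarrow> real \<Rightarrow> (int \<Rightarrow> real) \<Rightarrow> int \<Rightarrow> nat \<Rightarrow> real" where
  "bdet g e w a 0 = 1"
| "bdet g e w a (Suc 0) = g - e * w a"
| "bdet g e w a (Suc (Suc k)) = (g - e * w (a + int k + 1)) * bdet g e w a (Suc k)
     - w (a + int k + 1) * w (a + int k) * bdet g e w a k"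

section \<open>Block determinants of the reduced equation\<close>

lemma nat_induct2 [case_names 0 1 step]:
  assumes "P 0" "P (Suc 0)" "\<And>k. P k \<Longrightarrow> P (Suc k) \<Longrightarrow> P (Suc (Suc k))"
  shows "P (n::nat)"
proof -
  have "P n \<and> P (Suc n)" by (induction n) (use assms in auto)
  thus ?thesis by simp
qed

lemma bdet_shift: "bdet g e (\<lambda>j. w (j + c)) a k = bdet g e w (a + c) k"
  by (induction k rule: nat_induct2) (simp_all add: algebra_simps)

text \<open>The bracket is the term \<open>- w y * w (y + 1) * bdet g e w (y + 2) (l - 1)\<close>, written so that
  the empty block \<open>l = 0\<close> needs no separate treatment.\<close>

lemma bdet_split:
  "bdet g e w a (i + l + 1) = bdet g e w a (i + 1) * bdet g e w (a + int i + 1) l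
     + bdet g e w a i * (bdet g e w (a + int i) (l + 1) - (g - e * w (a + int i)) * bdet g e w (a + int i + 1) l)"
proof (induction l rule: nat_induct2)
  case (step l)
  have 1: "bdet g e w a (i + Suc (Suc l) + 1) =
      (g - e * w (a + int i + 1 + int l + 1)) * bdet g e w a (i + Suc l + 1)
      - w (a + int i + 1 + int l + 1) * w (a + int i + 1 + int l) * bdet g e w a (i + l + 1)"
    by (simp add: add_ac)
  have 2: "bdet g e w (a + int i) (Suc (Suc l) + 1) =
      (g - e * w (a + int i + 1 + int l + 1)) * bdet g e w (a + int i) (Suc l + 1)
      - w (a + int i + 1 + int l + 1) * w (a + int i + 1 + int l) * bdet g e w (a + int i) (l + 1)"
    by (simp add: add_ac)
  show ?case
    unfolding 1 2 step.IH bdet.simps(3)[of g e w "a + int i + 1" l]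
    by (simp add: algebra_simps)
qed (simp_all add: algebra_simps)

text \<open>The recursive definition expands at the last site. Agreement with the expansion at the
  first one gives invariance under reflection, and with it the evenness in the phase.\<close>

lemma bdet_left_rec:
  "bdet g e w a (Suc (Suc l)) = (g - e * w a) * bdet g e w (a + 1) (Suc l) - w a * w (a + 1) * bdet g e w (a + 2) l"
proof (induction l rule: nat_induct2)
  case (step l)
  show ?case
    unfolding bdet.simps(3)[of g e w a "Suc (Suc l)"] step.IH bdet.simps(3)[of g e w "a+1" "Suc l"] bdet.simps(3)[of g e w "a+2" l]
    by (simp add: algebra_simps)
qed (simp_all add: algebra_simps)

lemma bdet_reverse: "bdet g e (\<lambda>j. w (- j)) (- (a + int k - 1)) k = bdet g e w a k"
proof (induction k arbitrary: a rule: nat_induct2)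
  case (step k)
  have 1: "bdet g e (\<lambda>j. w (- j)) (- (a + int (Suc (Suc k)) - 1)) (Suc k) = bdet g e w (a + 1) (Suc k)"
    using step.IH(2)[of "a + 1"] by (simp add: algebra_simps)
  have 2: "bdet g e (\<lambda>j. w (- j)) (- (a + int (Suc (Suc k)) - 1)) k = bdet g e w (a + 2) k"
    using step.IH(1)[of "a + 2"] by (simp add: algebra_simps)
  show ?case by (subst bdet_left_rec[of g e w a k], subst bdet.simps(3)) (simp add: 1[simplified] 2[simplified] add.commute)
qed simp_all

lemma bdet_bound:
  assumes "\<And>j. \<bar>w j\<bar> \<le> 1"
  shows "\<bar>bdet g e w a k\<bar> \<le> (\<bar>g\<bar> + \<bar>e\<bar> + 1) ^ k"
proof (induction k rule: nat_induct2)
  case 1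
  have "\<bar>e * w a\<bar> \<le> \<bar>e\<bar>" using assms[of a] by (simp add: abs_mult mult_left_le)
  thus ?case by simp
next
  case (step k)
  let ?M = "\<bar>g\<bar> + \<bar>e\<bar> + 1"
  let ?x = "w (a + int k + 1)" and ?y = "w (a + int k)"
  have "\<bar>e * ?x\<bar> \<le> \<bar>e\<bar>" using assms by (simp add: abs_mult mult_left_le)
  hence 1: "\<bar>g - e * ?x\<bar> \<le> \<bar>g\<bar> + \<bar>e\<bar>" by linarith
  have 2: "\<bar>?x * ?y\<bar> \<le> 1" using assms by (simp add: abs_mult mult_le_one)
  have "\<bar>bdet g e w a (Suc (Suc k))\<bar> \<le> \<bar>g - e * ?x\<bar> * \<bar>bdet g e w a (Suc k)\<bar> + \<bar>?x * ?y\<bar> * \<bar>bdet g e w a k\<bar>"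
    by (simp add: abs_mult[symmetric] order.trans[OF abs_triangle_ineq4])
  also have "\<dots> \<le> (\<bar>g\<bar> + \<bar>e\<bar>) * ?M ^ Suc k + 1 * ?M ^ Suc k"
  proof (intro add_mono mult_mono 1 2 step.IH)
    have "?M ^ k \<le> ?M ^ Suc k" by (rule power_increasing) auto
    thus "\<bar>bdet g e w a k\<bar> \<le> ?M ^ Suc k" using step.IH(1) by linarith
  qed auto
  also have "\<dots> = ?M ^ Suc (Suc k)" by (simp add: algebra_simps)
  finally show ?case .
qed simp

section \<open>Solutions of the reduced equation on a block\<close>

definition sol :: "real \<Rightarrow> real \<Rightarrow> (int \<Rightarrow> real) \<Rightarrow> (int \<Rightarrow> real) \<Rightarrow> bool" where
  "sol g e w \<psi> \<longleftrightarrow> (\<forall>m. w m * (\<psi> (m + 1) + \<psi> (m - 1) + e * \<psi> m) = g * \<psi> m)"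

lemma solD: "sol g e w \<psi> \<Longrightarrow> w m * \<psi> (m + 1) = (g - e * w m) * \<psi> m - w m * \<psi> (m - 1)"
  by (drule sol_def[THEN iffD1, rule_format, of _ _ _ _ m]) (simp add: algebra_simps)

text \<open>The recurrence is iterated without dividing by \<open>w\<close>: the product of the
  values passed stays on the left, and the two coefficients on the right then obey the recursion of
  the determinants.\<close>

lemma sol_right:
  assumes S: "sol g e w \<psi>"
  shows "(\<Prod>j=y..y + int l. w j) * \<psi> (y + int l + 1)
      = bdet g e w y (l + 1) * \<psi> y - w y * bdet g e w (y + 1) l * \<psi> (y - 1)"
proof (induction l rule: nat_induct2)
  case 0
  show ?case using solD[OF S, of y] by simp
next
  case 1
  have "{y..y + 1} = {y, y + 1}" by auto
  hence "(\<Prod>j=y..y + int (Suc 0). w j) * \<psi> (y + int (Suc 0) + 1) = w y * (w (y + 1) * \<psi> (y + 1 + 1))" by simp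
  also have "w (y + 1) * \<psi> (y + 1 + 1) = (g - e * w (y + 1)) * \<psi> (y + 1) - w (y + 1) * \<psi> y"
    using solD[OF S, of "y + 1"] by simp
  also have "w y * \<dots> = (g - e * w (y+1)) * (w y * \<psi> (y + 1)) - w y * w (y + 1) * \<psi> y"
    by (simp add: algebra_simps)
  also have "w y * \<psi> (y + 1) = (g - e * w y) * \<psi> y - w y * \<psi> (y - 1)" by (rule solD[OF S])
  finally show ?case by (simp add: algebra_simps)
next
  case (step l)
  have iv: "{y..y + int (Suc k)} = insert (y + int (Suc k)) {y..y + int k}" for k by auto
  have P: "(\<Prod>j=y..y + int (Suc k). w j) = w (y + int (Suc k)) * (\<Prod>j=y..y + int k. w j)" for k
    unfolding iv by (subst prod.insert) auto
  let ?z = "y + int l + 2" and ?P = "\<Prod>j=y..y + int l. w j"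
  have z: "y + int (Suc (Suc l)) = ?z" "y + int (Suc l) = ?z - 1" "y + int (Suc l) + 1 = ?z" "y + int l + 1 = ?z - 1"
    by simp_all
  have "(\<Prod>j=y..y + int (Suc (Suc l)). w j) * \<psi> (y + int (Suc (Suc l)) + 1)
      = w (?z - 1) * ?P * (w ?z * \<psi> (?z + 1))"
    unfolding P[of "Suc l"] P[of l] unfolding z by simp
  also have "\<dots> = (g - e * w ?z) * (w (?z - 1) * ?P * \<psi> ?z) - w ?z * w (?z - 1) * (?P * \<psi> (?z - 1))"
    unfolding solD[OF S, of ?z] by (simp add: algebra_simps)
  also have "w (?z - 1) * ?P * \<psi> ?z = bdet g e w y (Suc l + 1) * \<psi> y - w y * bdet g e w (y + 1) (Suc l) * \<psi> (y - 1)"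
    using step.IH(2) unfolding P[of l] unfolding z by (simp add: add_ac)
  also have "?P * \<psi> (?z - 1) = bdet g e w y (l + 1) * \<psi> y - w y * bdet g e w (y + 1) l * \<psi> (y - 1)"
    using step.IH(1) unfolding z by (simp add: add_ac)
  finally show ?case
    using bdet.simps(3)[of g e w y "Suc l"] bdet.simps(3)[of g e w "y+1" l]
    by (simp add: algebra_simps)
qed

lemma sol_reverse: "sol g e w \<psi> \<Longrightarrow> sol g e (\<lambda>j. w (- j)) (\<lambda>j. \<psi> (- j))"
  unfolding sol_def
proof
  fix m assume "\<forall>m. w m * (\<psi> (m + 1) + \<psi> (m - 1) + e * \<psi> m) = g * \<psi> m"
  hence "w (- m) * (\<psi> (- m - 1) + \<psi> (- m + 1) + e * \<psi> (- m)) = g * \<psi> (- m)"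
    by (metis add.commute)
  thus "w (- m) * (\<psi> (- (m + 1)) + \<psi> (- (m - 1)) + e * \<psi> (- m)) = g * \<psi> (- m)" by simp
qed

lemma sol_shift: "sol g e w \<psi> \<Longrightarrow> sol g e (\<lambda>j. w (j + c)) (\<lambda>j. \<psi> (j + c))"
  unfolding sol_def
proof
  fix m assume "\<forall>m. w m * (\<psi> (m + 1) + \<psi> (m - 1) + e * \<psi> m) = g * \<psi> m"
  from this[THEN HOL.spec, of "m + c"]
  show "w (m + c) * (\<psi> (m + 1 + c) + \<psi> (m - 1 + c) + e * \<psi> (m + c)) = g * \<psi> (m + c)"
    by (simp add: algebra_simps)
qed

lemma sol_left:
  assumes S: "sol g e w \<psi>"
  shows "(\<Prod>j=y - int i..y. w j) * \<psi> (y - int i - 1)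
      = bdet g e w (y - int i) (i + 1) * \<psi> y - w y * bdet g e w (y - int i) i * \<psi> (y + 1)"
proof -
  have "(\<Prod>j=-y..-y + int i. w (- j)) = (\<Prod>j=y - int i..y. w j)"
    by (rule prod.reindex_bij_witness[of _ uminus uminus]) auto
  moreover have "bdet g e (\<lambda>j. w (- j)) (-y) (i + 1) = bdet g e w (y - int i) (i + 1)"
    using bdet_reverse[of g e w "y - int i" "i + 1"] by simp
  moreover have "bdet g e (\<lambda>j. w (- j)) (-y + 1) i = bdet g e w (y - int i) i"
    using bdet_reverse[of g e w "y - int i" i] by (simp add: algebra_simps)
  ultimately show ?thesis
    using sol_right[OF sol_reverse[OF S], of "- y" i] by (simp add: algebra_simps)
qed

text \<open>Cramer's rule for the restriction of the equation to a block around the site \<open>y\<close>.\<close>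

lemma sol_green:
  assumes S: "sol g e w \<psi>"
  shows "bdet g e w (y - int i) (i + l + 1) * \<psi> y
    = bdet g e w (y + 1) l * (\<Prod>j=y - int i..y. w j) * \<psi> (y - int i - 1)
    + bdet g e w (y - int i) i * (\<Prod>j=y..y + int l. w j) * \<psi> (y + int l + 1)"
proof -
  have split: "bdet g e w (y - int i) (i + l + 1) = bdet g e w (y - int i) (i + 1) * bdet g e w (y + 1) l
     + bdet g e w (y - int i) i * (bdet g e w y (l + 1) - (g - e * w y) * bdet g e w (y + 1) l)"
    using bdet_split[of g e w "y - int i" i l] by simp
  have eq: "w y * \<psi> (y + 1) + w y * \<psi> (y - 1) = (g - e * w y) * \<psi> y" using solD[OF S, of y] by simp
  \<comment> \<open>The weights are chosen so that the two neighbours of \<open>y\<close> occur only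
    in the combination \<open>w y * (\<psi> (y + 1) + \<psi> (y - 1))\<close>, which the equation at
    \<open>y\<close> turns into a multiple of \<open>\<psi> y\<close>.\<close>
  have "bdet g e w (y + 1) l * (\<Prod>j=y - int i..y. w j) * \<psi> (y - int i - 1)
    + bdet g e w (y - int i) i * (\<Prod>j=y..y + int l. w j) * \<psi> (y + int l + 1)
    = (bdet g e w (y + 1) l * bdet g e w (y - int i) (i + 1) + bdet g e w (y - int i) i * bdet g e w y (l + 1)) * \<psi> y
      - bdet g e w (y + 1) l * bdet g e w (y - int i) i * (w y * \<psi> (y + 1) + w y * \<psi> (y - 1))"
    unfolding mult.assoc sol_right[OF S] sol_left[OF S] by (simp add: algebra_simps)
  thus ?thesis unfolding split eq by (simp add: algebra_simps)
qed

section \<open>Block determinants as polynomials in the cosine of the phase\<close>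

definition wcos :: "real \<Rightarrow> real \<Rightarrow> int \<Rightarrow> real" where
  "wcos \<omega> x j = cos (2 * pi * (x + of_int j * \<omega>))"

definition detc :: "real \<Rightarrow> real \<Rightarrow> real \<Rightarrow> nat \<Rightarrow> real \<Rightarrow> real" where
  "detc g e \<omega> k x = bdet g e (wcos \<omega> x) 0 k"

lemma wcos_shift: "wcos \<omega> x (j + a) = wcos \<omega> (x + of_int a * \<omega>) j"
  by (simp add: wcos_def algebra_simps)

lemma bdet_wcos: "bdet g e (wcos \<omega> x) a k = detc g e \<omega> k (x + of_int a * \<omega>)"
  using bdet_shift[of g e "wcos \<omega> x" a 0 k] by (simp add: detc_def wcos_shift)

text \<open>The last two conditions say that, for \<open>k > 0\<close>, the part of frequency \<open>k\<close> of \<open>F y\<close> is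
  \<open>u * cos (k * y + \<Phi>) / 2 ^ (k - 1)\<close>.\<close>

definition trigpoly :: "nat \<Rightarrow> (real \<Rightarrow> real) \<Rightarrow> real \<Rightarrow> real \<Rightarrow> bool" where
  "trigpoly k F u \<Phi> \<longleftrightarrow> (\<exists>p q. degree p \<le> k \<and> degree (pCons 0 q) \<le> k \<and>
     (\<forall>y. F y = poly p (cos y) + sin y * poly q (cos y)) \<and>
     coeff p k = u * cos \<Phi> \<and> coeff (pCons 0 q) k = - u * sin \<Phi>)"

lemma trigpoly_Suc:
  assumes "trigpoly k F u \<Phi>"
  shows "trigpoly (Suc k) F 0 \<Psi>"
  using assms unfolding trigpoly_def by (metis (no_types, lifting) coeff_eq_0 le_SucI less_Suc_eq_le mult_zero_left neg_0_equal_iff_equal)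

lemma trigpoly_lincomb:
  assumes "trigpoly k F u \<Phi>" "trigpoly k G v \<Phi>"
  shows "trigpoly k (\<lambda>y. a * F y + b * G y) (a * u + b * v) \<Phi>"
proof -
  obtain p q where 1: "degree p \<le> k" "degree (pCons 0 q) \<le> k"
     "\<And>y. F y = poly p (cos y) + sin y * poly q (cos y)"
     "coeff p k = u * cos \<Phi>" "coeff (pCons 0 q) k = - u * sin \<Phi>"
    using assms(1) unfolding trigpoly_def by blast
  obtain p' q' where 2: "degree p' \<le> k" "degree (pCons 0 q') \<le> k"
     "\<And>y. G y = poly p' (cos y) + sin y * poly q' (cos y)"
     "coeff p' k = v * cos \<Phi>" "coeff (pCons 0 q') k = - v * sin \<Phi>"
    using assms(2) unfolding trigpoly_def by blast
  have q: "pCons 0 (smult a q + smult b q') = smult a (pCons 0 q) + smult b (pCons 0 q')" by simp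
  show ?thesis unfolding trigpoly_def
    by (rule exI[of _ "smult a p + smult b p'"], rule exI[of _ "smult a q + smult b q'"], unfold q, intro conjI allI)
       (use 1 2 in \<open>auto intro!: degree_add_le order.trans[OF degree_smult_le] simp: algebra_simps simp del: smult_pCons\<close>)
qed

text \<open>Replacing the square of the sine by 1 minus that of the cosine restores the normal form.
  On the leading coefficients this is the addition theorem: the phases add and the amplitude is
  unchanged.\<close>

lemma trigpoly_mult_cos:
  assumes "trigpoly k F u \<Phi>"
  shows "trigpoly (Suc k) (\<lambda>y. cos (y + \<beta>) * F y) u (\<Phi> + \<beta>)"
proof -
  obtain p q where 1: "degree p \<le> k" "degree (pCons 0 q) \<le> k"
     "\<And>y. F y = poly p (cos y) + sin y * poly q (cos y)"
     "coeff p k = u * cos \<Phi>" "coeff (pCons 0 q) k = - u * sin \<Phi>"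
    using assms(1) unfolding trigpoly_def by blast
  define p' where "p' = smult (cos \<beta>) (pCons 0 p) - smult (sin \<beta>) (q - pCons 0 (pCons 0 q))"
  define q' where "q' = smult (cos \<beta>) (pCons 0 q) - smult (sin \<beta>) p"
  have p0: "coeff p i = 0" if "i > k" for i using 1(1) that by (intro coeff_eq_0) auto
  have q0: "coeff (pCons 0 q) i = 0" if "i > k" for i using 1(2) that by (intro coeff_eq_0) auto
  have q00: "coeff q i = 0" if "i \<ge> k" for i using q0[of "Suc i"] that by simp
  have "degree p' \<le> Suc k"
    by (rule degree_le) (auto simp: p'_def p0 q0 q00 coeff_pCons split: nat.split)
  moreover have "degree (pCons 0 q') \<le> Suc k"
    by (rule degree_le) (auto simp: q'_def p0 q0 q00 coeff_pCons split: nat.split)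
  moreover have "cos (y + \<beta>) * F y = poly p' (cos y) + sin y * poly q' (cos y)" for y
  proof -
    have "poly p' (cos y) = cos \<beta> * (cos y * poly p (cos y)) - sin \<beta> * ((1 - (cos y)\<^sup>2) * poly q (cos y))"
      by (simp add: p'_def algebra_simps power2_eq_square)
    also have "1 - (cos y)\<^sup>2 = sin y * sin y" using sin_squared_eq[of y] by (simp add: power2_eq_square)
    finally show ?thesis unfolding 1(3) q'_def cos_add by (simp add: algebra_simps)
  qed
  moreover have "coeff p' (Suc k) = u * cos (\<Phi> + \<beta>)"
    unfolding p'_def cos_add using 1(4,5) by (simp add: q00 algebra_simps)
  moreover have "coeff (pCons 0 q') (Suc k) = - u * sin (\<Phi> + \<beta>)"
    unfolding q'_def sin_add using 1(4,5) by (simp add: algebra_simps del: smult_pCons)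
  ultimately show ?thesis unfolding trigpoly_def by blast
qed

text \<open>The Chebyshev polynomial of the second kind of degree \<open>k\<close> at
  \<open>- e / 2\<close>, or the determinant of \<open>- (\<Delta> + e)\<close> on \<open>k\<close>
  sites. The terms with \<open>g\<close> have lower degree in the cosines and do not enter.\<close>

fun ulead :: "real \<Rightarrow> nat \<Rightarrow> real" where
  "ulead e 0 = 1"
| "ulead e (Suc 0) = - e"
| "ulead e (Suc (Suc k)) = - e * ulead e (Suc k) - ulead e k"

lemma trigpoly_cong: "trigpoly k F u \<Phi> \<Longrightarrow> (\<And>y. F y = G y) \<Longrightarrow> u = v \<Longrightarrow> \<Phi> = \<Psi> \<Longrightarrow> trigpoly k G v \<Psi>"
  by (simp add: trigpoly_def)

text \<open>In the recursion the \<open>g\<close> term lacks one cosine, so it has amplitude 0 at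
  the new frequency. The other two terms both carry the sum of all phases, and their amplitudes
  combine as in \<open>ulead\<close>.\<close>

lemma trigpoly_cont:
  "trigpoly k (\<lambda>y. bdet g e (\<lambda>j. cos (y + \<beta> j)) 0 k) (ulead e k) (\<Sum>j<k. \<beta> (int j))"
proof (induction k rule: nat_induct2)
  case 0
  have "trigpoly 0 (\<lambda>_. 1) 1 0"
    unfolding trigpoly_def by (intro exI[of _ 1] exI[of _ 0]) auto
  thus ?case by simp
next
  case 1
  have 1: "trigpoly 0 (\<lambda>_. 1) 1 0"
    unfolding trigpoly_def by (intro exI[of _ 1] exI[of _ 0]) auto
  have "trigpoly (Suc 0) (\<lambda>y. g * 1 + (- e) * (cos (y + \<beta> 0) * 1)) (g * 0 + (- e) * 1) (0 + \<beta> 0)"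
    using trigpoly_lincomb[OF trigpoly_Suc[OF 1, of "0 + \<beta> 0"] trigpoly_mult_cos[OF 1, of "\<beta> 0"], of g "- e"]
    by (simp only: One_nat_def)
  thus ?case by (rule trigpoly_cong) auto
next
  case (step k)
  let ?F = "\<lambda>k y. bdet g e (\<lambda>j. cos (y + \<beta> j)) 0 k"
  let ?S = "\<Sum>j<Suc (Suc k). \<beta> (int j)"
  have A: "trigpoly (Suc (Suc k)) (?F (Suc k)) 0 ?S" by (rule trigpoly_Suc[OF step.IH(2)])
  have B: "trigpoly (Suc (Suc k)) (\<lambda>y. cos (y + \<beta> (int k + 1)) * ?F (Suc k) y) (ulead e (Suc k)) ?S"
    by (rule trigpoly_cong[OF trigpoly_mult_cos[OF step.IH(2)]]) (auto simp: add_ac)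
  have C: "trigpoly (Suc (Suc k)) (\<lambda>y. cos (y + \<beta> (int k + 1)) * (cos (y + \<beta> (int k)) * ?F k y)) (ulead e k) ?S"
    by (rule trigpoly_cong[OF trigpoly_mult_cos[OF trigpoly_mult_cos[OF step.IH(1)]]]) (auto simp: add_ac)
  show ?case
    by (rule trigpoly_cong[OF trigpoly_lincomb[OF trigpoly_lincomb[OF A B, of g "- e"] C, of 1 "- 1"]])
       (auto simp: algebra_simps)
qed

text \<open>Measuring the phase from the centre of the block makes the individual phases sum to 0.
  It also turns a sign change of the phase into the reflection of the block, so the determinant is
  even and the sine part drops out.\<close>

lemma detc_cos_poly:
  obtains Q where "degree Q \<le> k" "coeff Q k = ulead e k"
    "\<And>x. detc g e \<omega> k (x - (real k - 1) * \<omega> / 2) = poly Q (cos (2 * pi * x))"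
proof -
  define \<beta> where "\<beta> j = 2 * pi * \<omega> * (of_int j - (real k - 1) / 2)" for j :: int
  define F where "F y = bdet g e (\<lambda>j. cos (y + \<beta> j)) 0 k" for y
  have "(\<Sum>j<k. \<beta> (int j)) = 2 * pi * \<omega> * (\<Sum>j<k. real j - (real k - 1) / 2)"
    by (simp add: \<beta>_def sum_distrib_left)
  also have "(\<Sum>j<k. real j - (real k - 1) / 2) = 0"
  proof -
    have "(\<Sum>j<k. real j) = real k * (real k - 1) / 2" by (induction k) (auto simp: field_simps)
    thus ?thesis by (simp add: sum_subtractf)
  qed
  finally have "(\<Sum>j<k. \<beta> (int j)) = 0" by simp
  hence "trigpoly k F (ulead e k) 0" using trigpoly_cont[of k g e \<beta>] by (simp add: F_def[abs_def])
  then obtain p q where pq: "degree p \<le> k" "\<And>y. F y = poly p (cos y) + sin y * poly q (cos y)" "coeff p k = ulead e k"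
    unfolding trigpoly_def by auto
  have "F (- y) = F y" for y
  proof -
    have "cos (- y + \<beta> j) = cos (y + \<beta> (- (j + (- (int k - 1)))))" for j
    proof -
      have "\<beta> (- (j + (- (int k - 1)))) = - \<beta> j" by (simp add: \<beta>_def field_simps)
      thus ?thesis using cos_minus[of "- y + \<beta> j"] by simp
    qed
    hence "F (- y) = bdet g e (\<lambda>j. (\<lambda>i. cos (y + \<beta> (- i))) (j + (- (int k - 1)))) 0 k"
      unfolding F_def by simp
    also have "\<dots> = bdet g e (\<lambda>i. cos (y + \<beta> (- i))) (- (0 + int k - 1)) k"
      by (subst bdet_shift) simp
    also have "\<dots> = F y" unfolding F_def by (rule bdet_reverse[where w = "\<lambda>i. cos (y + \<beta> i)"])
    finally show ?thesis .
  qed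
  hence even: "F y = poly p (cos y)" for y
    using pq(2)[of y] pq(2)[of "- y"] by simp
  have "detc g e \<omega> k (x - (real k - 1) * \<omega> / 2) = F (2 * pi * x)" for x
    unfolding detc_def F_def wcos_def \<beta>_def by (simp add: algebra_simps)
  thus ?thesis using that[OF pq(1,3)] even by simp
qed

text \<open>The ratio of consecutive values never falls below \<rho>: with \<rho> + 1/\<rho> in
  place of \<open>\<bar>e\<bar>\<close>, the subtracted previous value is at most 1/\<rho> times the
  current one, by induction.\<close>

lemma ulead_lower:
  assumes "\<rho> \<ge> 1" "\<rho> + 1 / \<rho> = \<bar>e\<bar>"
  shows "\<rho> ^ k \<le> \<bar>ulead e k\<bar>"
proof -
  have step: "\<rho> * \<bar>ulead e k\<bar> \<le> \<bar>ulead e (Suc k)\<bar>" for k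
  proof (induction k)
    case 0
    have "\<rho> \<le> \<bar>e\<bar>" unfolding assms(2)[symmetric] using assms(1) by simp
    thus ?case by simp
  next
    case (Suc k)
    have "\<rho> * \<bar>ulead e (Suc k)\<bar> = \<bar>e\<bar> * \<bar>ulead e (Suc k)\<bar> - \<bar>ulead e (Suc k)\<bar> / \<rho>"
      unfolding assms(2)[symmetric] by (simp add: algebra_simps)
    moreover have "\<bar>ulead e (Suc k)\<bar> / \<rho> \<ge> \<bar>ulead e k\<bar>" using Suc assms(1) by (simp add: field_simps)
    moreover have "\<bar>e\<bar> * \<bar>ulead e (Suc k)\<bar> - \<bar>ulead e k\<bar> \<le> \<bar>ulead e (Suc (Suc k))\<bar>"
      using abs_triangle_ineq2[of "e * ulead e (Suc k)" "- ulead e k"] by (simp add: abs_mult abs_minus_commute[of _ "ulead e k"])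
    ultimately show ?case by linarith
  qed
  show ?thesis
  proof (induction k)
    case (Suc k)
    have "\<rho> ^ Suc k \<le> \<rho> * \<bar>ulead e k\<bar>" using Suc assms(1) by simp
    also note step[of k]
    finally show ?case .
  qed simp
qed

lemma abs_wcos_le: "\<bar>wcos \<omega> x j\<bar> \<le> 1"
  by (simp add: wcos_def)

section \<open>Growth rate of the determinants, uniformly in the phase\<close>

definition sdet :: "real \<Rightarrow> real \<Rightarrow> real \<Rightarrow> nat \<Rightarrow> real" where
  "sdet g e \<omega> k = (SUP x. \<bar>detc g e \<omega> k x\<bar>)"

lemma abs_detc_le_sdet: "\<bar>detc g e \<omega> k x\<bar> \<le> sdet g e \<omega> k"
  unfolding sdet_def
proof (rule cSUP_upper)
  show "bdd_above (range (\<lambda>x. \<bar>detc g e \<omega> k x\<bar>))"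
    by (rule bdd_aboveI2[of _ _ "(\<bar>g\<bar> + \<bar>e\<bar> + 1) ^ k"])
       (auto simp: detc_def intro: bdet_bound abs_wcos_le)
qed simp

lemma sdet_nonneg: "0 \<le> sdet g e \<omega> k"
  using abs_detc_le_sdet[of g e \<omega> k 0] by linarith

lemma sdet_le: "(\<And>x. \<bar>detc g e \<omega> k x\<bar> \<le> c) \<Longrightarrow> sdet g e \<omega> k \<le> c"
  unfolding sdet_def by (rule cSUP_least) auto

lemma sdet_0: "sdet g e \<omega> 0 = 1"
  by (simp add: sdet_def detc_def)

text \<open>The second product comes from the bond between the two blocks; its weight is a product
  of two cosines.\<close>

lemma sdet_submult:
  "sdet g e \<omega> (Suc k + Suc l) \<le> sdet g e \<omega> (Suc k) * sdet g e \<omega> (Suc l) + sdet g e \<omega> k * sdet g e \<omega> l"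
proof (rule sdet_le)
  fix x
  let ?w = "wcos \<omega> x"
  let ?y = "int k + 1"
  have 1: "bdet g e ?w (int k) (Suc l + 1) - (g - e * ?w (int k)) * bdet g e ?w ?y (Suc l)
      = - (?w ?y * ?w (int k)) * bdet g e ?w (int k + 2) l"
    using bdet_left_rec[of g e ?w "int k" l] by (simp only: Suc_eq_plus1[symmetric]) simp
  have "bdet g e ?w 0 (Suc k + Suc l) = bdet g e ?w 0 (Suc k) * bdet g e ?w ?y (Suc l)
      + bdet g e ?w 0 k * (- (?w ?y * ?w (int k)) * bdet g e ?w (int k + 2) l)"
    unfolding 1[symmetric] using bdet_split[of g e ?w 0 k "Suc l"] by (simp only: add_0 Suc_eq_plus1 add_ac)
  hence "bdet g e ?w 0 (Suc k + Suc l) = bdet g e ?w 0 (Suc k) * bdet g e ?w ?y (Suc l)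
      - bdet g e ?w 0 k * (?w ?y * ?w (int k)) * bdet g e ?w (int k + 2) l" by (simp only: mult_ac) simp
  hence "\<bar>detc g e \<omega> (Suc k + Suc l) x\<bar> \<le> \<bar>bdet g e ?w 0 (Suc k)\<bar> * \<bar>bdet g e ?w ?y (Suc l)\<bar>
      + \<bar>bdet g e ?w 0 k\<bar> * \<bar>?w ?y * ?w (int k)\<bar> * \<bar>bdet g e ?w (int k + 2) l\<bar>"
    unfolding detc_def by (simp add: abs_mult[symmetric] order.trans[OF abs_triangle_ineq4])
  also have "\<dots> \<le> sdet g e \<omega> (Suc k) * sdet g e \<omega> (Suc l) + sdet g e \<omega> k * 1 * sdet g e \<omega> l"
    unfolding bdet_wcos
    by (intro add_mono mult_mono abs_detc_le_sdet mult_nonneg_nonneg sdet_nonneg)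
       (auto simp: abs_mult intro!: mult_le_one abs_wcos_le)
  finally show "\<bar>detc g e \<omega> (Suc k + Suc l) x\<bar> \<le> sdet g e \<omega> (Suc k) * sdet g e \<omega> (Suc l) + sdet g e \<omega> k * sdet g e \<omega> l"
    by simp
qed

text \<open>The maximum of three consecutive values is submultiplicative up to a constant, as the norm of
  the transfer matrix is; truncated subtraction is harmless because the value at \<open>0\<close> is \<open>1\<close>.\<close>

definition ndet :: "real \<Rightarrow> real \<Rightarrow> real \<Rightarrow> nat \<Rightarrow> real" where
  "ndet g e \<omega> k = max (sdet g e \<omega> k) (max (sdet g e \<omega> (k - 1)) (sdet g e \<omega> (k - 2)))"

lemma ndet_nonneg: "0 \<le> ndet g e \<omega> k"
  using sdet_nonneg[of g e \<omega> k] by (auto simp: ndet_def)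

text \<open>Cutting the length \<open>k + l - 1\<close> involves \<open>l - 2\<close>, which forces
  three lengths into the maximum. The lengths \<open>k + l\<close>, \<open>k + l - 1\<close> and
  \<open>k + l - 2\<close> are cut as \<open>k + l\<close>, \<open>k + (l - 1)\<close> and
  \<open>(k - 1) + (l - 1)\<close>, so all parts are among the recorded ones.\<close>

lemma ndet_submult:
  assumes "k \<ge> 1" "l \<ge> 1"
  shows "ndet g e \<omega> (k + l) \<le> 2 * ndet g e \<omega> k * ndet g e \<omega> l"
proof -
  let ?s = "sdet g e \<omega>" and ?N = "ndet g e \<omega>"
  have le: "?s k \<le> ?N k" "?s (k - 1) \<le> ?N k" "?s (k - 2) \<le> ?N k" for k by (auto simp: ndet_def)
  have pr: "?s a * ?s b \<le> ?N k * ?N l" if "a \<in> {k, k-1, k-2}" "b \<in> {l, l-1, l-2}" for a b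
    using that le[of k] le[of l] by (intro mult_mono sdet_nonneg ndet_nonneg) auto
  have nn: "0 \<le> ?N k * ?N l" by (simp add: ndet_nonneg)
  have sub: "?s (a + b) \<le> ?s a * ?s b + ?s (a - 1) * ?s (b - 1)" if "a \<ge> 1" "b \<ge> 1" for a b
    using sdet_submult[of g e \<omega> "a - 1" "b - 1"] that by simp
  have 1: "?s (k + l) \<le> 2 * (?N k * ?N l)"
    using sub[OF assms] pr[of k l] pr[of "k-1" "l-1"] by simp
  have 2: "?s (k + l - 1) \<le> 2 * (?N k * ?N l)"
  proof (cases "l = 1")
    case True
    thus ?thesis using pr[of k "l - 1"] nn by (simp add: sdet_0)
  next
    case False
    hence "1 \<le> l - 1" using assms by simp
    thus ?thesis using sub[of k "l - 1"] assms pr[of k "l-1"] pr[of "k-1" "l-2"]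
      by (simp add: numeral_2_eq_2)
  qed
  have 3: "?s (k + l - 2) \<le> 2 * (?N k * ?N l)"
  proof (cases "k = 1 \<or> l = 1")
    case True
    thus ?thesis using pr[of "k - 1" "l - 1"] nn by (auto simp: sdet_0)
  next
    case False
    hence "k - 1 + (l - 1) = k + l - 2" "1 \<le> k - 1" "1 \<le> l - 1" using assms by auto
    thus ?thesis using sub[of "k - 1" "l - 1"] False assms pr[of "k-1" "l-1"] pr[of "k-2" "l-2"]
      by (simp add: numeral_2_eq_2)
  qed
  show ?thesis using 1 2 3 by (simp add: ndet_def[of _ _ _ "k + l"])
qed

text \<open>Fekete's lemma for \<open>ln (2 * N k)\<close>, where the 2 absorbs the constant of
  submultiplicativity. The exponential lower bound keeps the values positive and the infimum
  finite.\<close>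

lemma submult_growth_rate:
  fixes N :: "nat \<Rightarrow> real"
  assumes sub: "\<And>k l. k \<ge> 1 \<Longrightarrow> l \<ge> 1 \<Longrightarrow> N (k + l) \<le> 2 * N k * N l"
    and nn: "\<And>k. 0 \<le> N k" and c: "c > 0" "r > 0" and low: "\<And>k. k \<ge> k0 \<Longrightarrow> c * r ^ k \<le> N k"
  obtains L where "\<And>k. k \<ge> 1 \<Longrightarrow> exp (L * k) \<le> 2 * N k"
    "\<And>\<epsilon>. \<epsilon> > 0 \<Longrightarrow> \<exists>C>0. \<forall>k\<ge>1. N k \<le> C * exp ((L + \<epsilon>) * k)"
proof -
  have pos: "0 < N k" if "k \<ge> 1" for k
  proof -
    have "0 < c * r ^ (k + (k0 + 1))" using c by simp
    also have "\<dots> \<le> N (k + (k0 + 1))" by (rule low) simp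
    also have "\<dots> \<le> 2 * N k * N (k0 + 1)" using that by (intro sub) auto
    finally show ?thesis using nn[of k] nn[of "k0 + 1"] by (cases "N k = 0") auto
  qed
  define a where "a k = ln (2 * N k)" for k
  have a_sub: "a (k + l) \<le> a k + a l" if "k \<ge> 1" "l \<ge> 1" for k l
  proof -
    have "ln (2 * N (k + l)) \<le> ln ((2 * N k) * (2 * N l))"
      using sub[OF that] pos that by (subst ln_le_cancel_iff) auto
    also have "\<dots> = a k + a l" unfolding a_def using pos that by (intro ln_mult_pos) auto
    finally show ?thesis by (simp add: a_def)
  qed
  define X where "X = (\<lambda>k. a k / real k) ` {1..}"
  have bdd: "bdd_below X"
  proof -
    have "X = (\<lambda>k. a k / real k) ` {1..<k0+1} \<union> (\<lambda>k. a k / real k) ` {k0+1..}"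
      unfolding X_def image_Un[symmetric] by (rule arg_cong[of _ _ "image _"]) auto
    moreover have "bdd_below ((\<lambda>k. a k / real k) ` {k0+1..})"
    proof (rule bdd_belowI2[of _ "- \<bar>ln (2 * c)\<bar> + ln r"])
      fix k assume k: "k \<in> {k0+1..}"
      have "ln (2 * c * r ^ k) \<le> a k" unfolding a_def
        using low[of k] k c pos[of k] by (subst ln_le_cancel_iff) auto
      moreover have "ln (2 * c * r ^ k) = ln (2 * c) + k * ln r"
        using c by (subst ln_mult) (auto simp: ln_realpow)
      ultimately have "(ln (2 * c) + k * ln r) / k \<le> a k / k" by (intro divide_right_mono) auto
      moreover have "(ln (2 * c) + k * ln r) / k = ln (2 * c) / k + ln r"
        using k by (simp add: field_simps)
      moreover have "- \<bar>ln (2 * c)\<bar> \<le> ln (2 * c) / k"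
      proof -
        have "\<bar>ln (2 * c) / k\<bar> \<le> \<bar>ln (2 * c)\<bar>" using k by (simp add: abs_divide divide_le_eq mult_le_cancel_left1)
        thus ?thesis by linarith
      qed
      ultimately show "- \<bar>ln (2 * c)\<bar> + ln r \<le> a k / real k" by linarith
    qed
    ultimately show ?thesis by simp
  qed
  define L where "L = Inf X"
  show ?thesis
  proof (rule that[of L])
    fix k :: nat assume k: "k \<ge> 1"
    have "L \<le> a k / k" unfolding L_def using bdd k by (intro cInf_lower) (auto simp: X_def)
    hence "L * k \<le> a k" using k by (simp add: field_simps)
    hence "exp (L * k) \<le> exp (a k)" by simp
    also have "\<dots> = 2 * N k" using pos[OF k] by (simp add: a_def)
    finally show "exp (L * k) \<le> 2 * N k" .
  next
    fix \<epsilon> :: real assume eps: "\<epsilon> > 0"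
    have "\<exists>x\<in>X. x < L + \<epsilon>" unfolding L_def using eps bdd
      by (subst cInf_less_iff[symmetric]) (auto simp: X_def)
    then obtain m where m: "m \<ge> 1" "a m / m < L + \<epsilon>" by (auto simp: X_def)
    hence am: "a m \<le> (L + \<epsilon>) * m" by (simp add: field_simps)
    define A where "A = Max ((\<lambda>r. \<bar>a r\<bar>) ` {..m})"
    have A: "a r \<le> A" if "r \<le> m" for r
    proof -
      have "\<bar>a r\<bar> \<le> A" unfolding A_def using that by (intro Max_ge) auto
      thus ?thesis by linarith
    qed
    have main: "a (q * m + r) \<le> (L + \<epsilon>) * (q * m) + A" if "1 \<le> r" "r \<le> m" for q r
    proof (induction q)
      case 0 thus ?case using A[OF that(2)] by simp
    next
      case (Suc q)
      have "a (Suc q * m + r) = a (m + (q * m + r))" by (simp add: add_ac)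
      also have "\<dots> \<le> a m + a (q * m + r)" using m that by (intro a_sub) auto
      also have "\<dots> \<le> (L + \<epsilon>) * m + ((L + \<epsilon>) * (q * m) + A)" using Suc am by (intro add_mono) auto
      finally show ?case by (simp add: algebra_simps)
    qed
    have "N k \<le> exp (A + \<bar>L + \<epsilon>\<bar> * m) * exp ((L + \<epsilon>) * k)" if k: "k \<ge> 1" for k
    proof -
      \<comment> \<open>The remainder is taken in \<open>1..m\<close> instead of
        \<open>0..m - 1\<close>, since subadditivity is available only for positive lengths.\<close>
      define q r where "q = (k - 1) div m" and "r = (k - 1) mod m + 1"
      have kqr: "k = q * m + r" using k by (simp add: q_def r_def)
      have r: "1 \<le> r" "r \<le> m" using m mod_less_divisor[of m "k - 1"] by (auto simp: r_def Suc_le_eq)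
      have "a k \<le> (L + \<epsilon>) * (q * m) + A" unfolding kqr using main[OF r] .
      also have "(L + \<epsilon>) * (q * m) = (L + \<epsilon>) * k - (L + \<epsilon>) * r" unfolding kqr by (simp add: algebra_simps)
      moreover have "- ((L + \<epsilon>) * r) \<le> \<bar>L + \<epsilon>\<bar> * m"
      proof -
        have "- ((L + \<epsilon>) * r) \<le> \<bar>L + \<epsilon>\<bar> * r" using abs_le_D2[of "(L + \<epsilon>) * r"] by (simp add: abs_mult)
        also have "\<dots> \<le> \<bar>L + \<epsilon>\<bar> * m" using r by (intro mult_left_mono) auto
        finally show ?thesis .
      qed
      ultimately have "a k \<le> (A + \<bar>L + \<epsilon>\<bar> * m) + (L + \<epsilon>) * k" by linarith
      hence "exp (a k) \<le> exp ((A + \<bar>L + \<epsilon>\<bar> * m) + (L + \<epsilon>) * k)" by (subst exp_le_cancel_iff)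
      moreover have "exp (a k) = 2 * N k" using pos[OF k] by (simp add: a_def)
      ultimately show ?thesis using nn[of k] by (simp add: exp_add)
    qed
    thus "\<exists>C>0. \<forall>k\<ge>1. N k \<le> C * exp ((L + \<epsilon>) * k)" by (intro exI[of _ "exp (A + \<bar>L + \<epsilon>\<bar> * m)"]) auto
  qed
qed

section \<open>Interpolation of the block determinants\<close>

lemma prod_chord_int_upper:
  assumes D: "dioph \<omega> c N" and eps: "\<epsilon> > 0"
  obtains C where "C > 0"
    "\<And>x a n i. (\<Prod>j\<in>{a..<a + int n} - {i}. chord (x + of_int j * \<omega>)) \<le> C * exp (\<epsilon> * of_nat n)"
proof -
  obtain C where C: "C > 0"
    "\<And>x n i. (\<Prod>j\<in>{..<n} - {i}. chord (x + of_nat j * \<omega>)) \<le> C * exp (\<epsilon> * of_nat n)"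
    using prod_chord_upper[OF D eps] by blast
  show ?thesis
  proof (rule that[OF C(1)])
    fix x :: real and a :: int and n :: nat and i :: int
    \<comment> \<open>An index to the left of the interval is sent to \<open>n\<close>, where it
      removes nothing; this keeps \<open>nat\<close> from mapping it onto the first site.\<close>
    define i' where "i' = (if i < a then n else nat (i - a))"
    have "(\<Prod>j\<in>{a..<a + int n} - {i}. chord (x + of_int j * \<omega>))
        = (\<Prod>t\<in>{..<n} - {i'}. chord ((x + of_int a * \<omega>) + of_nat t * \<omega>))"
      by (rule prod.reindex_bij_witness[of _ "\<lambda>t. a + int t" "\<lambda>j. nat (j - a)"])
         (auto simp: i'_def algebra_simps split: if_splits)
    also have "\<dots> \<le> C * exp (\<epsilon> * of_nat n)" by (rule C(2))
    finally show "(\<Prod>j\<in>{a..<a + int n} - {i}. chord (x + of_int j * \<omega>)) \<le> C * exp (\<epsilon> * of_nat n)" .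
  qed
qed

lemma prod_chord_int_lower:
  assumes D: "dioph \<omega> c N" and eps: "\<epsilon> > 0" and b: "b > 0"
  obtains C where "C > 0"
    "\<And>x a n A. \<lbrakk>A \<subseteq> {a..<a + int n}; \<And>j. j \<in> {a..<a + int n} - A \<Longrightarrow> chord (x + of_int j * \<omega>) = 0;
       \<And>j. j \<in> A \<Longrightarrow> b \<le> chord (x + of_int j * \<omega>) * of_nat n ^ B\<rbrakk>
      \<Longrightarrow> exp (- \<epsilon> * of_nat n) \<le> C * (\<Prod>j\<in>A. chord (x + of_int j * \<omega>))"
proof -
  obtain C where C: "C > 0"
    "\<And>x n A. \<lbrakk>A \<subseteq> {..<n}; \<And>j. j \<in> {..<n} - A \<Longrightarrow> chord (x + of_nat j * \<omega>) = 0;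
       \<And>j. j \<in> A \<Longrightarrow> b \<le> chord (x + of_nat j * \<omega>) * of_nat n ^ B\<rbrakk>
      \<Longrightarrow> exp (- \<epsilon> * of_nat n) \<le> C * (\<Prod>j\<in>A. chord (x + of_nat j * \<omega>))"
    using prod_chord_lower[OF D eps b, of B] by blast
  show ?thesis
  proof (rule that[OF C(1)])
    fix x :: real and a :: int and n :: nat and A
    assume A: "A \<subseteq> {a..<a + int n}" "\<And>j. j \<in> {a..<a + int n} - A \<Longrightarrow> chord (x + of_int j * \<omega>) = 0"
       "\<And>j. j \<in> A \<Longrightarrow> b \<le> chord (x + of_int j * \<omega>) * of_nat n ^ B"
    define A' where "A' = {t\<in>{..<n}. a + int t \<in> A}"
    have eq: "(x + of_int a * \<omega>) + of_nat t * \<omega> = x + of_int (a + int t) * \<omega>" for t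
      by (simp add: algebra_simps)
    have "exp (- \<epsilon> * of_nat n) \<le> C * (\<Prod>t\<in>A'. chord ((x + of_int a * \<omega>) + of_nat t * \<omega>))"
      by (rule C(2)) (use A in \<open>auto simp: A'_def eq simp del: of_int_add\<close>)
    also have "(\<Prod>t\<in>A'. chord ((x + of_int a * \<omega>) + of_nat t * \<omega>)) = (\<Prod>j\<in>A. chord (x + of_int j * \<omega>))"
      by (rule prod.reindex_bij_witness[of _ "\<lambda>j. nat (j - a)" "\<lambda>t. a + int t"])
         (use A(1) in \<open>auto simp: A'_def algebra_simps\<close>)
    finally show "exp (- \<epsilon> * of_nat n) \<le> C * (\<Prod>j\<in>A. chord (x + of_int j * \<omega>))" .
  qed
qed

lemma lagrange_interpolation:
  fixes z :: "'b \<Rightarrow> 'a::field" and Q :: "'a poly"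
  assumes fin: "finite J" and card: "degree Q < card J" and inj: "inj_on z J"
  shows "Q = (\<Sum>i\<in>J. smult (poly Q (z i) / (\<Prod>j\<in>J-{i}. z i - z j)) (\<Prod>j\<in>J-{i}. [:- z j, 1:]))"
    (is "Q = ?R")
proof (rule poly_eqI_degree[of "z ` J"])
  fix x assume "x \<in> z ` J"
  then obtain m where m: "m \<in> J" "x = z m" by auto
  have "poly ?R x = (\<Sum>i\<in>J. poly Q (z i) / (\<Prod>j\<in>J-{i}. z i - z j) * (\<Prod>j\<in>J-{i}. z m - z j))"
    unfolding m by (simp add: poly_sum poly_prod)
  also have "\<dots> = (\<Sum>i\<in>J. if i = m then poly Q (z i) else 0)"
  proof (rule sum.cong[OF refl])
    fix i assume i: "i \<in> J"
    show "poly Q (z i) / (\<Prod>j\<in>J-{i}. z i - z j) * (\<Prod>j\<in>J-{i}. z m - z j) = (if i = m then poly Q (z i) else 0)"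
    proof (cases "i = m")
      case True
      have "(\<Prod>j\<in>J-{m}. z m - z j) \<noteq> 0" using fin inj m by (auto simp: inj_on_def)
      thus ?thesis using True by simp
    next
      case False
      have "(\<Prod>j\<in>J-{i}. z m - z j) = 0" using fin False m by (intro prod_zero) auto
      thus ?thesis using False by simp
    qed
  qed
  also have "\<dots> = poly Q x" using fin m by (simp add: sum.delta)
  finally show "poly Q x = poly ?R x" by simp
next
  have c: "card (z ` J) = card J" using inj by (rule card_image)
  show "degree Q < card (z ` J)" using card c by simp
  have "degree ?R \<le> card J - 1"
  proof (rule degree_sum_le[OF fin])
    fix i assume i: "i \<in> J"
    have "degree (\<Prod>j\<in>J-{i}. [:- z j, 1:]) \<le> (\<Sum>j\<in>J-{i}. degree [:- z j, 1:])"
      using degree_prod_sum_le[of "J - {i}" "\<lambda>j. [:- z j, 1:]"] fin by (simp add: o_def)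
    also have "\<dots> = card J - 1" using fin i by simp
    finally show "degree (smult (poly Q (z i) / (\<Prod>j\<in>J-{i}. z i - z j)) (\<Prod>j\<in>J-{i}. [:- z j, 1:])) \<le> card J - 1"
      by (rule order.trans[OF degree_smult_le])
  qed
  thus "degree ?R < card (z ` J)" using card c by simp
qed

lemma coeff_prod_monic_linear:
  fixes z :: "'b \<Rightarrow> 'a::field"
  assumes "finite J"
  shows "coeff (\<Prod>j\<in>J. [:- z j, 1:]) (card J) = 1"
proof -
  have "degree (\<Prod>j\<in>J. [:- z j, 1:]) = card J"
    using assms by (subst degree_prod_sum_eq) auto
  moreover have "lead_coeff (\<Prod>j\<in>J. [:- z j, 1:]) = 1"
    by (subst lead_coeff_prod) simp
  ultimately show ?thesis by simp
qed

text \<open>Both bounds read off the Lagrange form, the second because every basis product is monic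
  of degree \<open>k\<close>. The positive lower bound \<open>d\<close> also forces the nodes to be
  distinct.\<close>

lemma lagrange_poly_bound:
  fixes z :: "'b \<Rightarrow> real"
  assumes fin: "finite J" and card: "card J = Suc k" and deg: "degree Q \<le> k"
    and M: "\<And>i. i \<in> J \<Longrightarrow> \<bar>poly Q (z i)\<bar> \<le> M"
    and den: "\<And>i. i \<in> J \<Longrightarrow> d \<le> (\<Prod>j\<in>J-{i}. \<bar>z i - z j\<bar>)" and d: "d > 0"
  shows "(\<And>i. i \<in> J \<Longrightarrow> (\<Prod>j\<in>J-{i}. \<bar>x - z j\<bar>) \<le> u) \<Longrightarrow> \<bar>poly Q x\<bar> \<le> real (Suc k) * (M * u / d)"
    and "\<bar>coeff Q k\<bar> \<le> real (Suc k) * (M / d)"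
proof -
  have inj: "inj_on z J"
  proof (rule inj_onI)
    fix i j assume ij: "i \<in> J" "j \<in> J" "z i = z j"
    show "i = j"
    proof (rule ccontr)
      assume "i \<noteq> j"
      hence "(\<Prod>j\<in>J-{i}. \<bar>z i - z j\<bar>) = 0" using fin ij by (intro prod_zero) auto
      thus False using den[OF ij(1)] d by simp
    qed
  qed
  obtain i0 where "i0 \<in> J" using card by fastforce
  hence M0: "0 \<le> M" using M[of i0] by linarith
  let ?c = "\<lambda>i. poly Q (z i) / (\<Prod>j\<in>J-{i}. z i - z j)"
  have L: "Q = (\<Sum>i\<in>J. smult (?c i) (\<Prod>j\<in>J-{i}. [:- z j, 1:]))"
    using fin card deg inj by (intro lagrange_interpolation) auto
  have c: "\<bar>?c i\<bar> \<le> M / d" if "i \<in> J" for i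
    unfolding abs_divide abs_prod using M[OF that] den[OF that] d M0 by (intro frac_le) auto
  show "\<bar>poly Q x\<bar> \<le> real (Suc k) * (M * u / d)" if u: "\<And>i. i \<in> J \<Longrightarrow> (\<Prod>j\<in>J-{i}. \<bar>x - z j\<bar>) \<le> u"
  proof -
    have "poly Q x = (\<Sum>i\<in>J. ?c i * (\<Prod>j\<in>J-{i}. x - z j))"
      by (subst L) (simp add: poly_sum poly_prod)
    also have "\<bar>\<dots>\<bar> \<le> (\<Sum>i\<in>J. \<bar>?c i * (\<Prod>j\<in>J-{i}. x - z j)\<bar>)" by (rule sum_abs)
    also have "\<dots> \<le> (\<Sum>i\<in>J. M / d * u)"
    proof (rule sum_mono)
      fix i assume i: "i \<in> J"
      show "\<bar>?c i * (\<Prod>j\<in>J-{i}. x - z j)\<bar> \<le> M / d * u"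
        unfolding abs_mult abs_prod using c[OF i] u[OF i] M0 d
        by (intro mult_mono prod_nonneg) auto
    qed
    finally show ?thesis using card by simp
  qed
  have "coeff Q k = (\<Sum>i\<in>J. ?c i * coeff (\<Prod>j\<in>J-{i}. [:- z j, 1:]) k)"
    by (subst L) (simp add: coeff_sum)
  also have "\<dots> = (\<Sum>i\<in>J. ?c i)"
  proof (rule sum.cong[OF refl])
    fix i assume "i \<in> J"
    hence "card (J - {i}) = k" using fin card by simp
    thus "?c i * coeff (\<Prod>j\<in>J-{i}. [:- z j, 1:]) k = ?c i"
      using coeff_prod_monic_linear[of "J - {i}" z] fin by simp
  qed
  also have "\<bar>\<dots>\<bar> \<le> (\<Sum>i\<in>J. \<bar>?c i\<bar>)" by (rule sum_abs)
  also have "\<dots> \<le> (\<Sum>i\<in>J. M / d)" by (intro sum_mono c)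
  finally show "\<bar>coeff Q k\<bar> \<le> real (Suc k) * (M / d)" using card by simp
qed

text \<open>Finitely many resonances \<open>\<bar>k\<bar> \<le> K\<close> are allowed; this makes the condition invariant under
  shifting the origin and covers \<open>2 * \<theta> = 0\<close>.\<close>

definition nonres :: "real \<Rightarrow> real \<Rightarrow> real \<Rightarrow> nat \<Rightarrow> nat \<Rightarrow> bool" where
  "nonres \<omega> \<theta> b B K \<longleftrightarrow> b > 0 \<and> (\<forall>k::int. \<bar>k\<bar> > int K \<longrightarrow> b \<le> chord (2 * \<theta> + of_int k * \<omega>) * \<bar>of_int k\<bar> ^ B)"

text \<open>One node family's share of a Lagrange denominator, up to powers of 2. All index sums and
  differences are at most \<open>6 * k \<le> 24 * n\<close>, so the arithmetic conditions become
  bounds in powers of \<open>n\<close>; this is the origin of the constants with 24.\<close>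

lemma block_lower:
  assumes D: "dioph \<omega> c N" and NR: "nonres \<omega> \<theta> b B K" and eps: "\<epsilon> > 0"
  obtains C where "C > 0"
    "\<And>a n i k. \<lbrakk>k \<le> 4 * n; \<And>j. j \<in> {a..<a + int n} \<Longrightarrow> int K < i + j + int k - 1 \<and> i + j + int k - 1 \<le> 6 * int k \<and> \<bar>i - j\<bar> \<le> 6 * int k\<rbrakk>
      \<Longrightarrow> exp (- \<epsilon> * of_nat n) \<le> C * (\<Prod>j\<in>{a..<a + int n} - {i}. chord (2 * \<theta> + of_int (i + j + int k - 1) * \<omega>) * chord (of_int (i - j) * \<omega>))"
proof -
  have c: "c > 0" and b: "b > 0" using D NR by (auto simp: dioph_def nonres_def)
  have e2: "\<epsilon> / 2 > 0" and b24: "b / 24 ^ B > 0" and c24: "c / 24 ^ N > 0" using eps b c by auto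
  obtain C1 where C1: "C1 > 0"
    "\<And>x a n A. \<lbrakk>A \<subseteq> {a..<a + int n}; \<And>j. j \<in> {a..<a + int n} - A \<Longrightarrow> chord (x + of_int j * \<omega>) = 0;
       \<And>j. j \<in> A \<Longrightarrow> b / 24 ^ B \<le> chord (x + of_int j * \<omega>) * of_nat n ^ B\<rbrakk>
      \<Longrightarrow> exp (- (\<epsilon> / 2) * of_nat n) \<le> C1 * (\<Prod>j\<in>A. chord (x + of_int j * \<omega>))"
    using prod_chord_int_lower[OF D e2 b24, of B] by blast
  obtain C2 where C2: "C2 > 0"
    "\<And>x a n A. \<lbrakk>A \<subseteq> {a..<a + int n}; \<And>j. j \<in> {a..<a + int n} - A \<Longrightarrow> chord (x + of_int j * \<omega>) = 0;
       \<And>j. j \<in> A \<Longrightarrow> c / 24 ^ N \<le> chord (x + of_int j * \<omega>) * of_nat n ^ N\<rbrakk>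
      \<Longrightarrow> exp (- (\<epsilon> / 2) * of_nat n) \<le> C2 * (\<Prod>j\<in>A. chord (x + of_int j * \<omega>))"
    using prod_chord_int_lower[OF D e2 c24, of N] by blast
  show ?thesis
  proof (rule that[of "2 * C1 * C2"])
    show "0 < 2 * C1 * C2" using C1(1) C2(1) by simp
    fix a :: int and n :: nat and i :: int and k :: nat
    assume kn: "k \<le> 4 * n" and *: "\<And>j. j \<in> {a..<a + int n} \<Longrightarrow> int K < i + j + int k - 1 \<and> i + j + int k - 1 \<le> 6 * int k \<and> \<bar>i - j\<bar> \<le> 6 * int k"
    let ?I = "{a..<a + int n}"
    let ?x = "2 * \<theta> + of_int (i + int k - 1) * \<omega>"
    have x: "2 * \<theta> + of_int (i + j + int k - 1) * \<omega> = ?x + of_int j * \<omega>" for j by (simp add: algebra_simps)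
    have y: "chord (of_int (i - j) * \<omega>) = chord (- of_int i * \<omega> + of_int j * \<omega>)" for j
      using chord_minus[of "of_int (i - j) * \<omega>"] by (simp add: algebra_simps del: chord_minus)
    have pw: "chord z * \<bar>of_int d\<bar> ^ m \<le> 24 ^ m * (chord z * of_nat n ^ m)" if "\<bar>d\<bar> \<le> 6 * int k" for d z m
    proof -
      have "\<bar>of_int d :: real\<bar> \<le> 24 * of_nat n" using that kn by linarith
      hence "\<bar>of_int d :: real\<bar> ^ m \<le> (24 * of_nat n) ^ m" by (intro power_mono) auto
      thus ?thesis by (metis chord_nonneg mult.left_commute mult_left_mono power_mult_distrib)
    qed
    have 1: "exp (- (\<epsilon> / 2) * of_nat n) \<le> C1 * (\<Prod>j\<in>?I. chord (?x + of_int j * \<omega>))"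
    proof (rule C1(2))
      fix j assume j: "j \<in> ?I"
      have "b \<le> chord (2 * \<theta> + of_int (i + j + int k - 1) * \<omega>) * \<bar>of_int (i + j + int k - 1)\<bar> ^ B"
        using NR *[OF j] unfolding nonres_def by (intro NR[unfolded nonres_def, THEN conjunct2, rule_format]) linarith
      also have "\<dots> \<le> 24 ^ B * (chord (2 * \<theta> + of_int (i + j + int k - 1) * \<omega>) * of_nat n ^ B)"
        using *[OF j] by (intro pw) auto
      finally show "b / 24 ^ B \<le> chord (?x + of_int j * \<omega>) * of_nat n ^ B" unfolding x by (simp add: field_simps)
    qed auto
    \<comment> \<open>The estimate for the sums runs over the whole block. Dropping
      \<open>i\<close>, whose factor is at most 2, costs the factor 2 in the constant.\<close>
    have "(\<Prod>j\<in>?I. chord (?x + of_int j * \<omega>)) \<le> 2 * (\<Prod>j\<in>?I-{i}. chord (?x + of_int j * \<omega>))"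
    proof (cases "i \<in> ?I")
      case True
      hence "(\<Prod>j\<in>?I. chord (?x + of_int j * \<omega>)) = chord (?x + of_int i * \<omega>) * (\<Prod>j\<in>?I-{i}. chord (?x + of_int j * \<omega>))"
        by (intro prod.remove) auto
      thus ?thesis by (simp add: mult_right_mono[OF chord_le_2] prod_nonneg)
    next
      case False
      hence "?I - {i} = ?I" by auto
      moreover have "0 \<le> (\<Prod>j\<in>?I. chord (?x + of_int j * \<omega>))" by (intro prod_nonneg) auto
      ultimately show ?thesis by simp
    qed
    hence 2: "exp (- (\<epsilon> / 2) * of_nat n) \<le> 2 * C1 * (\<Prod>j\<in>?I-{i}. chord (?x + of_int j * \<omega>))"
      using order.trans[OF 1 mult_left_mono] C1(1) by fastforce
    \<comment> \<open>For the differences the index \<open>i\<close> itself gives a vanishing chord,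
      the exception that \<open>prod_chord_int_lower\<close> permits.\<close>
    have 3: "exp (- (\<epsilon> / 2) * of_nat n) \<le> C2 * (\<Prod>j\<in>?I-{i}. chord (- of_int i * \<omega> + of_int j * \<omega>))"
    proof (rule C2(2))
      fix j assume j: "j \<in> ?I - {i}"
      have "c \<le> chord (of_int (i - j) * \<omega>) * \<bar>of_int (i - j)\<bar> ^ N"
        using j by (intro diophD[OF D]) auto
      also have "\<dots> \<le> 24 ^ N * (chord (of_int (i - j) * \<omega>) * of_nat n ^ N)"
        using * j by (intro pw) auto
      finally show "c / 24 ^ N \<le> chord (- of_int i * \<omega> + of_int j * \<omega>) * of_nat n ^ N" unfolding y by (simp add: field_simps)
    qed (auto simp: chord_def)
    have "exp (- \<epsilon> * of_nat n) = exp (- (\<epsilon> / 2) * of_nat n) * exp (- (\<epsilon> / 2) * of_nat n)"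
      by (simp add: exp_add[symmetric])
    also have "\<dots> \<le> (2 * C1 * (\<Prod>j\<in>?I-{i}. chord (?x + of_int j * \<omega>))) * (C2 * (\<Prod>j\<in>?I-{i}. chord (- of_int i * \<omega> + of_int j * \<omega>)))"
      using 2 3 C1(1) by (intro mult_mono mult_nonneg_nonneg prod_nonneg) auto
    also have "\<dots> = 2 * C1 * C2 * (\<Prod>j\<in>?I-{i}. chord (?x + of_int j * \<omega>) * chord (- of_int i * \<omega> + of_int j * \<omega>))"
      by (simp add: prod.distrib)
    finally show "exp (- \<epsilon> * of_nat n) \<le> 2 * C1 * C2 * (\<Prod>j\<in>?I - {i}. chord (2 * \<theta> + of_int (i + j + int k - 1) * \<omega>) * chord (of_int (i - j) * \<omega>))"
      unfolding x y .
  qed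
qed

text \<open>The starting sites of the blocks of length \<open>k\<close> whose determinants are interpolated. The two
  families will consist of blocks well around \<open>0\<close> and of blocks well around a distant site; the
  first one is kept one-sided so that all index sums exceed the resonance threshold \<open>K\<close>.\<close>

definition nodes :: "nat \<Rightarrow> nat \<Rightarrow> int \<Rightarrow> nat \<Rightarrow> int \<Rightarrow> nat \<Rightarrow> bool" where
  "nodes K k a n a' n' \<longleftrightarrow> n + n' = Suc k \<and> k \<le> 4 * n \<and> k \<le> 4 * n' \<and> a + int n \<le> a' \<and>
    (\<forall>i\<in>{a..<a + int n} \<union> {a'..<a' + int n'}. \<forall>j\<in>{a..<a + int n} \<union> {a'..<a' + int n'}.
       int K < i + j + int k - 1 \<and> i + j + int k - 1 \<le> 6 * int k \<and> \<bar>i - j\<bar> \<le> 6 * int k)"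

text \<open>Numerators and denominators of the Lagrange basis are both of size
  \<open>(1/2) ^ k\<close> up to small exponentials. In the bound for values these powers cancel; in
  the bound for the leading coefficient there is no numerator, and the denominator leaves
  \<open>2 ^ k\<close>, as for polynomials bounded on [-1, 1].\<close>

lemma interpolation_bounds:
  assumes D: "dioph \<omega> c N" and NR: "nonres \<omega> \<theta> b B K" and eps: "\<epsilon> > 0"
  obtains C where "C > 0"
    "\<And>g e k a n a' n' M. \<lbrakk>nodes K k a n a' n';
        \<And>i. i \<in> {a..<a + int n} \<union> {a'..<a' + int n'} \<Longrightarrow> \<bar>bdet g e (wcos \<omega> \<theta>) i k\<bar> \<le> M\<rbrakk>
      \<Longrightarrow> sdet g e \<omega> k \<le> C * exp (\<epsilon> * of_nat k) * M"
    "\<And>g e k a n a' n'. nodes K k a n a' n' \<Longrightarrow> \<bar>ulead e k\<bar> \<le> C * (2 * exp \<epsilon>) ^ k * sdet g e \<omega> k"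
proof -
  \<comment> \<open>At most three factors \<open>exp (\<delta> * k)\<close> accumulate: from the
    number of nodes, from the numerators and from the denominators.\<close>
  define \<delta> where "\<delta> = \<epsilon> / 4"
  have \<delta>: "\<delta> > 0" and d2: "\<delta> / 2 > 0" using eps by (auto simp: \<delta>_def)
  obtain C1 where C1: "C1 > 0"
    "\<And>a n i k. \<lbrakk>k \<le> 4 * n; \<And>j. j \<in> {a..<a + int n} \<Longrightarrow> int K < i + j + int k - 1 \<and> i + j + int k - 1 \<le> 6 * int k \<and> \<bar>i - j\<bar> \<le> 6 * int k\<rbrakk>
      \<Longrightarrow> exp (- \<delta> * of_nat n) \<le> C1 * (\<Prod>j\<in>{a..<a + int n} - {i}. chord (2 * \<theta> + of_int (i + j + int k - 1) * \<omega>) * chord (of_int (i - j) * \<omega>))"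
    using block_lower[OF D NR \<delta>] by blast
  obtain C2 where C2: "C2 > 0"
    "\<And>x a n i. (\<Prod>j\<in>{a..<a + int n} - {i}. chord (x + of_int j * \<omega>)) \<le> C2 * exp ((\<delta>/2) * of_nat n)"
    using prod_chord_int_upper[OF D d2] by blast
  define C3 where "C3 = (1 + 1 / \<delta>)"
  have C3: "real (Suc k) \<le> C3 * exp (\<delta> * of_nat k)" for k
  proof -
    have "real (Suc k) \<le> (1 + 1 / \<delta>) * (1 + \<delta> * k)" using \<delta> by (simp add: field_simps)
    also have "\<dots> \<le> (1 + 1 / \<delta>) * exp (\<delta> * k)" using \<delta> by (intro mult_left_mono exp_ge_add_one_self) auto
    finally show ?thesis by (simp add: C3_def)
  qed
  have C3p: "C3 > 0" using \<delta> by (simp add: C3_def add_pos_pos)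
  \<comment> \<open>The phase at the centre of the block that starts at site \<open>i\<close>, the
    variable in which \<open>detc_cos_poly\<close> holds. The phases of two nodes add up to
    \<open>2 * \<theta> + (i + j + k - 1) * \<omega>\<close>, which explains the index sums in
    \<open>nodes\<close>.\<close>
  let ?z = "\<lambda>k i. cos (2 * pi * (\<theta> + of_int i * \<omega> + (real k - 1) * \<omega> / 2))"
  let ?d = "\<lambda>k. (1/2) ^ k * (exp (- \<delta> * Suc k) / (C1 * C1))"
  let ?u = "\<lambda>k. (1/2) ^ k * (C2 ^ 4 * exp (\<delta> * Suc k))"
  have nd: "finite J \<and> card J = Suc k \<and> (\<forall>i\<in>J. ?d k \<le> (\<Prod>j\<in>J-{i}. \<bar>?z k i - ?z k j\<bar>)) \<and>
      (\<forall>x. \<forall>i\<in>J. (\<Prod>j\<in>J-{i}. \<bar>cos (2*pi*x) - ?z k j\<bar>) \<le> ?u k)"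
    if nodes: "nodes K k a n a' n'" and J: "J = {a..<a + int n} \<union> {a'..<a' + int n'}" for k a n a' n' J
  proof (intro conjI ballI allI)
    show fin: "finite J" unfolding J by simp
    have nn: "n + n' = Suc k" and k4: "k \<le> 4 * n" "k \<le> 4 * n'" and sep: "a + int n \<le> a'"
      using nodes unfolding nodes_def by blast+
    have disj: "{a..<a + int n} \<inter> {a'..<a' + int n'} = {}" using sep by auto
    show card: "card J = Suc k" unfolding J using nn disj by (subst card_Un_disjoint) auto
    have split: "(\<Prod>j\<in>J-{i}. f j) = (\<Prod>j\<in>{a..<a + int n}-{i}. f j) * (\<Prod>j\<in>{a'..<a' + int n'}-{i}. f j)" for i and f :: "int \<Rightarrow> real"
    proof -
      have "J - {i} = ({a..<a + int n}-{i}) \<union> ({a'..<a' + int n'}-{i})" using J by auto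
      moreover have "(\<Prod>j\<in>({a..<a + int n}-{i}) \<union> ({a'..<a' + int n'}-{i}). f j)
          = (\<Prod>j\<in>{a..<a + int n}-{i}. f j) * (\<Prod>j\<in>{a'..<a' + int n'}-{i}. f j)"
        by (rule prod.union_disjoint) (use disj in blast)+
      ultimately show ?thesis by (rule ssubst)
    qed
    have half: "(\<Prod>j\<in>J-{i}. f j / 2) = (1/2)^k * (\<Prod>j\<in>J-{i}. f j)" if "i \<in> J" for i and f :: "int \<Rightarrow> real"
    proof -
      have "card (J - {i}) = k" using that card fin by simp
      thus ?thesis by (simp add: prod_dividef power_one_over)
    qed
    have nq: "int K < i + j + int k - 1 \<and> i + j + int k - 1 \<le> 6 * int k \<and> \<bar>i - j\<bar> \<le> 6 * int k"
      if "i \<in> J" "j \<in> J" for i j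
      using nodes that unfolding nodes_def J by blast
    {
      fix i assume i: "i \<in> J"
      let ?f = "\<lambda>j. chord (2 * \<theta> + of_int (i + j + int k - 1) * \<omega>) * chord (of_int (i - j) * \<omega>)"
      have "exp (- \<delta> * n) \<le> C1 * (\<Prod>j\<in>{a..<a + int n}-{i}. ?f j)"
        by (rule C1(2)[OF k4(1)], rule nq[OF i]) (simp add: J)
      moreover have "exp (- \<delta> * n') \<le> C1 * (\<Prod>j\<in>{a'..<a' + int n'}-{i}. ?f j)"
        by (rule C1(2)[OF k4(2)], rule nq[OF i]) (simp add: J)
      ultimately have "exp (- \<delta> * n) * exp (- \<delta> * n') \<le> (C1 * (\<Prod>j\<in>{a..<a + int n}-{i}. ?f j)) * (C1 * (\<Prod>j\<in>{a'..<a' + int n'}-{i}. ?f j))"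
        using C1(1) by (intro mult_mono mult_nonneg_nonneg prod_nonneg) auto
      also have "exp (- \<delta> * n) * exp (- \<delta> * n') = exp (- \<delta> * Suc k)"
        unfolding exp_add[symmetric] nn[symmetric] by (simp add: algebra_simps)
      finally have "exp (- \<delta> * Suc k) / (C1 * C1) \<le> (\<Prod>j\<in>J-{i}. ?f j)"
        unfolding split using C1(1) by (simp add: field_simps)
      hence "?d k \<le> (1/2)^k * (\<Prod>j\<in>J-{i}. ?f j)" by (intro mult_left_mono) auto
      also have "\<dots> = (\<Prod>j\<in>J-{i}. ?f j / 2)" by (rule half[OF i, symmetric])
      also have "\<dots> = (\<Prod>j\<in>J-{i}. \<bar>?z k i - ?z k j\<bar>)"
        unfolding cos_diff_chord by (intro prod.cong refl) (simp add: algebra_simps)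
      finally show "?d k \<le> (\<Prod>j\<in>J-{i}. \<bar>?z k i - ?z k j\<bar>)" .
      fix x
      let ?h = "(real k - 1) * \<omega> / 2"
      let ?F = "\<lambda>j. chord ((x + \<theta> + ?h) + of_int j * \<omega>) * chord ((\<theta> + ?h - x) + of_int j * \<omega>)"
      have bl: "(\<Prod>j\<in>{a..<a + int n}-{i}. ?F j) \<le> C2\<^sup>2 * exp (\<delta> * n)" for a n
      proof -
        have "(\<Prod>j\<in>{a..<a + int n}-{i}. ?F j) \<le> (C2 * exp ((\<delta>/2) * of_nat n)) * (C2 * exp ((\<delta>/2) * of_nat n))"
          unfolding prod.distrib using C2(1) by (intro mult_mono C2(2) prod_nonneg) auto
        also have "\<dots> = C2\<^sup>2 * exp (\<delta> * n)" by (simp add: power2_eq_square exp_add[symmetric])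
        finally show ?thesis .
      qed
      have "(\<Prod>j\<in>J-{i}. ?F j) \<le> (C2\<^sup>2 * exp (\<delta> * n)) * (C2\<^sup>2 * exp (\<delta> * n'))"
        unfolding split by (intro mult_mono bl prod_nonneg) auto
      also have "\<dots> = C2 ^ 4 * exp (\<delta> * Suc k)"
        unfolding nn[symmetric] by (simp add: exp_add distrib_left power2_eq_square power4_eq_xxxx)
      finally have "(1/2)^k * (\<Prod>j\<in>J-{i}. ?F j) \<le> ?u k" by (intro mult_left_mono) auto
      moreover have "(\<Prod>j\<in>J-{i}. \<bar>cos (2*pi*x) - ?z k j\<bar>) = (\<Prod>j\<in>J-{i}. ?F j / 2)"
      proof (intro prod.cong refl)
        fix j
        show "\<bar>cos (2*pi*x) - ?z k j\<bar> = ?F j / 2"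
          unfolding cos_diff_chord chord_minus_commute[of x] by (simp add: algebra_simps)
      qed
      ultimately show "(\<Prod>j\<in>J-{i}. \<bar>cos (2*pi*x) - ?z k j\<bar>) \<le> ?u k" using half[OF i] by simp
    }
  qed
  define Cu where "Cu = C3 * (C1 * C1) * C2 ^ 4 * exp (2 * \<delta>)"
  define Cl where "Cl = C3 * (C1 * C1) * exp \<delta>"
  have dpos: "?d k > 0" for k using C1(1) by simp
  have Cup: "Cu > 0" unfolding Cu_def using C1(1) C2(1) C3p by (intro mult_pos_pos) auto
  have Clp: "Cl > 0" unfolding Cl_def using C1(1) C3p by (intro mult_pos_pos) auto
  show ?thesis
  proof (rule that[of "Cu + Cl"])
    show "Cu + Cl > 0" using Cup Clp by simp
    {
      fix g e :: real and k :: nat and a n a' n' M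
      assume nodes: "nodes K k a n a' n'"
        and M: "\<And>i. i \<in> {a..<a + int n} \<union> {a'..<a' + int n'} \<Longrightarrow> \<bar>bdet g e (wcos \<omega> \<theta>) i k\<bar> \<le> M"
      define J where J: "J = {a..<a + int n} \<union> {a'..<a' + int n'}"
      note ndk = nd[OF nodes J]
      obtain Q where Q: "degree Q \<le> k" "coeff Q k = ulead e k"
         "\<And>x. detc g e \<omega> k (x - (real k - 1) * \<omega> / 2) = poly Q (cos (2 * pi * x))"
        using detc_cos_poly by blast
      have Qz: "poly Q (?z k i) = bdet g e (wcos \<omega> \<theta>) i k" for i
        unfolding Q(3)[symmetric] bdet_wcos by simp
      have M': "\<bar>poly Q (?z k i)\<bar> \<le> M" if "i \<in> J" for i unfolding Qz using M that J by simp
      obtain i0 where "i0 \<in> J" using ndk by fastforce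
      hence M0: "0 \<le> M" using M'[of i0] by linarith
      have bd: "\<bar>poly Q (cos (2*pi*x))\<bar> \<le> real (Suc k) * (M * ?u k / ?d k)" for x
        using ndk M' Q(1) by (intro lagrange_poly_bound(1)[where J = J and z = "?z k"] dpos) auto
      have "\<bar>detc g e \<omega> k x\<bar> \<le> (Cu + Cl) * exp (\<epsilon> * of_nat k) * M" for x
      proof -
        have "\<bar>detc g e \<omega> k x\<bar> \<le> real (Suc k) * (M * ?u k / ?d k)"
          using bd[of "x + (real k - 1) * \<omega> / 2"] unfolding Q(3)[symmetric] by simp
        also have "M * ?u k / ?d k = M * (C1 * C1 * C2 ^ 4 * (exp (\<delta> * Suc k) * exp (\<delta> * Suc k)))"
          using C1(1) by (simp add: field_simps mult_exp_exp)
        also have "real (Suc k) * \<dots> \<le> (C3 * exp (\<delta> * k)) * \<dots>"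
          by (rule mult_right_mono[OF C3]) (use M0 C1(1) C2(1) in simp)
        also have "\<dots> = Cu * (exp (\<delta> * k) * exp (\<delta> * k) * exp (\<delta> * k)) * M"
        proof -
          have "exp (\<delta> * Suc k) * exp (\<delta> * Suc k) = exp (2 * \<delta>) * (exp (\<delta> * k) * exp (\<delta> * k))"
            unfolding exp_add[symmetric] by (simp add: algebra_simps)
          thus ?thesis unfolding Cu_def by (simp only: mult_ac)
        qed
        also have "exp (\<delta> * k) * exp (\<delta> * k) * exp (\<delta> * k) = exp (3 * \<delta> * k)"
          by (simp add: exp_add[symmetric])
        also have "Cu * exp (3 * \<delta> * k) * M \<le> (Cu + Cl) * exp (4 * \<delta> * k) * M"
          using Cup Clp \<delta> by (intro mult_right_mono[OF mult_mono] M0) auto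
        finally show ?thesis by (simp add: \<delta>_def)
      qed
      thus "sdet g e \<omega> k \<le> (Cu + Cl) * exp (\<epsilon> * of_nat k) * M" by (rule sdet_le)
    }
    fix g e :: real and k :: nat and a n a' n'
    assume nodes: "nodes K k a n a' n'"
    define J where J: "J = {a..<a + int n} \<union> {a'..<a' + int n'}"
    note ndk = nd[OF nodes J]
    obtain Q where Q: "degree Q \<le> k" "coeff Q k = ulead e k"
       "\<And>x. detc g e \<omega> k (x - (real k - 1) * \<omega> / 2) = poly Q (cos (2 * pi * x))"
      using detc_cos_poly by blast
    have M': "\<bar>poly Q (?z k i)\<bar> \<le> sdet g e \<omega> k" for i
      unfolding Q(3)[symmetric] by (rule abs_detc_le_sdet)
    have "\<bar>ulead e k\<bar> \<le> real (Suc k) * (sdet g e \<omega> k / ?d k)"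
      unfolding Q(2)[symmetric]
      using ndk M' Q(1) by (intro lagrange_poly_bound(2)[where J = J and z = "?z k"] dpos) auto
    also have "sdet g e \<omega> k / ?d k = sdet g e \<omega> k * 2 ^ k * (C1 * C1 * exp (\<delta> * Suc k))"
      using C1(1) by (simp add: field_simps power_one_over mult_exp_exp)
    also have "real (Suc k) * \<dots> \<le> (C3 * exp (\<delta> * k)) * \<dots>"
      by (rule mult_right_mono[OF C3]) (use C1(1) sdet_nonneg[of g e \<omega> k] in simp)
    also have "\<dots> = Cl * (exp (\<delta> * k) * exp (\<delta> * k)) * (2 ^ k * sdet g e \<omega> k)"
    proof -
      have "exp (\<delta> * Suc k) = exp \<delta> * exp (\<delta> * k)"
        unfolding exp_add[symmetric] by (simp add: algebra_simps)
      thus ?thesis unfolding Cl_def by (simp only: mult_ac)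
    qed
    also have "exp (\<delta> * k) * exp (\<delta> * k) = exp (2 * \<delta> * k)"
      by (simp add: exp_add[symmetric])
    also have "Cl * exp (2 * \<delta> * k) * (2 ^ k * sdet g e \<omega> k) \<le> (Cu + Cl) * exp (4 * \<delta> * k) * (2 ^ k * sdet g e \<omega> k)"
      using Cup Clp \<delta> sdet_nonneg[of g e \<omega> k] by (intro mult_right_mono[OF mult_mono]) auto
    also have "\<dots> = (Cu + Cl) * (2 ^ k * exp (4 * \<delta> * k)) * sdet g e \<omega> k" by (simp only: mult_ac)
    also have "2 ^ k * exp (4 * \<delta> * k) = (2 * exp \<epsilon>) ^ k"
      by (simp add: \<delta>_def power_mult_distrib exp_of_nat2_mult)
    finally show "\<bar>ulead e k\<bar> \<le> (Cu + Cl) * (2 * exp \<epsilon>) ^ k * sdet g e \<omega> k" .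
  qed
qed

lemma interpolation_sdet:
  assumes D: "dioph \<omega> c N" and NR: "nonres \<omega> \<theta> b B K" and eps: "\<epsilon> > 0"
  obtains C where "C > 0"
    "\<And>g e k a n a' n' M. \<lbrakk>nodes K k a n a' n';
        \<And>i. i \<in> {a..<a + int n} \<union> {a'..<a' + int n'} \<Longrightarrow> \<bar>bdet g e (wcos \<omega> \<theta>) i k\<bar> \<le> M\<rbrakk>
      \<Longrightarrow> sdet g e \<omega> k \<le> C * exp (\<epsilon> * of_nat k) * M"
proof (rule interpolation_bounds[OF D NR eps])
  fix C assume C: "C > 0"
    and A: "\<And>g e k a n a' n' M. \<lbrakk>nodes K k a n a' n';
        \<And>i. i \<in> {a..<a + int n} \<union> {a'..<a' + int n'} \<Longrightarrow> \<bar>bdet g e (wcos \<omega> \<theta>) i k\<bar> \<le> M\<rbrakk>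
      \<Longrightarrow> sdet g e \<omega> k \<le> C * exp (\<epsilon> * of_nat k) * M"
  show thesis by (rule that[OF C], rule A)
qed

lemma interpolation_ulead:
  assumes D: "dioph \<omega> c N" and NR: "nonres \<omega> \<theta> b B K" and eps: "\<epsilon> > 0"
  obtains C where "C > 0"
    "\<And>g e k a n a' n'. nodes K k a n a' n' \<Longrightarrow> \<bar>ulead e k\<bar> \<le> C * (2 * exp \<epsilon>) ^ k * sdet g e \<omega> k"
proof (rule interpolation_bounds[OF D NR eps])
  fix C assume C: "C > 0"
    and A: "\<And>g e k a n a' n'. nodes K k a n a' n' \<Longrightarrow> \<bar>ulead e k\<bar> \<le> C * (2 * exp \<epsilon>) ^ k * sdet g e \<omega> k"
  show thesis by (rule that[OF C], rule A)
qed

section \<open>Exponential decay of polynomially bounded solutions\<close>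

text \<open>A third of the starting sites lies between about \<open>- k / 2\<close> and
  \<open>- k / 6\<close>, shifted right by \<open>K + 1\<close> to clear the resonances; the rest
  lies between about \<open>y - 5 * k / 6\<close> and \<open>y - k / 6\<close>. The distances of 0
  and of \<open>y\<close> to the block ends are then near \<open>k / 6\<close> at worst, and the
  threshold on \<open>k\<close> leaves \<open>k / 10\<close> after the shift and all
  rounding.\<close>

lemma nodes_exist:
  fixes K :: nat
  assumes k: "60 * (K + 5) \<le> k" and y: "k \<le> y" "y \<le> k + 2"
  obtains a n a' n' where "nodes K k a n a' n'"
    "\<And>i. i \<in> {a..<a + int n} \<Longrightarrow> i \<le> 0 \<and> 0 \<le> i + int k - 1 \<and> int k \<le> 10 * (1 - i) \<and> int k \<le> 10 * (i + int k)"
    "\<And>i. i \<in> {a'..<a' + int n'} \<Longrightarrow> i \<le> int y \<and> int y \<le> i + int k - 1 \<and>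
        int k \<le> 10 * (int y - i + 1) \<and> int k \<le> 10 * (i + int k - int y)"
proof -
  define h n c where "h = k div 2" and "n = k div 3" and "c = k div 6"
  define a a' n' where "a = - int h + int K + 1" and "a' = int y - int k + int c" and "n' = Suc k - n"
  have h: "2 * h \<le> k" "k \<le> 2 * h + 1" by (auto simp: h_def)
  have n: "3 * n \<le> k" "k \<le> 3 * n + 2" by (auto simp: n_def)
  have c: "6 * c \<le> k" "k \<le> 6 * c + 5" by (auto simp: c_def)
  have n': "int n' = int k + 1 - int n" using n by (simp add: n'_def)
  have J1: "- int h + int K + 1 \<le> i \<and> i \<le> - int h + int K + int n" if "i \<in> {a..<a + int n}" for i
    using that by (auto simp: a_def)
  have J2: "int y - int k + int c \<le> i \<and> i \<le> int y + int c - int n" if "i \<in> {a'..<a' + int n'}" for i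
    using that n' by (auto simp: a'_def)
  have J: "- int h + int K + 1 \<le> i \<and> i \<le> int y + int c - int n" if "i \<in> {a..<a + int n} \<union> {a'..<a' + int n'}" for i
    using that J1[of i] J2[of i] h n c k y by auto
  show ?thesis
  proof (rule that[of a n a' n'])
    have "int K < i + j + int k - 1 \<and> i + j + int k - 1 \<le> 6 * int k \<and> \<bar>i - j\<bar> \<le> 6 * int k"
      if "i \<in> {a..<a + int n} \<union> {a'..<a' + int n'}" "j \<in> {a..<a + int n} \<union> {a'..<a' + int n'}" for i j
      using J[OF that(1)] J[OF that(2)] h n c k y by auto
    moreover have "n + n' = Suc k" "k \<le> 4 * n" "k \<le> 4 * n'" "a + int n \<le> a'"
      using h n c k y by (auto simp: n'_def a_def a'_def)
    ultimately show "nodes K k a n a' n'" unfolding nodes_def by blast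
  next
    fix i assume "i \<in> {a..<a + int n}"
    from J1[OF this] show "i \<le> 0 \<and> 0 \<le> i + int k - 1 \<and> int k \<le> 10 * (1 - i) \<and> int k \<le> 10 * (i + int k)"
      using h n c k y by auto
  next
    fix i assume "i \<in> {a'..<a' + int n'}"
    from J2[OF this] show "i \<le> int y \<and> int y \<le> i + int k - 1 \<and>
        int k \<le> 10 * (int y - i + 1) \<and> int k \<le> 10 * (i + int k - int y)"
      using h n c k y by auto
  qed
qed

lemma eventually_exp_less:
  fixes X Y \<delta> :: real
  assumes "Y > 0" "\<delta> > 0"
  shows "\<exists>k1::nat. \<forall>k\<ge>k1. X * exp (- \<delta> * real k) < Y"
proof -
  obtain k1 :: nat where k1: "\<bar>X\<bar> / Y / \<delta> < k1" using reals_Archimedean2 by blast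
  show ?thesis
  proof (intro exI[of _ k1] allI impI)
    fix k assume "k \<ge> k1"
    hence "\<bar>X\<bar> / Y / \<delta> < k" using k1 by linarith
    hence "\<bar>X\<bar> < Y * (\<delta> * k)" using assms by (simp add: field_simps)
    also have "\<dots> < Y * exp (\<delta> * k)" using assms exp_ge_add_one_self[of "\<delta> * k"]
      by (intro mult_strict_left_mono) linarith+
    finally have "\<bar>X\<bar> < Y * exp (\<delta> * k)" .
    hence "X < Y * exp (\<delta> * k)" by linarith
    thus "X * exp (- \<delta> * k) < Y" by (simp add: exp_minus field_simps)
  qed
qed

lemma dioph_double:
  assumes "dioph \<omega> c N"
  shows "dioph (2 * \<omega>) (c / 2 ^ N) N"
  unfolding dioph_def
proof (intro conjI allI impI)
  fix d :: int assume d: "d \<noteq> 0"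
  have "c \<le> chord (of_int (2 * d) * \<omega>) * \<bar>of_int (2 * d)\<bar> ^ N" using d by (intro diophD[OF assms]) auto
  thus "c / 2 ^ N \<le> chord (of_int d * (2 * \<omega>)) * \<bar>of_int d\<bar> ^ N"
    by (simp add: field_simps abs_mult power_mult_distrib)
qed (use assms in \<open>auto simp: dioph_def\<close>)

text \<open>Each cosine is half a chord along the doubled rotation, and products of chords grow
  slower than any exponential; hence the rate \<open>- ln 2\<close>, the mean of the logarithm of
  the absolute cosine.\<close>

lemma prod_wcos_upper:
  assumes D: "dioph \<omega> c N" and eps: "\<epsilon> > 0"
  obtains C where "C > 0"
    "\<And>a n. \<bar>\<Prod>j\<in>{a..<a + int n}. wcos \<omega> \<theta> j\<bar> \<le> C * exp ((\<epsilon> - ln 2) * n)"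
proof -
  obtain C where C: "C > 0"
    "\<And>x a n i. (\<Prod>j\<in>{a..<a + int n} - {i}. chord (x + of_int j * (2 * \<omega>))) \<le> C * exp (\<epsilon> * of_nat n)"
    using prod_chord_int_upper[OF dioph_double[OF D] eps] by blast
  show ?thesis
  proof (rule that[OF C(1)])
    fix a :: int and n :: nat
    have "\<bar>\<Prod>j\<in>{a..<a + int n}. wcos \<omega> \<theta> j\<bar> = (\<Prod>j\<in>{a..<a + int n}. chord ((2 * \<theta> + 1/2) + of_int j * (2 * \<omega>)) / 2)"
      unfolding abs_prod
    proof (intro prod.cong refl)
      fix j
      show "\<bar>wcos \<omega> \<theta> j\<bar> = chord ((2 * \<theta> + 1/2) + of_int j * (2 * \<omega>)) / 2"
        using abs_two_cos_chord[of "\<theta> + of_int j * \<omega>"] by (simp add: wcos_def algebra_simps)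
    qed
    \<comment> \<open>The site \<open>a - 1\<close> lies outside the block, so nothing is
      removed.\<close>
    also have "\<dots> = (\<Prod>j\<in>{a..<a + int n} - {a - 1}. chord ((2 * \<theta> + 1/2) + of_int j * (2 * \<omega>))) / 2 ^ n"
      by (simp add: prod_dividef)
    also have "\<dots> \<le> C * exp (\<epsilon> * of_nat n) / 2 ^ n" by (intro divide_right_mono C(2)) auto
    also have "\<dots> = C * exp ((\<epsilon> - ln 2) * n)"
      by (simp add: left_diff_distrib exp_diff exp_of_nat2_mult)
    finally show "\<bar>\<Prod>j\<in>{a..<a + int n}. wcos \<omega> \<theta> j\<bar> \<le> C * exp ((\<epsilon> - ln 2) * n)" .
  qed
qed

text \<open>The lower bound for \<open>L\<close> compares \<open>q ^ k\<close>, obtained from the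
  leading coefficient, with \<open>exp ((L + \<delta>) * k)\<close> as \<open>k\<close> grows. One
  \<delta> is lost in \<open>q\<close> and one in the upper bound.\<close>

lemma growth_rate:
  assumes D: "dioph \<omega> c N" and NR: "nonres \<omega> \<theta> b B K"
    and \<rho>: "\<rho> > 1" "\<rho> + 1 / \<rho> = \<bar>e\<bar>" and \<delta>: "\<delta> > 0"
  shows "\<exists>L C. C > 0 \<and> (\<forall>k\<ge>1. exp (L * k) \<le> 2 * ndet g e \<omega> k) \<and>
    (\<forall>k. sdet g e \<omega> k \<le> C * exp ((L + \<delta>) * k)) \<and> ln \<rho> - ln 2 - 2 * \<delta> \<le> L"
proof -
  obtain C1 where C1: "C1 > 0"
    "\<And>g e k a n a' n'. nodes K k a n a' n' \<Longrightarrow> \<bar>ulead e k\<bar> \<le> C1 * (2 * exp \<delta>) ^ k * sdet g e \<omega> k"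
    using interpolation_ulead[OF D NR \<delta>] by blast
  define q where "q = \<rho> / (2 * exp \<delta>)"
  have q: "q > 0" using \<rho> by (simp add: q_def)
  have slow: "1 / C1 * q ^ k \<le> sdet g e \<omega> k" if k: "60 * (K + 5) \<le> k" for k
  proof -
    obtain a n a' n' where "nodes K k a n a' n'" by (rule nodes_exist[OF k le_refl le_add1]) blast
    from C1(2)[OF this] have "\<rho> ^ k \<le> C1 * (2 * exp \<delta>) ^ k * sdet g e \<omega> k"
      using ulead_lower[of \<rho> e k] \<rho> by (meson less_imp_le order_trans)
    hence "\<rho> ^ k / (2 * exp \<delta>) ^ k \<le> C1 * sdet g e \<omega> k" by (simp add: field_simps)
    thus ?thesis using C1(1) by (simp add: q_def power_divide field_simps)
  qed
  have c1: "1 / C1 > 0" using C1(1) by simp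
  have sn: "sdet g e \<omega> k \<le> ndet g e \<omega> k" for k by (simp add: ndet_def)
  obtain L where L: "\<And>k. k \<ge> 1 \<Longrightarrow> exp (L * k) \<le> 2 * ndet g e \<omega> k"
    "\<And>\<epsilon>. \<epsilon> > 0 \<Longrightarrow> \<exists>C>0. \<forall>k\<ge>1. ndet g e \<omega> k \<le> C * exp ((L + \<epsilon>) * k)"
    using submult_growth_rate[where N = "ndet g e \<omega>", OF ndet_submult ndet_nonneg c1 q order.trans[OF slow sn]] by blast
  obtain C2 where C2: "C2 > 0" "\<And>k. k \<ge> 1 \<Longrightarrow> ndet g e \<omega> k \<le> C2 * exp ((L + \<delta>) * k)"
    using L(2)[OF \<delta>] by auto
  define C where "C = max 1 C2"
  have sup: "sdet g e \<omega> k \<le> C * exp ((L + \<delta>) * k)" for k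
  proof (cases "k = 0")
    case False
    have "sdet g e \<omega> k \<le> C2 * exp ((L + \<delta>) * k)" using sn[of k] C2(2)[of k] False by linarith
    also have "\<dots> \<le> C * exp ((L + \<delta>) * k)" by (intro mult_right_mono) (auto simp: C_def)
    finally show ?thesis .
  qed (simp add: sdet_0 C_def)
  have "q / exp (L + \<delta>) \<le> 1"
  proof (rule ccontr)
    let ?r = "q / exp (L + \<delta>)"
    assume "\<not> ?r \<le> 1"
    hence r: "?r > 1" by simp
    obtain m where m: "C1 * C < ?r ^ m" using real_arch_pow[OF r] by blast
    define k where "k = m + 60 * (K + 5)"
    have "?r ^ m \<le> ?r ^ k" using r unfolding k_def by (intro power_increasing) auto
    moreover have "1 / C1 * q ^ k \<le> C * exp ((L + \<delta>) * k)" using slow[of k] sup[of k] by (simp add: k_def)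
    hence "?r ^ k \<le> C1 * C" using C1(1)
      by (simp add: power_divide field_simps exp_of_nat2_mult[symmetric])
    ultimately show False using m by linarith
  qed
  hence "q \<le> exp (L + \<delta>)" by (simp add: field_simps)
  hence "ln q \<le> ln (exp (L + \<delta>))" using q by (subst ln_le_cancel_iff) auto
  hence "ln q \<le> L + \<delta>" by simp
  moreover have "ln q = ln \<rho> - ln 2 - \<delta>" using \<rho> by (simp add: q_def ln_div ln_mult)
  ultimately have "ln \<rho> - ln 2 - 2 * \<delta> \<le> L" by linarith
  moreover have "C > 0" by (simp add: C_def)
  ultimately show ?thesis using L(1) sup by blast
qed

text \<open>By interpolation some block determinant at a node is large. It cannot belong to a block around
  \<open>0\<close>, since \<open>sol_green\<close> would then force \<open>\<psi> 0\<close> to be tiny; hence it belongs to a block around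
  \<open>y\<close>, and \<open>sol_green\<close> makes \<open>\<psi> y\<close> exponentially small.\<close>

lemma decay_right:
  assumes D: "dioph \<omega> c N" and NR: "nonres \<omega> \<theta> b B K" and e: "\<bar>e\<bar> > 2"
    and S: "sol g e (wcos \<omega> \<theta>) \<psi>" and P: "\<And>m. \<bar>\<psi> m\<bar> \<le> P * (1 + \<bar>of_int m\<bar>)" and nz: "\<psi> 0 \<noteq> 0"
  obtains C r where "r > 0" "\<And>y::nat. \<bar>\<psi> (int y)\<bar> \<le> C * exp (- r * real y)"
proof -
  \<comment> \<open>The larger root of \<rho> + 1/\<rho> = \<open>\<bar>e\<bar>\<close>.\<close>
  define \<rho> where "\<rho> = (\<bar>e\<bar> + sqrt (e\<^sup>2 - 4)) / 2"
  have "2\<^sup>2 < \<bar>e\<bar>\<^sup>2" using e by (intro power_strict_mono) auto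
  hence e4: "e\<^sup>2 - 4 > 0" by simp
  have \<rho>1: "\<rho> > 1" using e e4 by (simp add: \<rho>_def add_pos_nonneg) (smt (verit) real_sqrt_ge_zero)
  have "\<rho> * (\<bar>e\<bar> - \<rho>) = (\<bar>e\<bar>\<^sup>2 - (sqrt (e\<^sup>2 - 4))\<^sup>2) / 4"
    by (simp add: \<rho>_def field_simps power2_eq_square)
  also have "\<dots> = 1" using e4 by simp
  finally have \<rho>2: "\<rho> + 1 / \<rho> = \<bar>e\<bar>" using \<rho>1 by (simp add: field_simps)
  \<comment> \<open>This makes \<open>L + ln 2\<close> at least \<open>98 * \<delta>\<close>;
    \<open>90 * \<delta>\<close> is used, because a block side may hold only a tenth of the sites
    and a gain of \<open>9 * \<delta>\<close> per site of the block is wanted.\<close>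
  define \<delta> where "\<delta> = ln \<rho> / 100"
  have \<delta>: "\<delta> > 0" using \<rho>1 by (simp add: \<delta>_def)
  obtain C1 where C1: "C1 > 0"
    "\<And>g e k a n a' n' M. \<lbrakk>nodes K k a n a' n';
        \<And>i. i \<in> {a..<a + int n} \<union> {a'..<a' + int n'} \<Longrightarrow> \<bar>bdet g e (wcos \<omega> \<theta>) i k\<bar> \<le> M\<rbrakk>
      \<Longrightarrow> sdet g e \<omega> k \<le> C1 * exp (\<delta> * of_nat k) * M"
    using interpolation_sdet[OF D NR \<delta>] by blast
  obtain L C3 where C3: "C3 > 0" and L1': "\<forall>k\<ge>1. exp (L * k) \<le> 2 * ndet g e \<omega> k"
    and L2': "\<forall>k. sdet g e \<omega> k \<le> C3 * exp ((L + \<delta>) * k)" and L3: "ln \<rho> - ln 2 - 2 * \<delta> \<le> L"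
    using growth_rate[OF D NR \<rho>1 \<rho>2 \<delta>, of g] by blast
  note L1 = L1'[rule_format] and L2 = L2'[rule_format]
  obtain C4 where C4: "C4 > 0"
    "\<And>a n. \<bar>\<Prod>j\<in>{a..<a + int n}. wcos \<omega> \<theta> j\<bar> \<le> C4 * exp ((\<delta> - ln 2) * n)"
    using prod_wcos_upper[OF D \<delta>, of \<theta>] by blast
  have P0: "P \<ge> 0" using P[of 0] by simp
  define A where "A = 2 * C3 * C4 * P"
  have A0: "A \<ge> 0" unfolding A_def using C3 C4 P0 by simp
  have Lam: "90 * \<delta> \<le> L + ln 2" using L3 \<delta> by (simp add: \<delta>_def)
  \<comment> \<open>Each of the \<open>Suc i\<close> sites covered by cosines instead of a
    determinant gains \<open>L + ln 2\<close>. With at least \<open>k / 10\<close> of them the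
    exponent falls from \<open>(L + \<delta>) * k\<close> to
    \<open>(L - 8 * \<delta>) * k\<close>.\<close>
  have ex: "exp ((L + \<delta>) * l) * exp ((\<delta> - ln 2) * Suc i) \<le> exp ((L - 8 * \<delta>) * k)"
    if k: "k = Suc (i + l)" "k \<le> 10 * Suc i" for i l k :: nat
  proof -
    have "9 * \<delta> * k \<le> 9 * \<delta> * (10 * Suc i)" using that \<delta> by (intro mult_left_mono) auto
    also have "\<dots> = 90 * \<delta> * Suc i" by simp
    also have "\<dots> \<le> (L + ln 2) * Suc i" using Lam by (intro mult_right_mono) auto
    finally have "9 * \<delta> * k \<le> (L + ln 2) * Suc i" .
    moreover have "(L + \<delta>) * l + (\<delta> - ln 2) * Suc i = (L + \<delta>) * k - (L + ln 2) * Suc i"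
      unfolding k(1) by (simp add: algebra_simps)
    ultimately show ?thesis unfolding mult_exp_exp by (simp add: algebra_simps)
  qed
  have green: "\<bar>bdet g e (wcos \<omega> \<theta>) s k\<bar> * \<bar>\<psi> y\<bar> \<le> A * (1 + \<bar>of_int y\<bar> + k) * exp ((L - 8 * \<delta>) * k)"
    if s: "s \<le> y" "y \<le> s + int k - 1" "int k \<le> 10 * (y - s + 1)" "int k \<le> 10 * (s + int k - y)" for s y :: int and k :: nat
  proof -
    define i l where "i = nat (y - s)" and "l = nat (s + int k - 1 - y)"
    have il: "s = y - int i" "k = i + l + 1" using s by (auto simp: i_def l_def)
    have ki: "k \<le> 10 * Suc i" "k \<le> 10 * Suc l" using s unfolding il by auto
    let ?w = "wcos \<omega> \<theta>" and ?X = "1 + \<bar>of_int y\<bar> + real k" and ?E = "exp ((L - 8 * \<delta>) * k)"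
    have w1: "\<bar>\<Prod>j=y - int i..y. ?w j\<bar> \<le> C4 * exp ((\<delta> - ln 2) * Suc i)"
    proof -
      have "{y - int i..y} = {y - int i..<(y - int i) + int (Suc i)}" by auto
      thus ?thesis using C4(2)[of "y - int i" "Suc i"] by (simp only:)
    qed
    have w2: "\<bar>\<Prod>j=y..y + int l. ?w j\<bar> \<le> C4 * exp ((\<delta> - ln 2) * Suc l)"
    proof -
      have "{y..y + int l} = {y..<y + int (Suc l)}" by auto
      thus ?thesis using C4(2)[of y "Suc l"] by (simp only:)
    qed
    have d: "\<bar>bdet g e ?w t m\<bar> \<le> C3 * exp ((L + \<delta>) * m)" for t m
      unfolding bdet_wcos using abs_detc_le_sdet L2 by (rule order_trans)
    have p: "\<bar>\<psi> m\<bar> \<le> P * ?X" if "\<bar>m\<bar> \<le> \<bar>y\<bar> + int k" for m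
    proof -
      have "1 + \<bar>of_int m\<bar> \<le> ?X" using that by linarith
      thus ?thesis using P[of m] P0 by (meson mult_left_mono order_trans)
    qed
    have t1: "\<bar>bdet g e ?w (y + 1) l * (\<Prod>j=y - int i..y. ?w j) * \<psi> (y - int i - 1)\<bar> \<le> C3 * C4 * P * ?X * ?E"
    proof -
      have "\<bar>bdet g e ?w (y + 1) l * (\<Prod>j=y - int i..y. ?w j) * \<psi> (y - int i - 1)\<bar>
          \<le> (C3 * exp ((L + \<delta>) * l)) * (C4 * exp ((\<delta> - ln 2) * Suc i)) * (P * ?X)"
        unfolding abs_mult using C3 C4(1)
        by (intro mult_mono d w1 p mult_nonneg_nonneg) (use il in auto)
      also have "\<dots> = (C3 * C4 * P * ?X) * (exp ((L + \<delta>) * l) * exp ((\<delta> - ln 2) * Suc i))" by (simp only: mult_ac)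
      also have "\<dots> \<le> (C3 * C4 * P * ?X) * ?E"
        using C3 C4(1) P0 il ki by (intro mult_left_mono ex) auto
      finally show ?thesis .
    qed
    have t2: "\<bar>bdet g e ?w (y - int i) i * (\<Prod>j=y..y + int l. ?w j) * \<psi> (y + int l + 1)\<bar> \<le> C3 * C4 * P * ?X * ?E"
    proof -
      have "\<bar>bdet g e ?w (y - int i) i * (\<Prod>j=y..y + int l. ?w j) * \<psi> (y + int l + 1)\<bar>
          \<le> (C3 * exp ((L + \<delta>) * i)) * (C4 * exp ((\<delta> - ln 2) * Suc l)) * (P * ?X)"
        unfolding abs_mult using C3 C4(1)
        by (intro mult_mono d w2 p mult_nonneg_nonneg) (use il in auto)
      also have "\<dots> = (C3 * C4 * P * ?X) * (exp ((L + \<delta>) * i) * exp ((\<delta> - ln 2) * Suc l))" by (simp only: mult_ac)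
      also have "\<dots> \<le> (C3 * C4 * P * ?X) * ?E"
        using C3 C4(1) P0 il ki by (intro mult_left_mono ex) auto
      finally show ?thesis .
    qed
    have "\<bar>bdet g e ?w s k\<bar> * \<bar>\<psi> y\<bar> = \<bar>bdet g e ?w (y - int i) (i + l + 1) * \<psi> y\<bar>"
      using il by (simp add: abs_mult)
    also have "\<dots> \<le> C3 * C4 * P * ?X * ?E + C3 * C4 * P * ?X * ?E"
      unfolding sol_green[OF S] using t1 t2 by linarith
    finally show ?thesis by (simp add: A_def)
  qed
  \<comment> \<open>The threshold \<open>L - 4 * \<delta>\<close> leaves a margin on both sides:
    interpolation guarantees it at some node for large \<open>k\<close>, and dividing the bound with
    \<open>L - 8 * \<delta>\<close> by it still gives decay.\<close>
  have small: "\<bar>\<psi> y\<bar> \<le> A * (1 + \<bar>of_int y\<bar> + k) * exp (- 4 * \<delta> * k)"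
    if s: "s \<le> y" "y \<le> s + int k - 1" "int k \<le> 10 * (y - s + 1)" "int k \<le> 10 * (s + int k - y)"
      and big: "exp ((L - 4 * \<delta>) * k) \<le> \<bar>bdet g e (wcos \<omega> \<theta>) s k\<bar>" for s y :: int and k :: nat
  proof -
    have "exp ((L - 4 * \<delta>) * k) * \<bar>\<psi> y\<bar> \<le> \<bar>bdet g e (wcos \<omega> \<theta>) s k\<bar> * \<bar>\<psi> y\<bar>" using big by (intro mult_right_mono) auto
    also have "\<dots> \<le> A * (1 + \<bar>of_int y\<bar> + k) * exp ((L - 8 * \<delta>) * k)" by (rule green[OF s])
    also have "exp ((L - 8 * \<delta>) * k) = exp ((L - 4 * \<delta>) * k) * exp (- 4 * \<delta> * k)"
      by (simp add: mult_exp_exp algebra_simps)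
    finally have "exp ((L - 4 * \<delta>) * k) * \<bar>\<psi> y\<bar>
        \<le> exp ((L - 4 * \<delta>) * k) * (A * (1 + \<bar>of_int y\<bar> + k) * exp (- 4 * \<delta> * k))"
      by (simp only: mult_ac)
    thus ?thesis by (simp only: mult_le_cancel_left_pos[OF exp_gt_zero])
  qed
  have lin: "1 + real m \<le> (1 + 1 / \<delta>) * exp (\<delta> * m)" for m
  proof -
    have "1 + real m \<le> (1 + 1 / \<delta>) * (1 + \<delta> * m)" using \<delta> by (simp add: field_simps)
    also have "\<dots> \<le> (1 + 1 / \<delta>) * exp (\<delta> * m)" using \<delta> by (intro mult_left_mono exp_ge_add_one_self) auto
    finally show ?thesis .
  qed
  have p1: "0 < \<bar>\<psi> 0\<bar>" and d3: "0 < 3 * \<delta>" using nz \<delta> by auto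
  obtain k1 :: nat where k1: "\<forall>k\<ge>k1. (A * (1 + 1 / \<delta>)) * exp (- (3 * \<delta>) * real k) < \<bar>\<psi> 0\<bar>"
    using eventually_exp_less[OF p1 d3, of "A * (1 + 1 / \<delta>)"] by blast
  \<comment> \<open>The exponential pays for a difference of at most 2 between \<open>k\<close> and
    \<open>y\<close>, the 2 for the constant in \<open>L1\<close>.\<close>
  have p2: "0 < exp (- 2 * \<bar>L\<bar>) / 2" by simp
  obtain k2 :: nat where k2: "\<forall>k\<ge>k2. C1 * exp (- (3 * \<delta>) * real k) < exp (- 2 * \<bar>L\<bar>) / 2"
    using eventually_exp_less[OF p2 d3, of C1] by blast
  define y0 where "y0 = k1 + k2 + 60 * (K + 5) + 2"
  define C where "C = A * (1 + 1 / \<delta>) * exp (8 * \<delta>) + P * (1 + y0) * exp (2 * \<delta> * y0)"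
  have Cnn: "0 \<le> A * (1 + 1 / \<delta>) * exp (8 * \<delta>)" "0 \<le> P * (1 + y0) * exp (2 * \<delta> * y0)"
    using A0 \<delta> P0 by auto
  show ?thesis
  proof (rule that[of "2 * \<delta>" C])
    fix y :: nat
    show "\<bar>\<psi> (int y)\<bar> \<le> C * exp (- (2 * \<delta>) * y)"
    proof (cases "y \<ge> y0")
      case False
      have "\<bar>\<psi> (int y)\<bar> \<le> P * (1 + y)" using P[of "int y"] by simp
      also have "\<dots> \<le> P * (1 + y0) * 1" using False P0 by (simp add: mult_left_mono)
      also have "\<dots> \<le> P * (1 + y0) * (exp (2 * \<delta> * y0) * exp (- (2 * \<delta>) * y))"
        unfolding mult_exp_exp using False P0 \<delta> by (intro mult_left_mono) (auto simp: algebra_simps)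
      also have "\<dots> = (P * (1 + y0) * exp (2 * \<delta> * y0)) * exp (- (2 * \<delta>) * y)" by (simp only: mult.assoc)
      also have "\<dots> \<le> C * exp (- (2 * \<delta>) * y)"
        unfolding C_def by (intro mult_right_mono le_add_same_cancel2[THEN iffD2] Cnn(1)) simp
      finally show ?thesis .
    next
      case True
      \<comment> \<open>Only one of three consecutive lengths is known to have a large determinant,
        so the block length depends on \<open>y\<close>; \<open>nodes_exist\<close> allows for
        this.\<close>
      have "\<exists>k\<in>{y, y - 1, y - 2}. sdet g e \<omega> k = ndet g e \<omega> y"
        unfolding ndet_def max_def by simp
      then obtain k where k: "k \<in> {y, y - 1, y - 2}" "sdet g e \<omega> k = ndet g e \<omega> y" by blast
      have ky: "k \<le> y" "y \<le> k + 2" "k1 \<le> k" "k2 \<le> k" "60 * (K + 5) \<le> k" "1 \<le> y"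
        using k(1) True by (auto simp: y0_def)
      obtain a n a' n' where nodes: "nodes K k a n a' n'"
        and I1: "\<And>i. i \<in> {a..<a + int n} \<Longrightarrow> i \<le> 0 \<and> 0 \<le> i + int k - 1 \<and> int k \<le> 10 * (1 - i) \<and> int k \<le> 10 * (i + int k)"
        and I2: "\<And>i. i \<in> {a'..<a' + int n'} \<Longrightarrow> i \<le> int y \<and> int y \<le> i + int k - 1 \<and>
            int k \<le> 10 * (int y - i + 1) \<and> int k \<le> 10 * (i + int k - int y)"
        using nodes_exist[OF ky(5,1,2)] by blast
      have "\<exists>i\<in>{a..<a + int n} \<union> {a'..<a' + int n'}. exp ((L - 4 * \<delta>) * k) \<le> \<bar>bdet g e (wcos \<omega> \<theta>) i k\<bar>"
      proof (rule ccontr)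
        assume neg: "\<not> ?thesis"
        have "sdet g e \<omega> k \<le> C1 * exp (\<delta> * k) * exp ((L - 4 * \<delta>) * k)"
          by (rule C1(2)[OF nodes]) (use neg in force)
        also have "\<dots> = C1 * exp (- (3 * \<delta>) * k) * exp (L * k)"
          unfolding mult.assoc mult_exp_exp by (simp add: algebra_simps)
        also have "\<dots> < exp (- 2 * \<bar>L\<bar>) / 2 * exp (L * k)" using k2[rule_format, OF ky(4)] by (intro mult_strict_right_mono) auto
        also have "\<dots> = exp (L * k - 2 * \<bar>L\<bar>) / 2" by (simp add: mult_exp_exp)
        also have "\<dots> \<le> exp (L * y) / 2"
        proof -
          have "L * k - 2 * \<bar>L\<bar> \<le> L * y"
          proof -
            have "- (L * (real y - real k)) \<le> \<bar>L\<bar> * (real y - real k)"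
              using ky by (metis abs_ge_minus_self abs_mult abs_of_nonneg diff_ge_0_iff_ge of_nat_mono)
            also have "\<dots> \<le> \<bar>L\<bar> * 2" using ky by (intro mult_left_mono) auto
            finally show ?thesis by (simp add: algebra_simps)
          qed
          thus ?thesis by simp
        qed
        also have "\<dots> \<le> ndet g e \<omega> y" using L1[OF ky(6)] by simp
        finally show False using k(2) by simp
      qed
      then obtain i where i: "i \<in> {a..<a + int n} \<union> {a'..<a' + int n'}"
        and big: "exp ((L - 4 * \<delta>) * k) \<le> \<bar>bdet g e (wcos \<omega> \<theta>) i k\<bar>" by blast
      have "i \<notin> {a..<a + int n}"
      proof
        assume "i \<in> {a..<a + int n}"
        from I1[OF this] have "\<bar>\<psi> 0\<bar> \<le> A * (1 + \<bar>of_int 0\<bar> + k) * exp (- 4 * \<delta> * k)"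
          using big by (intro small[of i]) auto
        also have "\<dots> \<le> A * ((1 + 1 / \<delta>) * exp (\<delta> * k)) * exp (- 4 * \<delta> * k)"
          using lin[of k] A0 by (intro mult_right_mono mult_left_mono) auto
        also have "\<dots> = A * (1 + 1 / \<delta>) * exp (- (3 * \<delta>) * k)"
          unfolding mult.assoc mult_exp_exp by (simp add: algebra_simps)
        also have "\<dots> < \<bar>\<psi> 0\<bar>" by (rule k1[rule_format, OF ky(3)])
        finally show False by simp
      qed
      hence "i \<in> {a'..<a' + int n'}" using i by blast
      from I2[OF this] have "\<bar>\<psi> (int y)\<bar> \<le> A * (1 + \<bar>of_int (int y)\<bar> + k) * exp (- 4 * \<delta> * k)"
        using big by (intro small[of i]) auto
      also have "\<dots> \<le> A * (1 + real (2 * y)) * exp (8 * \<delta> - 4 * \<delta> * y)"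
      proof (intro mult_mono mult_left_mono)
        have "4 * \<delta> * y \<le> 4 * \<delta> * (k + 2)" using ky \<delta> by (intro mult_left_mono) auto
        thus "exp (- 4 * \<delta> * k) \<le> exp (8 * \<delta> - 4 * \<delta> * y)" by (simp add: algebra_simps)
      qed (use ky A0 in auto)
      also have "\<dots> \<le> A * ((1 + 1 / \<delta>) * exp (\<delta> * (2 * y))) * exp (8 * \<delta> - 4 * \<delta> * y)"
        using lin[of "2 * y"] A0 by (intro mult_right_mono mult_left_mono) auto
      also have "\<dots> = A * (1 + 1 / \<delta>) * exp (8 * \<delta>) * exp (- (2 * \<delta>) * y)"
        unfolding mult.assoc mult_exp_exp by (simp add: algebra_simps)
      also have "\<dots> \<le> C * exp (- (2 * \<delta>) * y)"
        unfolding C_def by (intro mult_right_mono le_add_same_cancel1[THEN iffD2] Cnn(2)) simp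
      finally show ?thesis .
    qed
  qed (use \<delta> in simp)
qed

text \<open>Moving the phase by \<open>p\<close> sites moves the resonance index by
  \<open>2 * p\<close>. Raising the threshold by twice the size of \<open>p\<close> keeps the moved
  index above \<open>K\<close> in absolute value and at most doubles it, hence
  \<open>2 ^ B\<close>.\<close>

lemma nonres_shift:
  assumes "nonres \<omega> \<theta> b B K"
  shows "nonres \<omega> (\<theta> + of_int p * \<omega>) (b / 2 ^ B) B (K + 2 * nat \<bar>p\<bar>)"
  unfolding nonres_def
proof (intro conjI allI impI)
  fix k :: int assume k: "\<bar>k\<bar> > int (K + 2 * nat \<bar>p\<bar>)"
  have "b \<le> chord (2 * \<theta> + of_int (k + 2 * p) * \<omega>) * \<bar>of_int (k + 2 * p)\<bar> ^ B"
    using k by (intro assms[unfolded nonres_def, THEN conjunct2, rule_format]) linarith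
  also have "\<dots> \<le> chord (2 * \<theta> + of_int (k + 2 * p) * \<omega>) * (2 * \<bar>of_int k\<bar>) ^ B"
    using k by (intro mult_left_mono power_mono) auto
  also have "2 * \<theta> + of_int (k + 2 * p) * \<omega> = 2 * (\<theta> + of_int p * \<omega>) + of_int k * \<omega>" by (simp add: algebra_simps)
  finally show "b / 2 ^ B \<le> chord (2 * (\<theta> + of_int p * \<omega>) + of_int k * \<omega>) * \<bar>of_int k\<bar> ^ B"
    by (simp add: field_simps power_mult_distrib)
qed (use assms in \<open>auto simp: nonres_def\<close>)

lemma nonres_minus: "nonres \<omega> \<theta> b B K \<Longrightarrow> nonres \<omega> (- \<theta>) b B K"
  unfolding nonres_def
proof (elim conjE, intro conjI allI impI)
  fix k :: int
  assume *: "\<forall>k. int K < \<bar>k\<bar> \<longrightarrow> b \<le> chord (2 * \<theta> + of_int k * \<omega>) * \<bar>of_int k\<bar> ^ B" and "int K < \<bar>k\<bar>"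
  hence "b \<le> chord (2 * \<theta> + of_int (- k) * \<omega>) * \<bar>of_int (- k)\<bar> ^ B"
    by (intro *[rule_format]) simp
  also have "2 * \<theta> + of_int (- k) * \<omega> = - (2 * (- \<theta>) + of_int k * \<omega>)" by simp
  finally show "b \<le> chord (2 * (- \<theta>) + of_int k * \<omega>) * \<bar>of_int k\<bar> ^ B" unfolding chord_minus by simp
qed

text \<open>\<open>decay_right\<close> requires a nonzero value at the origin, so the origin is
  moved to a site \<open>p\<close> where the solution does not vanish. The left half-line is the
  right one of the reflected solution, which belongs to the opposite phase.\<close>

theorem sol_exp_decay:
  assumes D: "dioph \<omega> c N" and NR: "nonres \<omega> \<theta> b B K" and e: "\<bar>e\<bar> > 2"
    and S: "sol g e (wcos \<omega> \<theta>) \<psi>" and P: "\<And>m. \<bar>\<psi> m\<bar> \<le> P * (1 + \<bar>of_int m\<bar>)"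
  obtains C r where "r > 0" "C \<ge> 0" "\<And>m. \<bar>\<psi> m\<bar> \<le> C * exp (- r * \<bar>of_int m\<bar>)"
proof (cases "\<forall>p. \<psi> p = 0")
  case True
  thus ?thesis using that[of 1 0] by simp
next
  case False
  then obtain p where p: "\<psi> p \<noteq> 0" by blast
  define \<psi>1 where "\<psi>1 m = \<psi> (m + p)" for m
  define \<theta>1 where "\<theta>1 = \<theta> + of_int p * \<omega>"
  have P0: "P \<ge> 0" using P[of 0] by simp
  have NR1: "nonres \<omega> \<theta>1 (b / 2 ^ B) B (K + 2 * nat \<bar>p\<bar>)" unfolding \<theta>1_def by (rule nonres_shift[OF NR])
  have S1: "sol g e (wcos \<omega> \<theta>1) \<psi>1"
    using sol_shift[OF S, of p] unfolding wcos_shift \<psi>1_def[abs_def] \<theta>1_def .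
  have P1: "\<bar>\<psi>1 m\<bar> \<le> (P * (1 + \<bar>of_int p\<bar>)) * (1 + \<bar>of_int m\<bar>)" for m
  proof -
    have "\<bar>\<psi>1 m\<bar> \<le> P * (1 + \<bar>of_int (m + p)\<bar>)" unfolding \<psi>1_def by (rule P)
    also have "\<dots> \<le> P * ((1 + \<bar>of_int p\<bar>) * (1 + \<bar>of_int m\<bar>))"
    proof (intro mult_left_mono P0)
      have "\<bar>of_int (m + p) :: real\<bar> \<le> \<bar>of_int m\<bar> + \<bar>of_int p\<bar>" by simp
      moreover have "0 \<le> \<bar>of_int p :: real\<bar> * \<bar>of_int m\<bar>" by simp
      ultimately show "1 + \<bar>of_int (m + p) :: real\<bar> \<le> (1 + \<bar>of_int p\<bar>) * (1 + \<bar>of_int m\<bar>)"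
        unfolding distrib_left distrib_right by linarith
    qed
    finally show ?thesis by (simp add: mult.assoc)
  qed
  have nz: "\<psi>1 0 \<noteq> 0" using p by (simp add: \<psi>1_def)
  obtain C1 r1 where 1: "r1 > 0" "\<And>y::nat. \<bar>\<psi>1 (int y)\<bar> \<le> C1 * exp (- r1 * real y)"
    using decay_right[OF D NR1 e S1 P1 nz] by blast
  have "(\<lambda>j. wcos \<omega> \<theta>1 (- j)) = wcos \<omega> (- \<theta>1)"
  proof
    fix j show "wcos \<omega> \<theta>1 (- j) = wcos \<omega> (- \<theta>1) j"
      unfolding wcos_def by (subst cos_minus[symmetric]) (simp add: algebra_simps)
  qed
  hence S2: "sol g e (wcos \<omega> (- \<theta>1)) (\<lambda>m. \<psi>1 (- m))" using sol_reverse[OF S1] by simp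
  have P2: "\<bar>\<psi>1 (- m)\<bar> \<le> (P * (1 + \<bar>of_int p\<bar>)) * (1 + \<bar>of_int m\<bar>)" for m using P1[of "- m"] by simp
  have nz2: "\<psi>1 (- 0) \<noteq> 0" using nz by simp
  obtain C2 r2 where 2: "r2 > 0" "\<And>y::nat. \<bar>\<psi>1 (- int y)\<bar> \<le> C2 * exp (- r2 * real y)"
    using decay_right[OF D nonres_minus[OF NR1] e S2 P2 nz2] by blast
  define r C where "r = min r1 r2" and "C = max C1 C2"
  have C0: "0 \<le> C1" "0 \<le> C2" using order.trans[OF abs_ge_zero 1(2)[of 0]] order.trans[OF abs_ge_zero 2(2)[of 0]] by auto
  have dec: "\<bar>\<psi>1 m\<bar> \<le> C * exp (- r * \<bar>of_int m\<bar>)" for m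
  proof (cases "m \<ge> 0")
    case True
    have "\<bar>\<psi>1 m\<bar> \<le> C1 * exp (- r1 * \<bar>of_int m\<bar>)" using 1(2)[of "nat m"] True by simp
    also have "\<dots> \<le> C * exp (- r * \<bar>of_int m\<bar>)"
      using C0 by (intro mult_mono) (auto simp: C_def r_def mult_right_mono)
    finally show ?thesis .
  next
    case False
    have "\<bar>\<psi>1 m\<bar> \<le> C2 * exp (- r2 * \<bar>of_int m\<bar>)" using 2(2)[of "nat (- m)"] False by simp
    also have "\<dots> \<le> C * exp (- r * \<bar>of_int m\<bar>)"
      using C0 by (intro mult_mono) (auto simp: C_def r_def mult_right_mono)
    finally show ?thesis .
  qed
  have r: "r > 0" using 1(1) 2(1) by (simp add: r_def)
  show ?thesis
  proof (rule that[OF r, of "C * exp (r * \<bar>of_int p\<bar>)"])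
    fix m
    have "\<bar>\<psi> m\<bar> \<le> C * exp (- r * \<bar>of_int (m - p)\<bar>)" using dec[of "m - p"] by (simp add: \<psi>1_def)
    also have "\<dots> \<le> C * exp (r * \<bar>of_int p\<bar> + - r * \<bar>of_int m\<bar>)"
    proof -
      have "\<bar>of_int m\<bar> - \<bar>of_int p\<bar> \<le> \<bar>of_int (m - p) :: real\<bar>" by simp
      hence "r * (\<bar>of_int m\<bar> - \<bar>of_int p\<bar>) \<le> r * \<bar>of_int (m - p)\<bar>" using r by (intro mult_left_mono) auto
      thus ?thesis using C0 by (intro mult_left_mono) (auto simp: C_def algebra_simps)
    qed
    finally show "\<bar>\<psi> m\<bar> \<le> C * exp (r * \<bar>of_int p\<bar>) * exp (- r * \<bar>of_int m\<bar>)"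
      by (simp only: exp_add mult.assoc)
  qed (use C0 in \<open>simp add: C_def\<close>)
qed

section \<open>Symmetric operators and their resolvent sets\<close>

text \<open>The Hellinger-Toeplitz theorem: symmetry alone yields linearity, closed sublevel sets of
  \<open>norm (R x)\<close>, and, by Baire category, boundedness.\<close>

lemma symmetric_imp_bounded:
  fixes R :: "'a::{real_inner, complete_space} \<Rightarrow> 'a"
  assumes sym: "\<And>x y. inner (R x) y = inner x (R y)"
  obtains B where "B > 0" "\<And>x. norm (R x) \<le> B * norm x"
proof -
  have eqI: "a = b" if "\<And>z. inner a z = inner b z" for a b :: 'a
    using that[of "a - b"] by (metis eq_iff_diff_eq_0 inner_diff_left inner_eq_zero_iff)
  have add: "R (x + y) = R x + R y" for x y
    by (rule eqI) (simp add: sym inner_add_left)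
  have scale: "R (c *\<^sub>R x) = c *\<^sub>R R x" for c x
    by (rule eqI) (simp add: sym)
  define A where "A k = {x. norm (R x) \<le> real k}" for k :: nat
  have closed: "closed (A k)" for k
    unfolding closed_sequential_limits
  proof (intro allI impI, elim conjE)
    fix X l assume X: "\<forall>n. X n \<in> A k" "X \<longlonglongrightarrow> l"
    \<comment> \<open>Continuity of \<open>R\<close> is not yet known; pairing with
      \<open>R l\<close> and moving \<open>R\<close> across replaces it.\<close>
    have "(\<lambda>n. inner (X n) (R (R l))) \<longlonglongrightarrow> inner l (R (R l))" by (intro tendsto_intros X)
    hence "(\<lambda>n. inner (R (X n)) (R l)) \<longlonglongrightarrow> inner (R l) (R l)" by (simp add: sym)
    moreover have "inner (R (X n)) (R l) \<le> k * norm (R l)" for n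
      using X(1) by (intro order.trans[OF norm_cauchy_schwarz] mult_right_mono) (auto simp: A_def)
    ultimately have "inner (R l) (R l) \<le> k * norm (R l)" by (intro LIMSEQ_le_const2) auto
    hence "norm (R l) * norm (R l) \<le> k * norm (R l)" by (simp add: power2_norm_eq_inner[symmetric] power2_eq_square)
    thus "l \<in> A k" by (cases "R l = 0") (auto simp: A_def)
  qed
  have "\<exists>k. interior (A k) \<noteq> {}"
  proof (rule ccontr)
    assume "\<not> ?thesis"
    hence "interior (\<Union> (range A)) = {}"
      using Met_TC.metric_Baire_category_alt[where ?'a = 'a, of "range A"] closed
      by (auto simp: complete_UNIV Met_TC.mcomplete_def Cauchy_convergent_iff convergent_def)
    moreover have "\<Union> (range A) = UNIV"
      using real_nat_ceiling_ge by (fastforce simp: A_def)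
    ultimately show False by simp
  qed
  then obtain k x0 r where r: "r > 0" "ball x0 r \<subseteq> A k"
    by (metis all_not_in_conv mem_interior)
  have small: "norm (R y) \<le> 2 * k" if "norm y < r" for y
  proof -
    have "x0 + y \<in> A k" "x0 \<in> A k" using r that by (auto simp: subset_iff dist_norm)
    moreover have "R y = R (x0 + y) - R x0" by (simp add: add)
    ultimately show ?thesis using norm_triangle_ineq4[of "R (x0 + y)" "R x0"] by (simp add: A_def)
  qed
  show ?thesis
  proof (rule that[of "4 * real k / r + 1"])
    show "0 < 4 * real k / r + 1" using r by (simp add: add_nonneg_pos)
    fix x
    show "norm (R x) \<le> (4 * real k / r + 1) * norm x"
    proof (cases "x = 0")
      case True
      thus ?thesis using scale[of 0 x] by simp
    next
      case False
      define c where "c = r / (2 * norm x)"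
      have c: "c > 0" using False r by (simp add: c_def)
      have "norm (R (c *\<^sub>R x)) \<le> 2 * k" using False r by (intro small) (simp add: c_def)
      hence "norm (R x) \<le> 2 * k / c" using c by (simp add: scale field_simps)
      also have "\<dots> = (4 * real k / r) * norm x" using False r by (simp add: c_def)
      also have "\<dots> \<le> (4 * real k / r + 1) * norm x" by (intro mult_right_mono) auto
      finally show ?thesis .
    qed
  qed
qed

text \<open>The inverse inherits symmetry and is therefore bounded by some \<open>B\<close>. For
  energies closer than \<open>1 / (2 * B)\<close> the equation becomes a fixed point problem for a
  contraction with constant 1/2.\<close>

lemma open_resolvent_set:
  fixes T :: "'a::{real_inner, complete_space} \<Rightarrow> 'a"
  assumes sym: "\<And>x y. inner (T x) y = inner x (T y)"
  shows "open {E. \<forall>f. \<exists>!g. T g - E *\<^sub>R g = f}"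
  unfolding open_dist
proof (intro ballI)
  fix E assume "E \<in> {E. \<forall>f. \<exists>!g. T g - E *\<^sub>R g = f}"
  hence ex: "\<exists>!g. T g - E *\<^sub>R g = f" for f by simp
  define R where "R f = (THE g. T g - E *\<^sub>R g = f)" for f
  have R1: "T (R f) - E *\<^sub>R R f = f" for f unfolding R_def by (rule theI'[OF ex])
  have R2: "R f = g" if "T g - E *\<^sub>R g = f" for f g using ex[of f] R1[of f] that by blast
  have symE: "inner (T x - E *\<^sub>R x) y = inner x (T y - E *\<^sub>R y)" for x y
    by (simp add: inner_diff_left inner_diff_right sym)
  have symR: "inner (R x) y = inner x (R y)" for x y
    using symE[of "R x" "R y"] by (simp add: R1)
  obtain B where B: "B > 0" "\<And>x. norm (R x) \<le> B * norm x"
    using symmetric_imp_bounded[OF symR] by blast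
  have eqI: "a = b" if "\<And>z. inner a z = inner b z" for a b :: 'a
    using that[of "a - b"] by (metis eq_iff_diff_eq_0 inner_diff_left inner_eq_zero_iff)
  have minus: "R (x - y) = R x - R y" for x y
    by (rule eqI) (simp add: symR inner_diff_left)
  show "\<exists>e>0. \<forall>E'. dist E' E < e \<longrightarrow> E' \<in> {E. \<forall>f. \<exists>!g. T g - E *\<^sub>R g = f}"
  proof (intro exI[of _ "1 / (2 * B)"] conjI allI impI)
    show "0 < 1 / (2 * B)" using B by simp
    fix E' assume d: "dist E' E < 1 / (2 * B)"
    have "\<exists>!g. T g - E' *\<^sub>R g = f" for f
    proof -
      have "\<exists>!g. R (f + (E' - E) *\<^sub>R g) = g"
      proof (rule banach_fix_type[of "1/2"])
        show "\<forall>x y. dist (R (f + (E' - E) *\<^sub>R x)) (R (f + (E' - E) *\<^sub>R y)) \<le> 1/2 * dist x y"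
        proof (intro allI)
          fix x y
          have "dist (R (f + (E' - E) *\<^sub>R x)) (R (f + (E' - E) *\<^sub>R y)) = norm (R ((E' - E) *\<^sub>R (x - y)))"
            unfolding dist_norm minus[symmetric] by (simp add: algebra_simps)
          also have "\<dots> \<le> B * (\<bar>E' - E\<bar> * norm (x - y))" using B(2)[of "(E' - E) *\<^sub>R (x - y)"] by simp
          also have "\<dots> = (B * \<bar>E' - E\<bar>) * norm (x - y)" by simp
          also have "\<dots> \<le> 1/2 * norm (x - y)"
            using d B(1) by (intro mult_right_mono) (auto simp: dist_norm field_simps)
          finally show "dist (R (f + (E' - E) *\<^sub>R x)) (R (f + (E' - E) *\<^sub>R y)) \<le> 1/2 * dist x y" by (simp add: dist_norm)
        qed
      qed auto
      moreover have "R (f + (E' - E) *\<^sub>R g) = g \<longleftrightarrow> T g - E' *\<^sub>R g = f" for g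
      proof
        assume "R (f + (E' - E) *\<^sub>R g) = g"
        hence "T g - E *\<^sub>R g = f + (E' - E) *\<^sub>R g" by (metis R1)
        thus "T g - E' *\<^sub>R g = f" by (simp add: algebra_simps)
      next
        assume "T g - E' *\<^sub>R g = f"
        thus "R (f + (E' - E) *\<^sub>R g) = g" by (intro R2) (simp add: algebra_simps)
      qed
      ultimately show ?thesis by simp
    qed
    thus "E' \<in> {E. \<forall>f. \<exists>!g. T g - E *\<^sub>R g = f}" by simp
  qed
qed

section \<open>The Hilbert space of square-summable sequences\<close>

lemma l2_bound:
  assumes "l2 u" "\<And>n. norm (v n) \<le> c * norm (u n)"
  shows "l2 v"
  unfolding l2_def
proof (rule summable_on_comparison_test)
  show "(\<lambda>n. c\<^sup>2 * (norm (u n))\<^sup>2) summable_on UNIV"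
    using assms(1) unfolding l2_def by (rule summable_on_cmult_right)
  fix n
  have "(norm (v n))\<^sup>2 \<le> (c * norm (u n))\<^sup>2" using assms(2) by (intro power_mono) auto
  thus "(norm (v n))\<^sup>2 \<le> c\<^sup>2 * (norm (u n))\<^sup>2" by (simp add: power_mult_distrib)
qed simp

lemma l2_add: assumes "l2 u" "l2 v" shows "l2 (\<lambda>n. u n + v n)"
  unfolding l2_def
proof (rule summable_on_comparison_test)
  show "(\<lambda>n. 2 * (norm (u n))\<^sup>2 + 2 * (norm (v n))\<^sup>2) summable_on UNIV"
    using assms unfolding l2_def by (intro summable_on_add summable_on_cmult_right)
  fix n
  have "(norm (u n + v n))\<^sup>2 \<le> (norm (u n) + norm (v n))\<^sup>2" by (intro power_mono norm_triangle_ineq) auto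
  also have "\<dots> \<le> 2 * (norm (u n))\<^sup>2 + 2 * (norm (v n))\<^sup>2" using sum_squares_bound[of "norm (u n)" "norm (v n)"] by (simp add: power2_sum)
  finally show "(norm (u n + v n))\<^sup>2 \<le> 2 * (norm (u n))\<^sup>2 + 2 * (norm (v n))\<^sup>2" .
qed simp

lemma l2_zero: "l2 (\<lambda>_. 0)"
  by (simp add: l2_def)

lemma l2_cmult: "l2 u \<Longrightarrow> l2 (\<lambda>n. c * u n)"
  by (rule l2_bound[where c = "norm c"]) (auto simp: norm_mult)

lemma l2_shift: assumes "l2 u" shows "l2 (\<lambda>n. u (n + k))"
proof -
  have "bij_betw (\<lambda>n::int. n + k) UNIV UNIV" by (rule bij_betw_byWitness[where f' = "\<lambda>n. n - k"]) auto
  from summable_on_reindex_bij_betw[OF this, of "\<lambda>n. (norm (u n))\<^sup>2"] show ?thesis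
    using assms by (simp add: l2_def)
qed

lemma l2_inner_summable: assumes "l2 u" "l2 v" shows "(\<lambda>n. inner (u n) (v n)) summable_on UNIV"
proof (rule abs_summable_summable, rule summable_on_comparison_test)
  show "(\<lambda>n. (norm (u n))\<^sup>2 + (norm (v n))\<^sup>2) summable_on UNIV"
    using assms unfolding l2_def by (intro summable_on_add)
  fix n
  have "\<bar>inner (u n) (v n)\<bar> \<le> norm (u n) * norm (v n)" by (rule Cauchy_Schwarz_ineq2)
  also have "\<dots> \<le> (norm (u n))\<^sup>2 + (norm (v n))\<^sup>2"
  proof -
    have "0 \<le> norm (u n) * norm (v n)" by simp
    thus ?thesis using sum_squares_bound[of "norm (u n)" "norm (v n)"] unfolding mult.assoc by linarith
  qed
  finally show "norm (inner (u n) (v n)) \<le> (norm (u n))\<^sup>2 + (norm (v n))\<^sup>2" by simp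
qed simp

text \<open>A type of its own gives access to the classes of inner product spaces and complete
  spaces. Real scalars suffice for the polynomials and minimising arguments below; complex ones
  enter through \<open>cmul\<close>.\<close>

typedef ell2 = "{u. l2 u}" morphisms coord mk_ell2
  using l2_zero by blast

lemma l2_coord [simp]: "l2 (coord u)"
  using coord[of u] by simp

lemma coord_mk [simp]: "l2 u \<Longrightarrow> coord (mk_ell2 u) = u"
  by (simp add: mk_ell2_inverse)

lemma ell2_eqI: "(\<And>n. coord u n = coord v n) \<Longrightarrow> u = v"
  by (metis coord_inject ext)

instantiation ell2 :: real_vector
begin
definition zero_ell2 where "0 = mk_ell2 (\<lambda>_. 0)"
definition plus_ell2 where "u + v = mk_ell2 (\<lambda>n. coord u n + coord v n)"
definition uminus_ell2 where "- u = mk_ell2 (\<lambda>n. - 1 * coord u n)"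
definition minus_ell2 where "u - v = mk_ell2 (\<lambda>n. coord u n + - 1 * coord v n)"
definition scaleR_ell2 where "c *\<^sub>R u = mk_ell2 (\<lambda>n. of_real c * coord u n)"

lemma coord_simps [simp]:
  "coord 0 n = 0" "coord (u + v) n = coord u n + coord v n" "coord (- u) n = - coord u n"
  "coord (u - v) n = coord u n - coord v n" "coord (c *\<^sub>R u) n = c *\<^sub>R coord u n"
  unfolding zero_ell2_def plus_ell2_def uminus_ell2_def minus_ell2_def scaleR_ell2_def
  by (simp_all only: coord_mk l2_zero l2_add l2_cmult l2_coord scaleR_conv_of_real) simp_all

instance
  by standard (auto intro!: ell2_eqI simp: algebra_simps)
end

instantiation ell2 :: real_inner
begin
definition inner_ell2 where "inner u v = infsum (\<lambda>n. inner (coord u n) (coord v n)) UNIV"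
definition norm_ell2 where "norm u = sqrt (inner u (u::ell2))"
definition dist_ell2 where "dist u v = norm (u - v :: ell2)"
definition sgn_ell2 where "sgn u = inverse (norm u) *\<^sub>R (u::ell2)"
definition uniformity_ell2 where "(uniformity :: (ell2 \<times> ell2) filter) = (INF e\<in>{0<..}. principal {(x, y). dist x y < e})"
definition open_ell2 where "open (U :: ell2 set) = (\<forall>x\<in>U. eventually (\<lambda>(x', y). x' = x \<longrightarrow> y \<in> U) uniformity)"

instance
proof
  fix u v w :: ell2 and r :: real
  show "inner u v = inner v u" unfolding inner_ell2_def by (simp add: inner_commute)
  show "inner (u + v) w = inner u w + inner v w"
    unfolding inner_ell2_def by (subst infsum_add[symmetric]) (auto simp: inner_add_left l2_inner_summable)
  show "inner (r *\<^sub>R u) v = r * inner u v"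
    unfolding inner_ell2_def by (subst infsum_cmult_right[symmetric]) (auto simp: l2_inner_summable)
  show "0 \<le> inner u u" unfolding inner_ell2_def by (intro infsum_nonneg) auto
  show "inner u u = 0 \<longleftrightarrow> u = 0"
  proof
    assume "inner u u = 0"
    hence "infsum (\<lambda>n. inner (coord u n) (coord u n)) UNIV \<le> 0" by (simp add: inner_ell2_def)
    hence "inner (coord u n) (coord u n) = 0" for n
      by (intro nonneg_infsum_le_0D[where A = UNIV and f = "\<lambda>n. inner (coord u n) (coord u n)"]) (auto simp: l2_inner_summable)
    thus "u = 0" by (intro ell2_eqI) simp
  qed (simp add: inner_ell2_def)
qed (auto simp: norm_ell2_def dist_ell2_def sgn_ell2_def uniformity_ell2_def open_ell2_def)
end

lemma sum_norm_coord_le: "finite F \<Longrightarrow> (\<Sum>n\<in>F. (norm (coord u n))\<^sup>2) \<le> (norm u)\<^sup>2"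
  unfolding power2_norm_eq_inner inner_ell2_def
  by (rule finite_sum_le_infsum) (auto simp: l2_inner_summable)

lemma norm_coord_le: "norm (coord u n) \<le> norm u"
  using sum_norm_coord_le[of "{n}" u] by (simp add: power2_le_iff_abs_le)

lemma norm_ell2_leI:
  assumes "c \<ge> 0" "\<And>F. finite F \<Longrightarrow> (\<Sum>n\<in>F. (norm (coord u n))\<^sup>2) \<le> c\<^sup>2"
  shows "norm u \<le> c"
proof -
  have "(norm u)\<^sup>2 \<le> c\<^sup>2"
    unfolding power2_norm_eq_inner inner_ell2_def
    by (rule infsum_le_finite_sums) (use assms in \<open>auto simp: l2_inner_summable power2_norm_eq_inner\<close>)
  thus ?thesis using assms(1) by (rule power2_le_imp_le)
qed

lemma l2_finite_sums:
  assumes "\<And>F. finite F \<Longrightarrow> (\<Sum>n\<in>F. (norm (u n))\<^sup>2) \<le> c"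
  shows "l2 u"
  unfolding l2_def
proof (rule nonneg_bdd_above_summable_on)
  show "bdd_above (sum (\<lambda>n. (norm (u n))\<^sup>2) ` {F. F \<subseteq> UNIV \<and> finite F})"
    by (rule bdd_aboveI2[where M = c]) (use assms in auto)
qed simp

instance ell2 :: complete_space
proof
  fix X :: "nat \<Rightarrow> ell2" assume X: "Cauchy X"
  have "Cauchy (\<lambda>i. coord (X i) n)" for n
  proof (rule CauchyI)
    fix e :: real assume "e > 0"
    then obtain M where M: "\<And>i j. i \<ge> M \<Longrightarrow> j \<ge> M \<Longrightarrow> norm (X i - X j) < e" using CauchyD[OF X] by blast
    have "norm (coord (X i) n - coord (X j) n) < e" if "i \<ge> M" "j \<ge> M" for i j
      using norm_coord_le[of "X i - X j" n] M[OF that] by simp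
    thus "\<exists>M. \<forall>m\<ge>M. \<forall>na\<ge>M. norm (coord (X m) n - coord (X na) n) < e" by blast
  qed
  hence "\<exists>l. (\<lambda>i. coord (X i) n) \<longlonglongrightarrow> l" for n by (simp add: Cauchy_convergent_iff convergent_def)
  then obtain g where g: "\<And>n. (\<lambda>i. coord (X i) n) \<longlonglongrightarrow> g n" by metis
  have key: "\<exists>M. \<forall>i\<ge>M. \<forall>F. finite F \<longrightarrow> (\<Sum>n\<in>F. (norm (coord (X i) n - g n))\<^sup>2) \<le> e\<^sup>2" if "e > 0" for e
  proof -
    obtain M where M: "\<And>i j. i \<ge> M \<Longrightarrow> j \<ge> M \<Longrightarrow> norm (X i - X j) < e" using CauchyD[OF X \<open>e > 0\<close>] by blast
    have "(\<Sum>n\<in>F. (norm (coord (X i) n - g n))\<^sup>2) \<le> e\<^sup>2" if "i \<ge> M" "finite F" for i F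
    proof (rule LIMSEQ_le_const2)
      show "(\<lambda>j. \<Sum>n\<in>F. (norm (coord (X i) n - coord (X j) n))\<^sup>2) \<longlonglongrightarrow> (\<Sum>n\<in>F. (norm (coord (X i) n - g n))\<^sup>2)"
        by (intro tendsto_intros g)
      have "(\<Sum>n\<in>F. (norm (coord (X i) n - coord (X j) n))\<^sup>2) \<le> e\<^sup>2" if "j \<ge> M" for j
      proof -
        have "(\<Sum>n\<in>F. (norm (coord (X i - X j) n))\<^sup>2) \<le> (norm (X i - X j))\<^sup>2" by (rule sum_norm_coord_le) fact
        also have "\<dots> \<le> e\<^sup>2" using M[OF \<open>i \<ge> M\<close> that] by (intro power_mono) auto
        finally show ?thesis by simp
      qed
      thus "\<exists>N. \<forall>j\<ge>N. (\<Sum>n\<in>F. (norm (coord (X i) n - coord (X j) n))\<^sup>2) \<le> e\<^sup>2" by blast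
    qed
    thus ?thesis by blast
  qed
  obtain M where M: "\<forall>i\<ge>M. \<forall>F. finite F \<longrightarrow> (\<Sum>n\<in>F. (norm (coord (X i) n - g n))\<^sup>2) \<le> 1\<^sup>2" using key[of 1] by auto
  have "l2 (\<lambda>n. coord (X M) n - g n)" by (rule l2_finite_sums[where c = "1\<^sup>2"]) (use M in auto)
  from l2_add[OF l2_coord[of "X M"] l2_cmult[OF this, of "- 1"]] have lg: "l2 g" by simp
  have "X \<longlonglongrightarrow> mk_ell2 g"
  proof (rule LIMSEQ_I)
    fix r :: real assume "r > 0"
    hence "r / 2 > 0" by simp
    from key[OF this] obtain N where N: "\<forall>i\<ge>N. \<forall>F. finite F \<longrightarrow> (\<Sum>n\<in>F. (norm (coord (X i) n - g n))\<^sup>2) \<le> (r/2)\<^sup>2" by blast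
    have "norm (X i - mk_ell2 g) < r" if "i \<ge> N" for i
    proof -
      have "norm (X i - mk_ell2 g) \<le> r / 2" by (rule norm_ell2_leI) (use \<open>r > 0\<close> N that lg in auto)
      thus ?thesis using \<open>r > 0\<close> by simp
    qed
    thus "\<exists>no. \<forall>n\<ge>no. norm (X n - mk_ell2 g) < r" by blast
  qed
  thus "convergent X" by (auto simp: convergent_def)
qed

definition cmul :: "complex \<Rightarrow> ell2 \<Rightarrow> ell2" where
  "cmul c u = mk_ell2 (\<lambda>n. c * coord u n)"

lemma coord_cmul [simp]: "coord (cmul c u) n = c * coord u n"
  by (simp add: cmul_def l2_cmult)

lemma norm_cmul: "norm (cmul c u) = norm c * norm u"
proof -
  have "(norm (cmul c u))\<^sup>2 = infsum (\<lambda>n. (norm c)\<^sup>2 * inner (coord u n) (coord u n)) UNIV"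
    unfolding power2_norm_eq_inner inner_ell2_def
    by (simp add: power2_norm_eq_inner[symmetric] norm_mult power_mult_distrib)
  also have "\<dots> = (norm c * norm u)\<^sup>2"
    unfolding power_mult_distrib power2_norm_eq_inner[of u] inner_ell2_def
    by (subst infsum_cmult_right) (auto simp: l2_inner_summable)
  finally show ?thesis by (rule power2_eq_imp_eq) auto
qed

lemma cmul_of_real: "cmul (of_real r) u = r *\<^sub>R u"
  by (rule ell2_eqI) (simp add: scaleR_conv_of_real)

lemma inner_cmul_ii_left: "inner (cmul \<i> u) v = - inner u (cmul \<i> v)"
  unfolding inner_ell2_def infsum_uminus[symmetric] by (rule infsum_cong) (simp add: inner_complex_def)

text \<open>For a form conjugate linear in its first argument, multiplying that argument by i turns
  the imaginary part into the real part; this recovers the complex form from the real one.\<close>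

definition cinner :: "ell2 \<Rightarrow> ell2 \<Rightarrow> complex" where
  "cinner u v = Complex (inner u v) (inner (cmul \<i> u) v)"

lemma cinner_infsum: "infsum (\<lambda>n. cnj (coord u n) * coord v n) UNIV = cinner u v"
proof -
  have 1: "((\<lambda>n. inner (coord u n) (coord v n)) has_sum inner u v) UNIV"
    unfolding inner_ell2_def by (rule has_sum_infsum, rule l2_inner_summable) (rule l2_coord)+
  have 2: "((\<lambda>n. inner (coord (cmul \<i> u) n) (coord v n)) has_sum inner (cmul \<i> u) v) UNIV"
    unfolding inner_ell2_def by (rule has_sum_infsum, rule l2_inner_summable) (rule l2_coord)+
  have 3: "((\<lambda>n. of_real (inner (coord u n) (coord v n)) + \<i> * of_real (inner (coord (cmul \<i> u) n) (coord v n)))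
      has_sum (of_real (inner u v) + \<i> * of_real (inner (cmul \<i> u) v))) UNIV"
    using 1 2 by (intro has_sum_add has_sum_cmult_right has_sum_of_real)
  have "of_real (inner (coord u n) (coord v n)) + \<i> * of_real (inner (coord (cmul \<i> u) n) (coord v n)) = cnj (coord u n) * coord v n" for n
    by (simp add: complex_eq_iff inner_complex_def)
  hence "infsum (\<lambda>n. cnj (coord u n) * coord v n) UNIV = of_real (inner u v) + \<i> * of_real (inner (cmul \<i> u) v)"
    using infsumI[OF 3] by simp
  thus ?thesis by (simp add: cinner_def complex_eq_iff)
qed

lemma cinner_add_right: "cinner u (v + w) = cinner u v + cinner u w"
  by (simp add: cinner_def inner_add_right complex_eq_iff)

lemma cinner_cmul_right: "cinner u (cmul z v) = z * cinner u v"
proof -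
  have z: "cmul z v = Re z *\<^sub>R v + Im z *\<^sub>R cmul \<i> v"
    by (rule ell2_eqI) (simp add: complex_eq_iff)
  have "cmul \<i> (cmul \<i> v) = - v" by (rule ell2_eqI) simp
  hence i: "inner (cmul \<i> u) (cmul \<i> v) = inner u v" using inner_cmul_ii_left[of u "cmul \<i> v"] by simp
  show ?thesis unfolding z cinner_def
    using i inner_cmul_ii_left[of u v] by (simp add: complex_eq_iff inner_add_right algebra_simps)
qed

lemma norm_cinner_le: "norm (cinner u v) \<le> 2 * (norm u * norm v)"
proof -
  have "norm (cinner u v) \<le> \<bar>inner u v\<bar> + \<bar>inner (cmul \<i> u) v\<bar>"
    unfolding cinner_def using cmod_le[of "Complex (inner u v) (inner (cmul \<i> u) v)"] by simp
  thus ?thesis using Cauchy_Schwarz_ineq2[of u v] Cauchy_Schwarz_ineq2[of "cmul \<i> u" v] by (simp add: norm_cmul)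
qed

section \<open>Spectral measures of bounded self-adjoint operators\<close>

definition delta :: "int \<Rightarrow> complex \<Rightarrow> ell2" where
  "delta n b = mk_ell2 (\<lambda>m. if m = n then b else 0)"

lemma coord_delta [simp]: "coord (delta n b) m = (if m = n then b else 0)"
proof -
  have "l2 (\<lambda>m. if m = n then b else 0)"
  proof (rule l2_finite_sums)
    fix F :: "int set" assume "finite F"
    have "(\<Sum>m\<in>F. (norm (if m = n then b else 0))\<^sup>2) = (\<Sum>m\<in>F. if m = n then (norm b)\<^sup>2 else 0)"
      by (intro sum.cong) auto
    also have "\<dots> \<le> (norm b)\<^sup>2" using \<open>finite F\<close> by (simp add: sum.delta)
    finally show "(\<Sum>m\<in>F. (norm (if m = n then b else 0))\<^sup>2) \<le> (norm b)\<^sup>2" .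
  qed
  thus ?thesis by (simp add: delta_def)
qed

lemma inner_delta_left: "inner (delta n b) w = inner b (coord w n)"
proof -
  have "inner (delta n b) w = infsum (\<lambda>m. inner b (coord w n)) {n}"
    unfolding inner_ell2_def by (intro infsum_cong_neutral) auto
  thus ?thesis by simp
qed

text \<open>\<open>Hf\<close> acts on bare sequences, the language of spectrum and spectral measure;
  \<open>H\<close> is the same operator on the Hilbert space.\<close>

locale selfadjoint_op =
  fixes Hf :: "(int \<Rightarrow> complex) \<Rightarrow> (int \<Rightarrow> complex)" and H :: "ell2 \<Rightarrow> ell2" and M :: real
  assumes coord_H: "coord (H u) = Hf (coord u)"
    and H_add: "H (u + v) = H u + H v"
    and H_cmul: "H (cmul z u) = cmul z (H u)"
    and H_sym: "inner (H u) v = inner u (H v)"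
    and H_bound: "norm (H u) \<le> M * norm u"
    and M_pos: "M > 0"
begin

lemma H_scaleR: "H (c *\<^sub>R u) = c *\<^sub>R H u"
  using H_cmul[of "of_real c" u] by (simp add: cmul_of_real)

lemma H_diff: "H (u - v) = H u - H v"
  using H_add[of "u - v" v] by (simp add: algebra_simps)

lemma spec_eq: "spec Hf = {E. \<not> (\<forall>f. \<exists>!g. H g - E *\<^sub>R g = f)}"
proof -
  have eq: "(\<forall>n. Hf (coord g) n - complex_of_real E * coord g n = coord f n) \<longleftrightarrow> H g - E *\<^sub>R g = f" for f g E
    by (auto simp: coord_H[symmetric] scaleR_conv_of_real intro!: ell2_eqI)
  have "(\<forall>f. l2 f \<longrightarrow> (\<exists>!g. l2 g \<and> (\<forall>n. Hf g n - complex_of_real E * g n = f n)))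
      \<longleftrightarrow> (\<forall>f. \<exists>!g. H g - E *\<^sub>R g = f)" (is "?L \<longleftrightarrow> ?R") for E
  proof
    assume L: ?L
    show ?R
    proof
      fix f
      from L obtain g where g: "l2 g" "\<forall>n. Hf g n - complex_of_real E * g n = coord f n"
        and u: "\<And>g'. l2 g' \<Longrightarrow> (\<forall>n. Hf g' n - complex_of_real E * g' n = coord f n) \<Longrightarrow> g' = g"
        by (metis l2_coord)
      show "\<exists>!g. H g - E *\<^sub>R g = f"
      proof (rule ex1I[of _ "mk_ell2 g"])
        show "H (mk_ell2 g) - E *\<^sub>R mk_ell2 g = f" using g by (simp add: eq[symmetric])
        fix g' assume "H g' - E *\<^sub>R g' = f"
        hence "coord g' = g" by (intro u) (auto simp: eq)
        thus "g' = mk_ell2 g" by (metis coord_inverse)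
      qed
    qed
  next
    assume R: ?R
    show ?L
    proof (intro allI impI)
      fix f assume f: "l2 f"
      from R obtain g where g: "H g - E *\<^sub>R g = mk_ell2 f" and u: "\<And>g'. H g' - E *\<^sub>R g' = mk_ell2 f \<Longrightarrow> g' = g"
        by metis
      show "\<exists>!g. l2 g \<and> (\<forall>n. Hf g n - complex_of_real E * g n = f n)"
      proof (rule ex1I[of _ "coord g"])
        show "l2 (coord g) \<and> (\<forall>n. Hf (coord g) n - complex_of_real E * coord g n = f n)"
          using g eq[of g E "mk_ell2 f"] f by simp
        fix g' assume g': "l2 g' \<and> (\<forall>n. Hf g' n - complex_of_real E * g' n = f n)"
        hence "H (mk_ell2 g') - E *\<^sub>R mk_ell2 g' = mk_ell2 f"
          using eq[of "mk_ell2 g'" E "mk_ell2 f"] f by simp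
        hence "mk_ell2 g' = g" by (rule u)
        thus "g' = coord g" using g' by auto
      qed
    qed
  qed
  thus ?thesis unfolding spec_def by simp
qed

lemma closed_spec: "closed (spec Hf)"
proof -
  have "spec Hf = - {E. \<forall>f. \<exists>!g. H g - E *\<^sub>R g = f}" unfolding spec_eq by auto
  thus ?thesis using open_resolvent_set[of H] H_sym by (simp add: closed_def)
qed

lemma eigenvectors_orthogonal:
  assumes "H g = E *\<^sub>R g" "H g' = E' *\<^sub>R g'" "E \<noteq> E'"
  shows "inner g g' = 0"
proof -
  have "E * inner g g' = E' * inner g g'" using H_sym[of g g'] assms by simp
  thus ?thesis using assms(3) by simp
qed

text \<open>By orthogonality and Bessel's inequality only finitely many unit eigenvectors have an
  inner product of size at least \<open>1 / k\<close> with a given vector, and each one is detected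
  by some unit vector. Both values of \<open>b\<close> are needed since the inner product is
  real.\<close>

lemma countable_eigenvalues: "countable {E. \<exists>g. g \<noteq> 0 \<and> H g = E *\<^sub>R g}" (is "countable ?S")
proof -
  have "\<forall>E\<in>?S. \<exists>g. norm g = 1 \<and> H g = E *\<^sub>R g"
  proof
    fix E assume "E \<in> ?S"
    then obtain g where "g \<noteq> 0" "H g = E *\<^sub>R g" by blast
    thus "\<exists>g. norm g = 1 \<and> H g = E *\<^sub>R g"
      by (intro exI[of _ "(1 / norm g) *\<^sub>R g"]) (simp add: H_scaleR)
  qed
  then obtain G where G: "\<And>E. E \<in> ?S \<Longrightarrow> norm (G E) = 1 \<and> H (G E) = E *\<^sub>R G E" by metis
  have bessel: "card F \<le> (real k)\<^sup>2 * (norm w)\<^sup>2"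
    if F: "finite F" "F \<subseteq> {E\<in>?S. \<bar>inner w (G E)\<bar> \<ge> 1 / real k}" and k: "k > 0" for F w k
  proof -
    let ?p = "\<Sum>E\<in>F. inner w (G E) *\<^sub>R G E"
    have orth: "inner (G E) (G E') = (if E = E' then 1 else 0)" if "E \<in> F" "E' \<in> F" for E E'
    proof -
      have "norm (G E) = 1 \<and> H (G E) = E *\<^sub>R G E" "norm (G E') = 1 \<and> H (G E') = E' *\<^sub>R G E'"
        using that F G by auto
      thus ?thesis using eigenvectors_orthogonal[of "G E" E "G E'" E'] by (auto simp: norm_eq_1)
    qed
    have pw: "inner ?p w = (\<Sum>E\<in>F. (inner w (G E))\<^sup>2)"
      by (simp add: inner_commute[of _ w] inner_sum_right power2_eq_square)
    have "inner ?p ?p = (\<Sum>E\<in>F. \<Sum>E'\<in>F. inner w (G E) * (inner w (G E') * inner (G E') (G E)))"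
      by (simp add: inner_sum_left inner_sum_right sum_distrib_left)
    also have "\<dots> = (\<Sum>E\<in>F. \<Sum>E'\<in>F. if E = E' then (inner w (G E))\<^sup>2 else 0)"
      by (intro sum.cong refl) (auto simp: orth power2_eq_square)
    also have "\<dots> = (\<Sum>E\<in>F. (inner w (G E))\<^sup>2)" using F by simp
    finally have pp: "inner ?p ?p = (\<Sum>E\<in>F. (inner w (G E))\<^sup>2)" .
    have "0 \<le> inner (w - ?p) (w - ?p)" by simp
    also have "\<dots> = (norm w)\<^sup>2 - (\<Sum>E\<in>F. (inner w (G E))\<^sup>2)"
      by (simp add: inner_diff_left inner_diff_right pp pw inner_commute[of w ?p] power2_norm_eq_inner)
    finally have "(\<Sum>E\<in>F. (inner w (G E))\<^sup>2) \<le> (norm w)\<^sup>2" by simp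
    moreover have "(\<Sum>E\<in>F. (1 / real k)\<^sup>2) \<le> (\<Sum>E\<in>F. (inner w (G E))\<^sup>2)"
    proof (rule sum_mono)
      fix E assume "E \<in> F"
      hence "1 / real k \<le> \<bar>inner w (G E)\<bar>" using F by auto
      thus "(1 / real k)\<^sup>2 \<le> (inner w (G E))\<^sup>2" using power_mono[of "1 / real k" "\<bar>inner w (G E)\<bar>" 2] by simp
    qed
    ultimately have "card F * (1 / real k)\<^sup>2 \<le> (norm w)\<^sup>2" by simp
    thus ?thesis using k by (simp add: field_simps power2_eq_square)
  qed
  have fin: "finite {E\<in>?S. \<bar>inner w (G E)\<bar> \<ge> 1 / real k}" if "k > 0" for w k
  proof (rule ccontr)
    assume inf: "infinite {E\<in>?S. \<bar>inner w (G E)\<bar> \<ge> 1 / real k}"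
    obtain m :: nat where m: "(real k)\<^sup>2 * (norm w)\<^sup>2 < m" using reals_Archimedean2 by blast
    obtain F where F: "F \<subseteq> {E\<in>?S. \<bar>inner w (G E)\<bar> \<ge> 1 / real k}" "finite F" "card F = m"
      using infinite_arbitrarily_large[OF inf] by blast
    from bessel[OF F(2,1) that] m F(3) show False by linarith
  qed
  have "?S \<subseteq> (\<Union>n. \<Union>b\<in>{1, \<i>}. \<Union>k. {E\<in>?S. \<bar>inner (delta n b) (G E)\<bar> \<ge> 1 / real (Suc k)})"
  proof
    fix E assume E: "E \<in> ?S"
    have "G E \<noteq> 0" using G[OF E] by auto
    then obtain n where n: "coord (G E) n \<noteq> 0" using ell2_eqI[of "G E" 0] by auto
    hence "inner (delta n 1) (G E) \<noteq> 0 \<or> inner (delta n \<i>) (G E) \<noteq> 0"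
      by (simp add: inner_delta_left inner_complex_def complex_eq_iff)
    then obtain b where b: "b \<in> {1, \<i>}" "inner (delta n b) (G E) \<noteq> 0" by blast
    obtain k where "inverse (real (Suc k)) < \<bar>inner (delta n b) (G E)\<bar>" using reals_Archimedean[of "\<bar>inner (delta n b) (G E)\<bar>"] b by auto
    hence "E \<in> {E\<in>?S. \<bar>inner (delta n b) (G E)\<bar> \<ge> 1 / real (Suc k)}" using E by (simp add: inverse_eq_divide)
    thus "E \<in> (\<Union>n. \<Union>b\<in>{1, \<i>}. \<Union>k. {E\<in>?S. \<bar>inner (delta n b) (G E)\<bar> \<ge> 1 / real (Suc k)})" using b by blast
  qed
  moreover have "countable (\<Union>n. \<Union>b\<in>{1, \<i>}. \<Union>k. {E\<in>?S. \<bar>inner (delta n b) (G E)\<bar> \<ge> 1 / real (Suc k)})"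
    by (rule countable_UN, simp, rule countable_UN, simp, rule countable_UN, simp, rule countable_finite, rule fin, simp)
  ultimately show ?thesis by (rule countable_subset)
qed

text \<open>The map taking \<open>v\<close> to \<open>(H v - u) / z\<close> contracts by
  \<open>M / norm z\<close>, and its fixed point is the solution.\<close>

lemma resolvent_large:
  assumes z: "norm z > M"
  obtains v where "H v - cmul z v = u" "norm v \<le> norm u / (norm z - M)"
proof -
  have z0: "z \<noteq> 0" using z M_pos by auto
  define c where "c = M / norm z"
  have "norm z > 0" using z0 by simp
  hence c: "0 \<le> c" "c < 1" using z M_pos by (auto simp: c_def divide_less_eq_1)
  have lin: "cmul (1/z) a - cmul (1/z) b = cmul (1/z) (a - b)" for a b
    by (rule ell2_eqI) (simp add: algebra_simps)
  have "\<exists>!v. cmul (1/z) (H v - u) = v"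
  proof (rule banach_fix_type[OF c], intro allI)
    fix x y
    have "dist (cmul (1/z) (H x - u)) (cmul (1/z) (H y - u)) = norm (cmul (1/z) (H (x - y)))"
      unfolding dist_norm lin by (simp add: H_diff)
    also have "\<dots> \<le> (1 / norm z) * (M * norm (x - y))"
      unfolding norm_cmul by (simp add: norm_divide divide_right_mono H_bound)
    finally show "dist (cmul (1/z) (H x - u)) (cmul (1/z) (H y - u)) \<le> c * dist x y"
      by (simp add: c_def dist_norm)
  qed
  then obtain v where v: "cmul (1/z) (H v - u) = v" by blast
  have eq: "H v - cmul z v = u"
  proof -
    have "cmul z v = H v - u" using z0 by (subst v[symmetric]) (rule ell2_eqI, simp)
    thus ?thesis by simp
  qed
  have "cmul z v = H v - u" unfolding eq[symmetric] by simp
  hence "norm z * norm v = norm (H v - u)" using norm_cmul[of z v] by simp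
  also have "\<dots> \<le> M * norm v + norm u" using H_bound[of v] norm_triangle_ineq4[of "H v" u] by linarith
  finally have "(norm z - M) * norm v \<le> norm u" by (simp add: algebra_simps)
  hence "norm v \<le> norm u / (norm z - M)" using z by (simp add: field_simps)
  thus ?thesis using that eq by blast
qed

text \<open>Symmetry makes the quadratic form of \<open>H\<close> real, so only the term with
  \<open>- cnj z\<close> has an imaginary part.\<close>

lemma Im_cinner_resolvent:
  assumes "H v - cmul z v = u"
  shows "Im (cinner u v) = Im z * (norm v)\<^sup>2"
proof -
  have ii: "inner (cmul \<i> v) v = 0" for v
    using inner_cmul_ii_left[of v v] by (simp add: inner_commute)
  have "cmul \<i> u = H (cmul \<i> v) + (Im z *\<^sub>R v - Re z *\<^sub>R cmul \<i> v)"
    unfolding assms[symmetric] H_cmul by (rule ell2_eqI) (simp add: complex_eq_iff algebra_simps)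
  moreover have "inner (H (cmul \<i> v)) v = 0"
    using inner_cmul_ii_left[of "H v" v] H_sym[of "v" "cmul \<i> v"] by (simp add: H_cmul inner_commute)
  ultimately show ?thesis
    by (simp add: cinner_def inner_add_left inner_diff_left ii power2_norm_eq_inner)
qed

end

section \<open>Support and moments of a spectral measure\<close>

locale spectral_measure = selfadjoint_op +
  fixes u :: ell2 and \<mu> :: "real measure"
  assumes spectral: "is_spectral_measure Hf (coord u) \<mu>"
begin

lemma finite_mu: "finite_measure \<mu>" and sets_mu [measurable_cong]: "sets \<mu> = sets borel"
  using spectral by (auto simp: is_spectral_measure_def)

lemma space_mu [simp]: "space \<mu> = UNIV"
  using sets_eq_imp_space_eq[OF sets_mu] by simp

lemma stieltjes:
  assumes "Im z \<noteq> 0" "H v - cmul z v = u"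
  shows "cinner u v = (LINT x|\<mu>. 1 / (complex_of_real x - z))"
proof -
  have "\<forall>n. Hf (coord v) n - z * coord v n = coord u n" using assms(2) by (auto simp: coord_H[symmetric])
  thus ?thesis using spectral assms(1) l2_coord[of v] unfolding is_spectral_measure_def cinner_infsum[symmetric] by blast
qed

lemma integrable_resolvent:
  assumes "Im z \<noteq> 0"
  shows "integrable \<mu> (\<lambda>x. 1 / (complex_of_real x - z))"
proof -
  interpret finite_measure \<mu> by (rule finite_mu)
  show ?thesis
  proof (rule integrable_const_bound[where B = "1 / \<bar>Im z\<bar>"])
    show "AE x in \<mu>. norm (1 / (complex_of_real x - z)) \<le> 1 / \<bar>Im z\<bar>"
    proof (rule AE_I2)
      fix x
      have "\<bar>Im z\<bar> \<le> norm (complex_of_real x - z)" using abs_Im_le_cmod[of "complex_of_real x - z"] by simp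
      thus "norm (1 / (complex_of_real x - z)) \<le> 1 / \<bar>Im z\<bar>" using assms by (simp add: norm_divide frac_le)
    qed
  qed measurable
qed

text \<open>On the interval the Poisson kernel is at least \<open>1 / (2 * \<epsilon>)\<close>, and
  its integral is \<open>\<epsilon> * (norm v)\<^sup>2\<close> with
  \<open>norm v \<le> norm u\<close>. The quadratic rate is the point: covering a unit interval
  takes about \<open>1 / \<epsilon>\<close> such intervals, so their total mass tends to 0.\<close>

lemma measure_cball_le:
  assumes E: "M + 1 \<le> \<bar>E\<bar>" and e: "\<epsilon> > 0"
  shows "measure \<mu> {E - \<epsilon>..E + \<epsilon>} \<le> 2 * \<epsilon>\<^sup>2 * (norm u)\<^sup>2"
proof -
  interpret finite_measure \<mu> by (rule finite_mu)
  define z where "z = Complex E \<epsilon>"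
  have nz: "norm z \<ge> M + 1" using E abs_Re_le_cmod[of z] by (simp add: z_def)
  then obtain v where v: "H v - cmul z v = u" "norm v \<le> norm u / (norm z - M)"
    using resolvent_large[of z u] by auto
  have "norm u / (norm z - M) \<le> norm u / 1" using nz by (intro divide_left_mono) auto
  hence nv: "norm v \<le> norm u" using v(2) by simp
  have iz: "Im z \<noteq> 0" using e by (simp add: z_def)
  have int: "integrable \<mu> (\<lambda>x. Im (1 / (complex_of_real x - z)))"
    by (rule integrable_Im[OF integrable_resolvent[OF iz]])
  have "(1 / (2 * \<epsilon>)) * measure \<mu> {E - \<epsilon>..E + \<epsilon>} = (LINT x|\<mu>. (1 / (2 * \<epsilon>)) * indicator {E - \<epsilon>..E + \<epsilon>} x)"
    by simp
  also have "\<dots> \<le> (LINT x|\<mu>. Im (1 / (complex_of_real x - z)))"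
  proof (rule integral_mono[OF _ int])
    fix x
    have im: "Im (1 / (complex_of_real x - z)) = \<epsilon> / ((x - E)\<^sup>2 + \<epsilon>\<^sup>2)"
      by (simp add: z_def Im_divide)
    show "(1 / (2 * \<epsilon>)) * indicator {E - \<epsilon>..E + \<epsilon>} x \<le> Im (1 / (complex_of_real x - z))"
    proof (cases "x \<in> {E - \<epsilon>..E + \<epsilon>}")
      case True
      hence "\<bar>x - E\<bar> \<le> \<epsilon>" by auto
      hence "(x - E)\<^sup>2 \<le> \<epsilon>\<^sup>2" using e by (simp add: abs_le_square_iff[symmetric])
      hence "\<epsilon> / (2 * \<epsilon>\<^sup>2) \<le> \<epsilon> / ((x - E)\<^sup>2 + \<epsilon>\<^sup>2)"
        using e by (intro divide_left_mono mult_pos_pos add_nonneg_pos) auto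
      thus ?thesis using True e by (simp add: im power2_eq_square)
    next
      case False
      thus ?thesis using e by (simp add: im)
    qed
  next
    show "integrable \<mu> (\<lambda>x. (1 / (2 * \<epsilon>)) * indicator {E - \<epsilon>..E + \<epsilon>} x)"
      by (intro integrable_mult_right integrable_real_indicator) (auto simp: sets_mu emeasure_eq_measure)
  qed
  also have "\<dots> = Im (LINT x|\<mu>. 1 / (complex_of_real x - z))" by (rule integral_Im[OF integrable_resolvent[OF iz]])
  also have "\<dots> = \<epsilon> * (norm v)\<^sup>2"
    using stieltjes[OF iz v(1)] Im_cinner_resolvent[OF v(1)] by (simp add: z_def)
  also have "\<dots> \<le> \<epsilon> * (norm u)\<^sup>2" using nv e by (intro mult_left_mono power_mono) auto
  finally show ?thesis using e by (simp add: field_simps power2_eq_square)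
qed

lemma measure_unit_interval_0:
  assumes a: "M + 1 \<le> a \<or> a + 1 \<le> - (M + 1)"
  shows "measure \<mu> {a..a + 1} = 0"
proof -
  interpret finite_measure \<mu> by (rule finite_mu)
  have bd: "measure \<mu> {a..a + 1} \<le> (norm u)\<^sup>2 / 2 * inverse (real (Suc k))" for k
  proof -
    let ?n = "Suc k"
    define e where "e = 1 / (2 * real ?n)"
    define C where "C i = a + (2 * real i + 1) * e" for i :: nat
    have e: "e > 0" "2 * real ?n * e = 1" by (simp_all add: e_def)
    have cov: "{a..a + 1} \<subseteq> (\<Union>i<?n. {C i - e..C i + e})"
    proof
      fix x assume x: "x \<in> {a..a + 1}"
      show "x \<in> (\<Union>i<?n. {C i - e..C i + e})"
      proof (cases "x = a + 1")
        \<comment> \<open>The right endpoint is separate because the floor used below would give the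
          index \<open>?n\<close>, one past the last interval.\<close>
        case True
        have "C k + e = a + 1" using e(2) by (simp add: C_def algebra_simps)
        hence "x \<in> {C k - e..C k + e}" using True e by simp
        thus ?thesis by blast
      next
        case False
        define i where "i = nat \<lfloor>(x - a) / (2 * e)\<rfloor>"
        have y0: "0 \<le> (x - a) / (2 * e)" using x e by simp
        have i1: "real i \<le> (x - a) / (2 * e)" "(x - a) / (2 * e) < real i + 1" unfolding i_def using y0 by linarith+
        have "(x - a) / (2 * e) = (x - a) * real ?n" by (simp add: e_def)
        also have "\<dots> < 1 * real ?n" using x False by (intro mult_strict_right_mono) auto
        finally have "(x - a) / (2 * e) < real ?n" by simp
        hence "i < ?n" using i1 by linarith
        moreover have "x \<in> {C i - e..C i + e}" using i1 e(1) by (simp add: C_def field_simps)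
        ultimately show ?thesis by blast
      qed
    qed
    have "measure \<mu> {a..a + 1} \<le> measure \<mu> (\<Union>i<?n. {C i - e..C i + e})"
      using cov by (intro finite_measure_mono) (auto simp: sets_mu)
    also have "\<dots> \<le> (\<Sum>i<?n. measure \<mu> {C i - e..C i + e})"
      by (intro finite_measure_subadditive_finite) (auto simp: sets_mu)
    also have "\<dots> \<le> (\<Sum>i<?n. 2 * e\<^sup>2 * (norm u)\<^sup>2)"
    proof (intro sum_mono measure_cball_le e(1))
      fix i assume "i \<in> {..<?n}"
      hence "real i + 1 \<le> real ?n" by simp
      hence "(2 * real i + 1) * e \<le> 2 * real ?n * e" using e(1) by (intro mult_right_mono) auto
      hence "(2 * real i + 1) * e \<le> 1" unfolding e(2) .
      moreover have "0 \<le> (2 * real i + 1) * e" using e(1) by simp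
      ultimately have "a \<le> C i" "C i \<le> a + 1" unfolding C_def by linarith+
      thus "M + 1 \<le> \<bar>C i\<bar>" using a by linarith
    qed
    also have "\<dots> = (2 * real ?n * e) * (e * (norm u)\<^sup>2)" by (simp add: power2_eq_square)
    also have "\<dots> = (norm u)\<^sup>2 / 2 * inverse (real ?n)" unfolding e(2) by (simp add: e_def inverse_eq_divide)
    finally show ?thesis .
  qed
  have "(\<lambda>k. (norm u)\<^sup>2 / 2 * inverse (real (Suc k))) \<longlonglongrightarrow> (norm u)\<^sup>2 / 2 * 0"
    by (intro tendsto_intros LIMSEQ_inverse_real_of_nat)
  hence "measure \<mu> {a..a + 1} \<le> (norm u)\<^sup>2 / 2 * 0" by (rule LIMSEQ_le_const) (use bd in auto)
  thus ?thesis by (simp add: measure_le_0_iff)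
qed

lemma AE_bounded: "AE x in \<mu>. \<bar>x\<bar> \<le> M + 1"
proof -
  interpret finite_measure \<mu> by (rule finite_mu)
  have null: "{a..a + 1} \<in> null_sets \<mu>" if "M + 1 \<le> a \<or> a + 1 \<le> - (M + 1)" for a
    using measure_unit_interval_0[OF that] by (auto simp: null_sets_def sets_mu emeasure_eq_measure)
  have "(\<Union>k::nat. {M + 1 + k..M + 1 + k + 1}) \<union> (\<Union>k::nat. {- (M + 1) - k - 1..- (M + 1) - k - 1 + 1}) \<in> null_sets \<mu>"
    by (intro null_sets.Un null_sets_UN null) auto
  moreover have "{x\<in>space \<mu>. \<not> \<bar>x\<bar> \<le> M + 1} \<subseteq> (\<Union>k::nat. {M + 1 + k..M + 1 + k + 1}) \<union> (\<Union>k::nat. {- (M + 1) - k - 1..- (M + 1) - k - 1 + 1})"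
  proof
    fix x assume "x \<in> {x\<in>space \<mu>. \<not> \<bar>x\<bar> \<le> M + 1}"
    hence x: "\<bar>x\<bar> > M + 1" by simp
    define k where "k = nat \<lfloor>\<bar>x\<bar> - (M + 1)\<rfloor>"
    have k: "real k \<le> \<bar>x\<bar> - (M + 1)" "\<bar>x\<bar> - (M + 1) < real k + 1" unfolding k_def using x by linarith+
    show "x \<in> (\<Union>k::nat. {M + 1 + k..M + 1 + k + 1}) \<union> (\<Union>k::nat. {- (M + 1) - k - 1..- (M + 1) - k - 1 + 1})"
    proof (cases "x \<ge> 0")
      case True
      hence "x \<in> {M + 1 + k..M + 1 + k + 1}" using k by auto
      thus ?thesis by blast
    next
      case False
      hence "x \<in> {- (M + 1) - k - 1..- (M + 1) - k - 1 + 1}" using k by auto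
      thus ?thesis by blast
    qed
  qed
  ultimately show ?thesis by (rule AE_I')
qed

lemma integrable_bounded_on_support:
  fixes f :: "real \<Rightarrow> 'b::{banach, second_countable_topology}"
  assumes "f \<in> borel_measurable borel" "\<And>x. \<bar>x\<bar> \<le> M + 1 \<Longrightarrow> norm (f x) \<le> B"
  shows "integrable \<mu> f"
proof -
  interpret finite_measure \<mu> by (rule finite_mu)
  show ?thesis
    by (rule integrable_const_bound[where B = B])
       (use assms AE_bounded in \<open>auto simp: measurable_cong_sets[OF sets_mu refl] elim: eventually_mono\<close>)
qed

text \<open>With \<open>v\<close> the solution of \<open>H v - z v = u\<close>, the quantities \<open>\<langle>u, H\<^sup>n v\<rangle>\<close> and \<open>\<integral>x\<^sup>n / (x - z)\<close> satisfy the
  same recursion in \<open>n\<close> up to the moments, and both tend to \<open>0\<close> as \<open>z \<rightarrow> \<i>\<infinity>\<close>.\<close>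

lemma moment: "(LINT x|\<mu>. x ^ n) = inner u ((H ^^ n) u)"
proof -
  interpret finite_measure \<mu> by (rule finite_mu)
  define R where "R = M + 1"
  have R: "R > 0" using M_pos by (simp add: R_def)
  have ipow: "integrable \<mu> (\<lambda>x. x ^ n)" for n
    by (rule integrable_bounded_on_support[where B = "R ^ n"]) (auto simp: power_abs R_def intro: power_mono)
  \<comment> \<open>Points on the imaginary axis with modulus above \<open>M\<close>, so that
    \<open>resolvent_large\<close> applies and its bound tends to 0.\<close>
  define y where "y k = M + 1 + real k" for k :: nat
  define z where "z k = Complex 0 (y k)" for k
  have yp: "y k > M" "y k > 0" for k using M_pos by (auto simp: y_def)
  have nz: "norm (z k) = y k" for k using yp[of k] by (simp add: z_def cmod_def)
  have "\<forall>k. \<exists>v. H v - cmul (z k) v = u \<and> norm v \<le> norm u / (y k - M)"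
    using resolvent_large[of "z _" u] yp nz by metis
  then obtain v where v: "\<And>k. H (v k) - cmul (z k) (v k) = u" "\<And>k. norm (v k) \<le> norm u / (y k - M)" by metis
  have Hn_bound: "norm ((H ^^ n) w) \<le> M ^ n * norm w" for n w
  proof (induction n)
    case (Suc n)
    have "norm ((H ^^ Suc n) w) \<le> M * norm ((H ^^ n) w)" by (simp add: H_bound)
    also have "\<dots> \<le> M * (M ^ n * norm w)" using Suc M_pos by (intro mult_left_mono) auto
    finally show ?case by (simp add: mult.assoc)
  qed simp
  have Hn_diff: "(H ^^ n) (a - b) = (H ^^ n) a - (H ^^ n) b" for n a b
    by (induction n) (simp_all add: H_diff)
  have Hn_cmul: "(H ^^ n) (cmul c a) = cmul c ((H ^^ n) a)" for n c a
    by (induction n) (simp_all add: H_cmul)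
  define a where "a n k = cinner u ((H ^^ n) (v k))" for n k
  define b where "b n k = (LINT x|\<mu>. of_real (x ^ n) / (of_real x - z k))" for n k
  have iz: "Im (z k) \<noteq> 0" for k using yp[of k] by (simp add: z_def)
  have low: "y k \<le> norm (of_real x - z k)" for k x
    using abs_Im_le_cmod[of "of_real x - z k"] yp[of k] by (simp add: z_def)
  have xz: "of_real x - z k \<noteq> 0" for x k using low[of k x] yp(2)[of k] by auto
  have ib: "integrable \<mu> (\<lambda>x. of_real (x ^ n) / (of_real x - z k))" for n k
  proof (rule integrable_bounded_on_support[where B = "R ^ n / y k"])
    fix x :: real assume "\<bar>x\<bar> \<le> M + 1"
    thus "norm (of_real (x ^ n) / (of_real x - z k)) \<le> R ^ n / y k"
      unfolding norm_divide using low[of k x] yp(2)[of k]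
      by (intro frac_le) (auto simp: norm_power R_def intro: power_mono)
  qed measurable
  have a_Suc: "a (Suc n) k = cinner u ((H ^^ n) u) + z k * a n k" for n k
  proof -
    have "(H ^^ Suc n) (v k) = (H ^^ n) u + cmul (z k) ((H ^^ n) (v k))"
      unfolding funpow_Suc_right o_apply v(1)[of k, symmetric] Hn_diff Hn_cmul by simp
    thus ?thesis by (simp add: a_def cinner_add_right cinner_cmul_right)
  qed
  have b_Suc: "b (Suc n) k = of_real (LINT x|\<mu>. x ^ n) + z k * b n k" for n k
  proof -
    have "of_real (x ^ Suc n) / (of_real x - z k) = of_real (x ^ n) + z k * (of_real (x ^ n) / (of_real x - z k))" for x :: real
      using xz[of x k] by (simp add: field_simps)
    hence "b (Suc n) k = (LINT x|\<mu>. complex_of_real (x ^ n) + z k * (of_real (x ^ n) / (of_real x - z k)))"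
      unfolding b_def by simp
    also have "\<dots> = (LINT x|\<mu>. complex_of_real (x ^ n)) + (LINT x|\<mu>. z k * (of_real (x ^ n) / (of_real x - z k)))"
      by (intro Bochner_Integration.integral_add integrable_mult_right integrable_of_real ipow ib)
    finally show ?thesis by (simp only: b_def integral_mult_right_zero integral_complex_of_real)
  qed
  have inv: "(\<lambda>k. 1 / (real k + 1)) \<longlonglongrightarrow> 0"
    using LIMSEQ_inverse_real_of_nat by (simp add: inverse_eq_divide add.commute)
  have a_lim: "a n \<longlonglongrightarrow> 0" for n
  proof (rule Lim_null_comparison)
    show "(\<lambda>k. 2 * (norm u * (M ^ n * norm u)) * (1 / (real k + 1))) \<longlonglongrightarrow> 0"
      using tendsto_mult_right_zero[OF inv] by simp
    have "norm (a n k) \<le> 2 * (norm u * (M ^ n * norm u)) * (1 / (real k + 1))" for k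
    proof -
      have "norm (a n k) \<le> 2 * (norm u * (M ^ n * norm (v k)))"
        unfolding a_def using Hn_bound[of n "v k"]
        by (intro order.trans[OF norm_cinner_le] mult_left_mono) auto
      also have "\<dots> \<le> 2 * (norm u * (M ^ n * (norm u / (real k + 1))))"
        using v(2)[of k] M_pos by (intro mult_left_mono) (auto simp: y_def add.commute)
      finally show ?thesis by simp
    qed
    thus "eventually (\<lambda>k. norm (a n k) \<le> 2 * (norm u * (M ^ n * norm u)) * (1 / (real k + 1))) sequentially" by simp
  qed
  have b_lim: "b n \<longlonglongrightarrow> 0" for n
  proof (rule Lim_null_comparison)
    show "(\<lambda>k. R ^ n * measure \<mu> UNIV * (1 / (real k + 1))) \<longlonglongrightarrow> 0"
      using tendsto_mult_right_zero[OF inv] by simp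
    have "norm (b n k) \<le> R ^ n * measure \<mu> UNIV * (1 / (real k + 1))" for k
    proof -
      have "norm (b n k) \<le> (LINT x|\<mu>. norm (of_real (x ^ n) / (of_real x - z k)))"
        unfolding b_def by (rule integral_norm_bound)
      also have "\<dots> \<le> (LINT x|\<mu>. R ^ n / (real k + 1))"
      proof (rule integral_mono_AE)
        show "AE x in \<mu>. norm (of_real (x ^ n) / (of_real x - z k)) \<le> R ^ n / (real k + 1)"
          using AE_bounded
        proof eventually_elim
          case (elim x)
          have "real k + 1 \<le> y k" using M_pos by (simp add: y_def)
          thus ?case unfolding norm_divide using low[of k x] elim
            by (intro frac_le) (auto simp: norm_power R_def intro: power_mono)
        qed
      next
        show "integrable \<mu> (\<lambda>x. norm (of_real (x ^ n) / (of_real x - z k)))" by (rule integrable_norm[OF ib])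
      qed simp
      finally show ?thesis by (simp add: mult.commute)
    qed
    thus "eventually (\<lambda>k. norm (b n k) \<le> R ^ n * measure \<mu> UNIV * (1 / (real k + 1))) sequentially" by simp
  qed
  \<comment> \<open>If \<open>a n = b n\<close>, the next difference is the constant difference of
    the two moments. It also tends to 0, so it vanishes, and equality passes on to the next
    index.\<close>
  have main: "a n = b n \<and> cinner u ((H ^^ n) u) = of_real (LINT x|\<mu>. x ^ n)" for n
  proof (induction n)
    case 0
    have ab: "a 0 = b 0"
      using stieltjes[OF iz v(1)] by (auto simp: a_def b_def)
    hence "(\<lambda>k. a (Suc 0) k - b (Suc 0) k) = (\<lambda>k. cinner u u - of_real (LINT x|\<mu>. x ^ 0))"
      by (auto simp: a_Suc b_Suc)
    moreover have "(\<lambda>k. a (Suc 0) k - b (Suc 0) k) \<longlonglongrightarrow> 0 - 0" by (intro tendsto_intros a_lim b_lim)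
    ultimately have "cinner u u - of_real (LINT x|\<mu>. x ^ 0) = 0" by (simp add: LIMSEQ_const_iff)
    thus ?case using ab by simp
  next
    case (Suc n)
    hence ab: "a (Suc n) = b (Suc n)" by (auto simp: a_Suc b_Suc)
    hence "(\<lambda>k. a (Suc (Suc n)) k - b (Suc (Suc n)) k) = (\<lambda>k. cinner u ((H ^^ Suc n) u) - of_real (LINT x|\<mu>. x ^ Suc n))"
      by (simp only: a_Suc[of "Suc n"] b_Suc[of "Suc n"]) auto
    moreover have "(\<lambda>k. a (Suc (Suc n)) k - b (Suc (Suc n)) k) \<longlonglongrightarrow> 0 - 0" by (intro tendsto_intros a_lim b_lim)
    ultimately have "cinner u ((H ^^ Suc n) u) - of_real (LINT x|\<mu>. x ^ Suc n) = 0" by (simp add: LIMSEQ_const_iff)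
    thus ?case using ab by simp
  qed
  have "Re (cinner u ((H ^^ n) u)) = (LINT x|\<mu>. x ^ n)" using main[of n] by simp
  thus ?thesis by (simp add: cinner_def)
qed

end

lemma quadratic_nonneg_imp:
  fixes a b c :: real
  assumes "\<And>t. 0 \<le> a + 2 * t * b + t\<^sup>2 * c" "0 \<le> c"
  shows "b\<^sup>2 \<le> a * c"
proof (cases "c = 0")
  case True
  have "b = 0"
  proof (rule ccontr)
    assume "b \<noteq> 0"
    thus False using assms(1)[of "- (a + 1) / (2 * b)"] True by (simp add: field_simps)
  qed
  thus ?thesis using True by simp
next
  case False
  hence "c > 0" using assms(2) by simp
  have "0 \<le> a + 2 * (- b / c) * b + (- b / c)\<^sup>2 * c" by (rule assms(1))
  also have "\<dots> = a - b\<^sup>2 / c" using False by (simp add: field_simps power2_eq_square)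
  finally show ?thesis using \<open>c > 0\<close> by (simp add: field_simps)
qed

text \<open>With summable weights of order \<open>1 / n\<^sup>2\<close> the weighted sum of squares
  has a finite integral, hence is finite almost everywhere, and it dominates each of its
  terms.\<close>

lemma AE_polynomially_bounded:
  fixes f :: "nat \<Rightarrow> 'a \<Rightarrow> real"
  assumes f: "\<And>n. f n \<in> borel_measurable M" "\<And>n. integrable M (\<lambda>x. (f n x)\<^sup>2)" "\<And>n. (LINT x|M. (f n x)\<^sup>2) \<le> B"
  shows "AE x in M. \<exists>P\<ge>0. \<forall>n. \<bar>f n x\<bar> \<le> P * (1 + real n)"
proof -
  define w where "w n = inverse ((1 + real n)\<^sup>2)" for n
  have w: "w n > 0" for n by (simp add: w_def)
  have "summable (\<lambda>n. inverse (real (Suc n) ^ 2))"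
    using inverse_power_summable[of 2, where 'a = real] by (subst summable_Suc_iff) simp
  hence ws: "summable w" by (simp add: w_def[abs_def] add.commute)
  note [measurable] = f(1)
  have B: "0 \<le> B" using order.trans[OF integral_nonneg_AE f(3)[of 0]] by simp
  have "(\<integral>\<^sup>+x. (\<Sum>n. ennreal (w n * (f n x)\<^sup>2)) \<partial>M) = (\<Sum>n. \<integral>\<^sup>+x. ennreal (w n * (f n x)\<^sup>2) \<partial>M)"
    by (intro nn_integral_suminf) measurable
  also have "\<dots> \<le> (\<Sum>n. ennreal (w n * B))"
  proof (rule suminf_le)
    fix n
    have "(\<integral>\<^sup>+x. ennreal (w n * (f n x)\<^sup>2) \<partial>M) = ennreal (LINT x|M. w n * (f n x)\<^sup>2)"
      using w[of n] f(2)[of n] by (intro nn_integral_eq_integral) auto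
    also have "\<dots> = ennreal (w n * (LINT x|M. (f n x)\<^sup>2))" by simp
    also have "\<dots> \<le> ennreal (w n * B)" using w[of n] f(3)[of n] by (intro ennreal_leI mult_left_mono) auto
    finally show "(\<integral>\<^sup>+x. ennreal (w n * (f n x)\<^sup>2) \<partial>M) \<le> ennreal (w n * B)" .
  qed auto
  also have "\<dots> < \<infinity>"
  proof -
    have "0 \<le> w n * B" for n using w[of n] B by simp
    thus ?thesis by (subst suminf_ennreal2) (auto intro!: summable_mult2 ws)
  qed
  finally have "(\<integral>\<^sup>+x. (\<Sum>n. ennreal (w n * (f n x)\<^sup>2)) \<partial>M) \<noteq> \<infinity>" by simp
  hence "AE x in M. (\<Sum>n. ennreal (w n * (f n x)\<^sup>2)) \<noteq> \<infinity>"
    by (intro nn_integral_noteq_infinite) measurable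
  thus ?thesis
  proof eventually_elim
    case (elim x)
    define S where "S = enn2real (\<Sum>n. ennreal (w n * (f n x)\<^sup>2))"
    have S: "ennreal S = (\<Sum>n. ennreal (w n * (f n x)\<^sup>2))" "0 \<le> S"
      using elim by (simp_all add: S_def less_top)
    show ?case
    proof (intro exI[of _ "sqrt S"] conjI allI)
      fix n
      have "ennreal (w n * (f n x)\<^sup>2) \<le> (\<Sum>n. ennreal (w n * (f n x)\<^sup>2))"
        using sum_le_suminf[of "\<lambda>n. ennreal (w n * (f n x)\<^sup>2)" "{n}"] by simp
      hence "w n * (f n x)\<^sup>2 \<le> S" unfolding S(1)[symmetric] using S(2) by simp
      hence "(f n x)\<^sup>2 \<le> S * (1 + real n)\<^sup>2" by (simp add: w_def field_simps)
      also have "\<dots> = (sqrt S * (1 + real n))\<^sup>2" using S(2) by (simp add: power_mult_distrib)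
      finally show "\<bar>f n x\<bar> \<le> sqrt S * (1 + real n)"
        using S(2) by (simp add: abs_le_square_iff[symmetric] abs_mult)
    qed (use S in simp)
  qed
qed

section \<open>Polynomials of the operator applied to \<open>u\<close>, and the adjoint of that
  isometry\<close>

context spectral_measure
begin

definition papp :: "real poly \<Rightarrow> ell2" where
  "papp p = (\<Sum>i\<le>degree p. coeff p i *\<^sub>R (H ^^ i) u)"

lemma papp_eq: "degree p \<le> N \<Longrightarrow> papp p = (\<Sum>i\<le>N. coeff p i *\<^sub>R (H ^^ i) u)"
  unfolding papp_def by (rule sum.mono_neutral_left) (auto simp: coeff_eq_0)

lemma poly_eq: "degree p \<le> N \<Longrightarrow> poly p x = (\<Sum>i\<le>N. coeff p i * x ^ i)" for x :: real
  unfolding poly_altdef by (rule sum.mono_neutral_left) (auto simp: coeff_eq_0)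

lemma papp_add: "papp (p + q) = papp p + papp q"
proof -
  let ?N = "max (degree p) (degree q)"
  have "degree (p + q) \<le> ?N" by (rule degree_add_le_max)
  thus ?thesis by (simp add: papp_eq[of _ ?N] scaleR_left_distrib sum.distrib)
qed

lemma papp_smult: "papp (smult c p) = c *\<^sub>R papp p"
  by (simp add: papp_eq[of "smult c p" "degree p"] papp_eq[of p "degree p"] scaleR_right.sum degree_smult_le)

lemma papp_diff: "papp (p - q) = papp p - papp q"
  using papp_add[of "p - q" q] by (simp add: algebra_simps)

lemma H_sum: "H (\<Sum>i\<in>I. f i) = (\<Sum>i\<in>I. H (f i))"
  by (induction I rule: infinite_finite_induct) (simp_all add: H_add H_scaleR[of 0 0, simplified])

lemma papp_pCons: "papp (pCons 0 p) = H (papp p)"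
proof -
  have "papp (pCons 0 p) = (\<Sum>i\<le>Suc (degree p). coeff (pCons 0 p) i *\<^sub>R (H ^^ i) u)"
    by (rule papp_eq) (rule degree_pCons_le)
  also have "\<dots> = (\<Sum>i\<le>degree p. coeff p i *\<^sub>R H ((H ^^ i) u))"
    by (simp add: sum.atMost_Suc_shift del: sum.atMost_Suc)
  also have "\<dots> = H (papp p)" by (simp add: papp_def H_sum H_scaleR)
  finally show ?thesis .
qed

lemma papp_1: "papp 1 = u"
  by (simp add: papp_def)

lemma Hn_sym: "inner ((H ^^ i) a) b = inner a ((H ^^ i) b)"
proof (induction i arbitrary: b)
  case (Suc i)
  have "inner ((H ^^ Suc i) a) b = inner ((H ^^ i) a) (H b)" by (simp add: H_sym)
  also have "\<dots> = inner a ((H ^^ i) (H b))" by (rule Suc)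
  finally show ?case by (simp add: funpow_swap1)
qed simp

lemma integrable_poly: "integrable \<mu> (\<lambda>x. poly p x * poly q x)"
proof -
  have "compact (poly (p * q) ` {- (M + 1)..M + 1})" by (intro compact_continuous_image continuous_intros) auto
  hence "bounded (poly (p * q) ` {- (M + 1)..M + 1})" by (rule compact_imp_bounded)
  then obtain B where "\<forall>y\<in>poly (p * q) ` {- (M + 1)..M + 1}. norm y \<le> B" unfolding bounded_iff by blast
  hence B: "norm (poly (p * q) x) \<le> B" if "x \<in> {- (M + 1)..M + 1}" for x using that by blast
  have "(\<lambda>x. poly p x * poly q x) \<in> borel_measurable borel"
    by (intro borel_measurable_continuous_onI continuous_intros)
  thus ?thesis by (rule integrable_bounded_on_support[where B = B]) (use B in \<open>auto simp: abs_le_iff\<close>)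
qed

lemma inner_papp: "inner (papp p) (papp q) = (LINT x|\<mu>. poly p x * poly q x)"
proof -
  let ?N = "max (degree p) (degree q)"
  have ip: "integrable \<mu> (\<lambda>x. x ^ n)" for n
    using integrable_poly[of "monom 1 n" 1] by (simp add: poly_monom)
  have "inner (papp p) (papp q) = (\<Sum>i\<le>?N. coeff p i * inner ((H ^^ i) u) (papp q))"
    by (simp add: papp_eq[of p ?N] inner_sum_left)
  also have "\<dots> = (\<Sum>i\<le>?N. \<Sum>j\<le>?N. coeff p i * (coeff q j * inner ((H ^^ i) u) ((H ^^ j) u)))"
    by (simp add: papp_eq[of q ?N] inner_sum_right sum_distrib_left)
  also have "\<dots> = (\<Sum>i\<le>?N. \<Sum>j\<le>?N. coeff p i * (coeff q j * (LINT x|\<mu>. x ^ (i + j))))"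
    by (simp add: Hn_sym moment funpow_add)
  also have "\<dots> = (LINT x|\<mu>. (\<Sum>i\<le>?N. \<Sum>j\<le>?N. coeff p i * (coeff q j * x ^ (i + j))))"
    using ip by simp
  also have "\<dots> = (LINT x|\<mu>. poly p x * poly q x)"
    by (rule Bochner_Integration.integral_cong[OF refl])
       (simp add: poly_eq[of _ ?N] sum_product power_add mult_ac)
  finally show ?thesis .
qed

definition sqint :: "(real \<Rightarrow> real) \<Rightarrow> bool" where
  "sqint h \<longleftrightarrow> h \<in> borel_measurable borel \<and> integrable \<mu> (\<lambda>x. (h x)\<^sup>2)"

lemma sqint_measurable: "sqint h \<Longrightarrow> h \<in> borel_measurable \<mu>"
  by (simp add: sqint_def measurable_cong_sets[OF sets_mu refl])

lemma sqint_mult: assumes "sqint f" "sqint g" shows "integrable \<mu> (\<lambda>x. f x * g x)"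
proof (rule Bochner_Integration.integrable_bound)
  show "integrable \<mu> (\<lambda>x. (f x)\<^sup>2 + (g x)\<^sup>2)" using assms by (simp add: sqint_def)
  show "(\<lambda>x. f x * g x) \<in> borel_measurable \<mu>" using assms[THEN sqint_measurable] by measurable
  show "AE x in \<mu>. norm (f x * g x) \<le> norm ((f x)\<^sup>2 + (g x)\<^sup>2)"
  proof (rule AE_I2)
    fix x
    have "2 * (\<bar>f x\<bar> * \<bar>g x\<bar>) \<le> (f x)\<^sup>2 + (g x)\<^sup>2" using sum_squares_bound[of "\<bar>f x\<bar>" "\<bar>g x\<bar>"] by simp
    moreover have "0 \<le> \<bar>f x\<bar> * \<bar>g x\<bar>" by simp
    ultimately have "\<bar>f x\<bar> * \<bar>g x\<bar> \<le> (f x)\<^sup>2 + (g x)\<^sup>2" by linarith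
    thus "norm (f x * g x) \<le> norm ((f x)\<^sup>2 + (g x)\<^sup>2)" by (simp add: abs_mult)
  qed
qed

lemma sqint_lincomb: assumes "sqint f" "sqint g" shows "sqint (\<lambda>x. a * f x + b * g x)"
proof -
  have "(a * f x + b * g x)\<^sup>2 = a\<^sup>2 * (f x)\<^sup>2 + 2 * a * b * (f x * g x) + b\<^sup>2 * (g x)\<^sup>2" for x
    by (simp add: power2_eq_square algebra_simps)
  moreover have "integrable \<mu> (\<lambda>x. a\<^sup>2 * (f x)\<^sup>2 + 2 * a * b * (f x * g x) + b\<^sup>2 * (g x)\<^sup>2)"
    using assms sqint_mult[OF assms] by (intro Bochner_Integration.integrable_add integrable_mult_right) (auto simp: sqint_def)
  moreover have "(\<lambda>x. a * f x + b * g x) \<in> borel_measurable borel"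
  proof -
    have [measurable]: "f \<in> borel_measurable borel" "g \<in> borel_measurable borel" using assms by (auto simp: sqint_def)
    show ?thesis by measurable
  qed
  ultimately show ?thesis by (simp add: sqint_def)
qed

lemma sqint_diff: "sqint f \<Longrightarrow> sqint g \<Longrightarrow> sqint (\<lambda>x. f x - g x)"
  using sqint_lincomb[of f g 1 "- 1"] by simp

lemma sqint_poly: "sqint (poly p)"
  using integrable_poly[of p p] by (auto simp: sqint_def power2_eq_square intro!: borel_measurable_continuous_onI continuous_intros)

lemma sqint_mult_x: assumes "sqint f" shows "sqint (\<lambda>x. x * f x)"
proof -
  have "integrable \<mu> (\<lambda>x. (x * f x)\<^sup>2)"
  proof (rule Bochner_Integration.integrable_bound)
    show "integrable \<mu> (\<lambda>x. (M + 1)\<^sup>2 * (f x)\<^sup>2)" using assms by (simp add: sqint_def)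
    show "(\<lambda>x. (x * f x)\<^sup>2) \<in> borel_measurable \<mu>" using sqint_measurable[OF assms] by measurable
    show "AE x in \<mu>. norm ((x * f x)\<^sup>2) \<le> norm ((M + 1)\<^sup>2 * (f x)\<^sup>2)"
      using AE_bounded
    proof eventually_elim
      case (elim x)
      hence "x\<^sup>2 \<le> (M + 1)\<^sup>2" using M_pos by (simp add: abs_le_square_iff[symmetric])
      thus ?case by (simp add: power_mult_distrib mult_right_mono)
    qed
  qed
  moreover have "(\<lambda>x. x * f x) \<in> borel_measurable borel"
  proof -
    have [measurable]: "f \<in> borel_measurable borel" using assms by (simp add: sqint_def)
    show ?thesis by measurable
  qed
  ultimately show ?thesis by (simp add: sqint_def)
qed

definition qn :: "(real \<Rightarrow> real) \<Rightarrow> real" where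
  "qn f = (LINT x|\<mu>. (f x)\<^sup>2)"

lemma qn_poly: "qn (poly p) = (norm (papp p))\<^sup>2"
  unfolding power2_norm_eq_inner inner_papp qn_def by (simp add: power2_eq_square)

lemma qn_nonneg: "0 \<le> qn f"
  by (simp add: qn_def)

lemma qn_lincomb:
  assumes "sqint f" "sqint g"
  shows "qn (\<lambda>x. a * f x + b * g x) = a\<^sup>2 * qn f + 2 * a * b * (LINT x|\<mu>. f x * g x) + b\<^sup>2 * qn g"
proof -
  have "(a * f x + b * g x)\<^sup>2 = a\<^sup>2 * (f x)\<^sup>2 + 2 * a * b * (f x * g x) + b\<^sup>2 * (g x)\<^sup>2" for x
    by (simp add: power2_eq_square algebra_simps)
  thus ?thesis using assms sqint_mult[OF assms] by (simp add: qn_def sqint_def)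
qed

lemma qn_Cauchy_Schwarz:
  assumes "sqint f" "sqint g"
  shows "(LINT x|\<mu>. f x * g x)\<^sup>2 \<le> qn f * qn g"
proof (rule quadratic_nonneg_imp)
  fix t
  show "0 \<le> qn f + 2 * t * (LINT x|\<mu>. f x * g x) + t\<^sup>2 * qn g"
    using qn_lincomb[OF assms, of 1 t] qn_nonneg[of "\<lambda>x. 1 * f x + t * g x"] by simp
qed (rule qn_nonneg)

lemma qn_lincomb_le:
  assumes "sqint f" "sqint g"
  shows "qn (\<lambda>x. a * f x + b * g x) \<le> 2 * a\<^sup>2 * qn f + 2 * b\<^sup>2 * qn g"
proof -
  have "0 \<le> a\<^sup>2 * qn f - 2 * a * b * (LINT x|\<mu>. f x * g x) + b\<^sup>2 * qn g"
    using qn_lincomb[OF assms, of a "- b"] qn_nonneg[of "\<lambda>x. a * f x + - b * g x"] by simp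
  thus ?thesis unfolding qn_lincomb[OF assms] by linarith
qed

lemma qn_mult_x_le:
  assumes "sqint f" shows "qn (\<lambda>x. x * f x) \<le> (M + 1)\<^sup>2 * qn f"
proof -
  have "qn (\<lambda>x. x * f x) \<le> (LINT x|\<mu>. (M + 1)\<^sup>2 * (f x)\<^sup>2)"
    unfolding qn_def
  proof (rule integral_mono_AE)
    show "AE x in \<mu>. (x * f x)\<^sup>2 \<le> (M + 1)\<^sup>2 * (f x)\<^sup>2"
      using AE_bounded
    proof eventually_elim
      case (elim x)
      hence "x\<^sup>2 \<le> (M + 1)\<^sup>2" using M_pos by (simp add: abs_le_square_iff[symmetric])
      thus ?case by (simp add: power_mult_distrib mult_right_mono)
    qed
  qed (use assms sqint_mult_x[OF assms] in \<open>auto simp: sqint_def\<close>)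
  thus ?thesis by (simp add: qn_def)
qed

text \<open>With \<open>U p = p(H) u\<close> an isometry from polynomials in \<open>L\<^sup>2(\<mu>)\<close>, \<open>rep h w\<close> says that \<open>h\<close> is
  the image of \<open>w\<close> under the adjoint of \<open>U\<close>.\<close>

definition rep :: "(real \<Rightarrow> real) \<Rightarrow> ell2 \<Rightarrow> bool" where
  "rep h w \<longleftrightarrow> sqint h \<and> (\<forall>p. inner (papp p) w = (LINT x|\<mu>. poly p x * h x)) \<and>
     (\<exists>P. (\<lambda>k. qn (\<lambda>x. poly (P k) x - h x)) \<longlonglongrightarrow> 0)"

lemma tendsto_integral_mult:
  assumes "sqint h" "sqint g" "\<And>k. sqint (F k)" "(\<lambda>k. qn (\<lambda>x. F k x - h x)) \<longlonglongrightarrow> 0"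
  shows "(\<lambda>k. LINT x|\<mu>. g x * F k x) \<longlonglongrightarrow> (LINT x|\<mu>. g x * h x)"
proof -
  have "(\<lambda>k. (LINT x|\<mu>. g x * F k x) - (LINT x|\<mu>. g x * h x)) \<longlonglongrightarrow> 0"
  proof (rule Lim_null_comparison)
    have "(\<lambda>k. sqrt (qn g * qn (\<lambda>x. F k x - h x))) \<longlonglongrightarrow> sqrt (qn g * 0)"
      by (intro tendsto_intros assms)
    thus "(\<lambda>k. sqrt (qn g * qn (\<lambda>x. F k x - h x))) \<longlonglongrightarrow> 0" by simp
    have "\<bar>(LINT x|\<mu>. g x * F k x) - (LINT x|\<mu>. g x * h x)\<bar> \<le> sqrt (qn g * qn (\<lambda>x. F k x - h x))" for k
    proof -
      have "(LINT x|\<mu>. g x * F k x) - (LINT x|\<mu>. g x * h x) = (LINT x|\<mu>. g x * (F k x - h x))"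
        by (simp add: right_diff_distrib sqint_mult assms)
      moreover have "(LINT x|\<mu>. g x * (F k x - h x))\<^sup>2 \<le> qn g * qn (\<lambda>x. F k x - h x)"
        by (intro qn_Cauchy_Schwarz sqint_diff assms)
      ultimately show ?thesis by (metis real_sqrt_abs real_sqrt_le_mono)
    qed
    thus "\<forall>\<^sub>F k in sequentially. norm ((LINT x|\<mu>. g x * F k x) - (LINT x|\<mu>. g x * h x)) \<le> sqrt (qn g * qn (\<lambda>x. F k x - h x))"
      by simp
  qed
  thus ?thesis by (simp add: LIM_zero_iff)
qed

text \<open>The adjoint of an isometry is a contraction. Along the approximating polynomials both
  the pairing with \<open>w\<close> and the squared norm tend to \<open>qn h\<close>, and
  Cauchy-Schwarz is applied before the limit.\<close>

lemma rep_norm: assumes "rep h w" shows "qn h \<le> (norm w)\<^sup>2"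
proof -
  obtain P where h: "sqint h" and eq: "\<And>p. inner (papp p) w = (LINT x|\<mu>. poly p x * h x)"
    and P: "(\<lambda>k. qn (\<lambda>x. poly (P k) x - h x)) \<longlonglongrightarrow> 0" using assms unfolding rep_def by blast
  have 1: "(\<lambda>k. LINT x|\<mu>. h x * poly (P k) x) \<longlonglongrightarrow> (LINT x|\<mu>. h x * h x)"
    by (rule tendsto_integral_mult[OF h h sqint_poly P])
  have q: "qn (poly (P k)) = 1 * qn (\<lambda>x. poly (P k) x - h x) + 2 * (LINT x|\<mu>. h x * poly (P k) x) - qn h" for k
  proof -
    have "qn (\<lambda>x. poly (P k) x - h x) = qn (poly (P k)) - 2 * (LINT x|\<mu>. poly (P k) x * h x) + qn h"
      using qn_lincomb[OF sqint_poly h, of 1 "P k" "- 1"] by simp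
    thus ?thesis by (simp add: mult.commute)
  qed
  have hh: "(LINT x|\<mu>. h x * h x) = qn h" by (simp add: qn_def power2_eq_square)
  have "(\<lambda>k. qn (poly (P k))) \<longlonglongrightarrow> 1 * 0 + 2 * qn h - qn h"
    unfolding q by (intro tendsto_intros P 1[unfolded hh])
  hence 2: "(\<lambda>k. qn (poly (P k)) * (norm w)\<^sup>2) \<longlonglongrightarrow> qn h * (norm w)\<^sup>2"
    by (intro tendsto_intros) simp
  have 3: "(\<lambda>k. (LINT x|\<mu>. h x * poly (P k) x)\<^sup>2) \<longlonglongrightarrow> (qn h)\<^sup>2" by (intro tendsto_intros 1[unfolded hh])
  have "(LINT x|\<mu>. h x * poly (P k) x)\<^sup>2 \<le> qn (poly (P k)) * (norm w)\<^sup>2" for k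
  proof -
    have "(inner (papp (P k)) w)\<^sup>2 \<le> qn (poly (P k)) * (norm w)\<^sup>2"
      unfolding qn_poly power2_norm_eq_inner by (rule Cauchy_Schwarz_ineq)
    thus ?thesis by (simp add: eq mult.commute[of "h _"])
  qed
  hence "(qn h)\<^sup>2 \<le> qn h * (norm w)\<^sup>2" by (intro LIMSEQ_le[OF 3 2]) auto
  thus ?thesis using qn_nonneg[of h] by (cases "qn h = 0") (auto simp: power2_eq_square)
qed

lemma rep_lincomb:
  assumes "rep f v" "rep g w" shows "rep (\<lambda>x. a * f x + b * g x) (a *\<^sub>R v + b *\<^sub>R w)"
proof -
  obtain P where f: "sqint f" "\<And>p. inner (papp p) v = (LINT x|\<mu>. poly p x * f x)"
    and P: "(\<lambda>k. qn (\<lambda>x. poly (P k) x - f x)) \<longlonglongrightarrow> 0" using assms(1) unfolding rep_def by blast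
  obtain Q where g: "sqint g" "\<And>p. inner (papp p) w = (LINT x|\<mu>. poly p x * g x)"
    and Q: "(\<lambda>k. qn (\<lambda>x. poly (Q k) x - g x)) \<longlonglongrightarrow> 0" using assms(2) unfolding rep_def by blast
  define R where "R k = smult a (P k) + smult b (Q k)" for k
  have eq: "(\<lambda>x. poly (R k) x - (a * f x + b * g x)) = (\<lambda>x. a * (poly (P k) x - f x) + b * (poly (Q k) x - g x))" for k
    by (auto simp: R_def algebra_simps)
  have "(\<lambda>k. qn (\<lambda>x. poly (R k) x - (a * f x + b * g x))) \<longlonglongrightarrow> 0"
  proof (rule tendsto_sandwich)
    show "\<forall>\<^sub>F k in sequentially. 0 \<le> qn (\<lambda>x. poly (R k) x - (a * f x + b * g x))" by (simp add: qn_nonneg)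
    show "\<forall>\<^sub>F k in sequentially. qn (\<lambda>x. poly (R k) x - (a * f x + b * g x))
        \<le> 2 * a\<^sup>2 * qn (\<lambda>x. poly (P k) x - f x) + 2 * b\<^sup>2 * qn (\<lambda>x. poly (Q k) x - g x)"
      unfolding eq by (intro always_eventually allI qn_lincomb_le sqint_diff sqint_poly f g)
    have "(\<lambda>k. 2 * a\<^sup>2 * qn (\<lambda>x. poly (P k) x - f x) + 2 * b\<^sup>2 * qn (\<lambda>x. poly (Q k) x - g x)) \<longlonglongrightarrow> 2 * a\<^sup>2 * 0 + 2 * b\<^sup>2 * 0"
      by (intro tendsto_intros P Q)
    thus "(\<lambda>k. 2 * a\<^sup>2 * qn (\<lambda>x. poly (P k) x - f x) + 2 * b\<^sup>2 * qn (\<lambda>x. poly (Q k) x - g x)) \<longlonglongrightarrow> 0" by simp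
  qed simp
  moreover have "inner (papp p) (a *\<^sub>R v + b *\<^sub>R w) = (LINT x|\<mu>. poly p x * (a * f x + b * g x))" for p
  proof -
    have "(LINT x|\<mu>. poly p x * (a * f x + b * g x)) = (LINT x|\<mu>. a * (poly p x * f x) + b * (poly p x * g x))"
      by (simp add: algebra_simps)
    also have "\<dots> = a * (LINT x|\<mu>. poly p x * f x) + b * (LINT x|\<mu>. poly p x * g x)"
      by (simp add: sqint_mult sqint_poly f g)
    finally show ?thesis by (simp add: inner_add_right f g)
  qed
  ultimately show ?thesis unfolding rep_def using sqint_lincomb[OF f(1) g(1)] by blast
qed

text \<open>The isometry intertwines multiplication by \<open>x\<close> with \<open>H\<close>, as
  \<open>papp_pCons\<close> shows; by symmetry of \<open>H\<close> so does its adjoint. This later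
  turns the matrix of \<open>H\<close> into an eigenvalue equation for functions of
  \<open>x\<close>.\<close>

lemma rep_mult_x: assumes "rep h w" shows "rep (\<lambda>x. x * h x) (H w)"
proof -
  obtain P where h: "sqint h" "\<And>p. inner (papp p) w = (LINT x|\<mu>. poly p x * h x)"
    and P: "(\<lambda>k. qn (\<lambda>x. poly (P k) x - h x)) \<longlonglongrightarrow> 0" using assms unfolding rep_def by blast
  have eq: "(\<lambda>x. poly (pCons 0 (P k)) x - x * h x) = (\<lambda>x. x * (poly (P k) x - h x))" for k
    by (auto simp: algebra_simps)
  have "(\<lambda>k. qn (\<lambda>x. poly (pCons 0 (P k)) x - x * h x)) \<longlonglongrightarrow> 0"
  proof (rule tendsto_sandwich)
    show "\<forall>\<^sub>F k in sequentially. 0 \<le> qn (\<lambda>x. poly (pCons 0 (P k)) x - x * h x)" by (simp add: qn_nonneg)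
    show "\<forall>\<^sub>F k in sequentially. qn (\<lambda>x. poly (pCons 0 (P k)) x - x * h x) \<le> (M + 1)\<^sup>2 * qn (\<lambda>x. poly (P k) x - h x)"
      unfolding eq by (intro always_eventually allI qn_mult_x_le sqint_diff sqint_poly h)
    show "(\<lambda>k. (M + 1)\<^sup>2 * qn (\<lambda>x. poly (P k) x - h x)) \<longlonglongrightarrow> 0" by (rule tendsto_mult_right_zero[OF P])
  qed simp
  moreover have "inner (papp p) (H w) = (LINT x|\<mu>. poly p x * (x * h x))" for p
    using h(2)[of "pCons 0 p"] by (simp add: papp_pCons H_sym mult_ac)
  ultimately show ?thesis unfolding rep_def using sqint_mult_x[OF h(1)]
    by (intro conjI allI exI[of _ "\<lambda>k. pCons 0 (P k)"])
qed

lemma rep_1: "rep (\<lambda>_. 1) u"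
proof -
  have "inner (papp p) u = (LINT x|\<mu>. poly p x * 1)" for p using inner_papp[of p 1] by (simp add: papp_1)
  moreover have "(\<lambda>k::nat. qn (\<lambda>x. poly 1 x - 1)) \<longlonglongrightarrow> 0" by (simp add: qn_def)
  moreover have "sqint (\<lambda>_. 1)" using sqint_poly[of 1] by (simp add: poly_1[abs_def])
  ultimately show ?thesis unfolding rep_def by (intro conjI allI exI[of _ "\<lambda>_. 1"])
qed

text \<open>A Riesz-Fischer argument. At the rate \<open>(1/16) ^ k\<close> the differences stay
  bounded in L2 even after scaling by \<open>2 ^ k\<close>, so pointwise they are almost everywhere
  of order \<open>k / 2 ^ k\<close> and summable. Fatou's lemma carries the norm bounds to the
  limit.\<close>

lemma L2_complete:
  fixes P :: "nat \<Rightarrow> real poly"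
  assumes C: "\<And>j k. k \<le> j \<Longrightarrow> qn (\<lambda>x. poly (P j) x - poly (P k) x) \<le> 4 * (1/16) ^ k"
  obtains h where "sqint h" "(\<lambda>k. qn (\<lambda>x. poly (P k) x - h x)) \<longlonglongrightarrow> 0"
proof -
  define h where "h x = lim (\<lambda>k. poly (P k) x)" for x
  have Pm: "poly p \<in> borel_measurable borel" for p :: "real poly"
    using sqint_poly[of p] by (simp add: sqint_def)
  have hm: "h \<in> borel_measurable borel" unfolding h_def[abs_def] by (intro borel_measurable_lim_metric Pm)
  note Pmu = Pm[folded measurable_cong_sets[OF sets_mu refl]] and hmu = hm[folded measurable_cong_sets[OF sets_mu refl]]
  note [measurable] = Pmu hmu
  have Psq: "sqint (\<lambda>x. poly p x - poly q x)" for p q by (intro sqint_diff sqint_poly)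
  let ?f = "\<lambda>k x. 2 ^ k * (poly (P (Suc k)) x - poly (P k) x)"
  have "AE x in \<mu>. \<exists>C\<ge>0. \<forall>k. \<bar>?f k x\<bar> \<le> C * (1 + real k)"
  proof (rule AE_polynomially_bounded[where B = 4])
    fix k
    have eq: "(2 ^ k * (poly (P (Suc k)) x - poly (P k) x))\<^sup>2 = 4 ^ k * (poly (P (Suc k)) x - poly (P k) x)\<^sup>2" for x
      by (simp add: power_mult_distrib power_mult[symmetric] mult.commute[of k 2] power_mult[of 2 2 k, simplified])
    show "integrable \<mu> (\<lambda>x. (?f k x)\<^sup>2)" unfolding eq using Psq by (simp add: sqint_def)
    have "(LINT x|\<mu>. (?f k x)\<^sup>2) = 4 ^ k * qn (\<lambda>x. poly (P (Suc k)) x - poly (P k) x)"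
      unfolding eq by (simp add: qn_def)
    also have "\<dots> \<le> 4 ^ k * (4 * (1/16) ^ k)" using C[of k "Suc k"] by (intro mult_left_mono) auto
    also have "\<dots> = 4 * (1/4) ^ k" by (simp add: power_mult_distrib[symmetric])
    also have "\<dots> \<le> 4" by (simp add: power_le_one)
    finally show "(LINT x|\<mu>. (?f k x)\<^sup>2) \<le> 4" .
  qed measurable
  hence conv: "AE x in \<mu>. (\<lambda>k. poly (P k) x) \<longlonglongrightarrow> h x"
  proof eventually_elim
    case (elim x)
    then obtain C where C: "\<And>k. \<bar>?f k x\<bar> \<le> C * (1 + real k)" by blast
    have "summable (\<lambda>k. poly (P (Suc k)) x - poly (P k) x)"
    proof (rule summable_comparison_test)
      have "summable (\<lambda>k. C * ((1/2) ^ k + real k * (1/2) ^ k))"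
        using summable_power_mult_geometric[of "1/2" 1]
        by (intro summable_mult summable_add summable_geometric) auto
      thus "summable (\<lambda>k. C * ((1/2) ^ k + real k * (1/2) ^ k))" .
      have "norm (poly (P (Suc k)) x - poly (P k) x) \<le> C * ((1/2) ^ k + real k * (1/2) ^ k)" for k
      proof -
        have "2 ^ k * \<bar>poly (P (Suc k)) x - poly (P k) x\<bar> \<le> C + C * real k"
          using C[of k] unfolding abs_mult by (simp add: distrib_left)
        thus ?thesis by (simp add: field_simps power_one_over)
      qed
      thus "\<exists>N. \<forall>n\<ge>N. norm (poly (P (Suc n)) x - poly (P n) x) \<le> C * ((1/2) ^ n + real n * (1/2) ^ n)" by blast
    qed
    hence "convergent (\<lambda>n. (\<Sum>k<n. poly (P (Suc k)) x - poly (P k) x) + poly (P 0) x)"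
      unfolding summable_iff_convergent by (rule convergent_add) (rule convergent_const)
    moreover have "(\<Sum>k<n. poly (P (Suc k)) x - poly (P k) x) + poly (P 0) x = poly (P n) x" for n
      by (induction n) auto
    ultimately have "convergent (\<lambda>k. poly (P k) x)" by simp
    thus ?case by (simp add: h_def convergent_LIMSEQ_iff)
  qed
  have bd: "integrable \<mu> (\<lambda>x. (poly (P k) x - h x)\<^sup>2) \<and> qn (\<lambda>x. poly (P k) x - h x) \<le> 4 * (1/16) ^ k" for k
  proof -
    have "(\<integral>\<^sup>+x. ennreal ((poly (P k) x - h x)\<^sup>2) \<partial>\<mu>) \<le> (\<integral>\<^sup>+x. liminf (\<lambda>j. ennreal ((poly (P k) x - poly (P j) x)\<^sup>2)) \<partial>\<mu>)"
    proof (rule nn_integral_mono_AE)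
      show "AE x in \<mu>. ennreal ((poly (P k) x - h x)\<^sup>2) \<le> liminf (\<lambda>j. ennreal ((poly (P k) x - poly (P j) x)\<^sup>2))"
        using conv
      proof eventually_elim
        case (elim x)
        have "(\<lambda>j. ennreal ((poly (P k) x - poly (P j) x)\<^sup>2)) \<longlonglongrightarrow> ennreal ((poly (P k) x - h x)\<^sup>2)"
          by (intro tendsto_intros elim)
        thus ?case using lim_imp_Liminf[OF sequentially_bot] by fastforce
      qed
    qed
    also have "\<dots> \<le> liminf (\<lambda>j. \<integral>\<^sup>+x. ennreal ((poly (P k) x - poly (P j) x)\<^sup>2) \<partial>\<mu>)"
      by (rule nn_integral_liminf) measurable
    also have "\<dots> \<le> ennreal (4 * (1/16) ^ k)"
    proof (rule Liminf_le)
      show "\<forall>\<^sub>F j in sequentially. (\<integral>\<^sup>+x. ennreal ((poly (P k) x - poly (P j) x)\<^sup>2) \<partial>\<mu>) \<le> ennreal (4 * (1/16) ^ k)"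
        using eventually_ge_at_top[of k]
      proof eventually_elim
        case (elim j)
        have "(\<integral>\<^sup>+x. ennreal ((poly (P k) x - poly (P j) x)\<^sup>2) \<partial>\<mu>) = ennreal (qn (\<lambda>x. poly (P k) x - poly (P j) x))"
          unfolding qn_def using Psq[of "P k" "P j"] by (intro nn_integral_eq_integral) (auto simp: sqint_def)
        also have "qn (\<lambda>x. poly (P k) x - poly (P j) x) = qn (\<lambda>x. poly (P j) x - poly (P k) x)"
          by (simp add: qn_def power2_commute)
        finally show ?case using C[OF elim] by (simp add: ennreal_leI)
      qed
    qed simp
    finally have le: "(\<integral>\<^sup>+x. ennreal ((poly (P k) x - h x)\<^sup>2) \<partial>\<mu>) \<le> ennreal (4 * (1/16) ^ k)" .
    have int: "integrable \<mu> (\<lambda>x. (poly (P k) x - h x)\<^sup>2)"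
    proof (rule integrableI_bounded)
      show "(\<integral>\<^sup>+x. ennreal (norm ((poly (P k) x - h x)\<^sup>2)) \<partial>\<mu>) < \<infinity>"
        using le by (simp add: order.strict_trans1[OF _ ennreal_less_top])
    qed measurable
    have "ennreal (qn (\<lambda>x. poly (P k) x - h x)) \<le> ennreal (4 * (1/16) ^ k)"
      unfolding qn_def using le int by (subst nn_integral_eq_integral[symmetric]) auto
    thus ?thesis using int by simp
  qed
  have hs: "sqint (\<lambda>x. poly (P k) x - h x)" for k
    using bd[of k] hm Pm by (auto simp: sqint_def intro!: borel_measurable_diff)
  show ?thesis
  proof (rule that[of h])
    show "sqint h" using sqint_diff[OF sqint_poly hs, of "P 0" 0] by simp
    show "(\<lambda>k. qn (\<lambda>x. poly (P k) x - h x)) \<longlonglongrightarrow> 0"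
    proof (rule tendsto_sandwich)
      show "\<forall>\<^sub>F k in sequentially. 0 \<le> qn (\<lambda>x. poly (P k) x - h x)" by (simp add: qn_nonneg)
      show "\<forall>\<^sub>F k in sequentially. qn (\<lambda>x. poly (P k) x - h x) \<le> 4 * (1/16) ^ k" using bd by simp
      have "(\<lambda>k. 4 * (1/16::real) ^ k) \<longlonglongrightarrow> 4 * 0" by (intro tendsto_intros LIMSEQ_realpow_zero) auto
      thus "(\<lambda>k. 4 * (1/16::real) ^ k) \<longlonglongrightarrow> 0" by simp
    qed simp
  qed
qed

text \<open>The Riesz representation of \<open>p \<mapsto> inner (p(H) u) w\<close>, by minimising the distance from \<open>w\<close> to
  the cyclic subspace.\<close>

lemma rep_exists: "\<exists>h. rep h w"
proof -
  define D where "D p = (norm (w - papp p))\<^sup>2" for p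
  define d where "d = Inf (range D)"
  have bdd: "bdd_below (range D)" by (rule bdd_belowI2[where m = 0]) (simp add: D_def)
  have dle: "d \<le> D p" for p unfolding d_def using bdd by (intro cInf_lower) auto
  have "\<exists>p. D p < d + (1/16) ^ k" for k :: nat
  proof -
    have "d < d + (1/16) ^ k" by simp
    hence "\<exists>y\<in>range D. y < d + (1/16) ^ k" unfolding d_def using bdd by (subst (asm) cInf_less_iff) auto
    thus ?thesis by blast
  qed
  then obtain P where P: "\<And>k::nat. D (P k) < d + (1/16) ^ k" by metis
  have cauchy: "qn (\<lambda>x. poly (P j) x - poly (P k) x) \<le> 4 * (1/16) ^ k" if "k \<le> j" for j k
  proof -
    let ?a = "w - papp (P j)" and ?b = "w - papp (P k)"
    \<comment> \<open>The parallelogram law: the midpoint of two almost minimising polynomials is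
      again a competitor, which forces them close together.\<close>
    have "(norm (b - a))\<^sup>2 = 2 * (norm a)\<^sup>2 + 2 * (norm b)\<^sup>2 - 4 * (norm ((1/2) *\<^sub>R (a + b)))\<^sup>2" for a b :: ell2
    proof -
      have "4 * (norm ((1/2) *\<^sub>R (a + b)))\<^sup>2 = (norm (a + b))\<^sup>2" by (simp add: power2_eq_square)
      moreover have "(norm (b - a))\<^sup>2 + (norm (a + b))\<^sup>2 = 2 * (norm a)\<^sup>2 + 2 * (norm b)\<^sup>2"
        unfolding power2_norm_eq_inner
        by (simp add: inner_add_left inner_add_right inner_diff_left inner_diff_right inner_commute)
      ultimately show ?thesis by linarith
    qed
    from this[of ?b ?a] have "(norm (?b - ?a))\<^sup>2 = 2 * (norm ?a)\<^sup>2 + 2 * (norm ?b)\<^sup>2 - 4 * (norm ((1/2) *\<^sub>R (?a + ?b)))\<^sup>2" .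
    also have "(1/2) *\<^sub>R (?a + ?b) = w - papp (smult (1/2) (P j + P k))"
      by (simp add: papp_smult papp_add algebra_simps scaleR_2[symmetric])
    also have "?b - ?a = papp (P j - P k)" by (simp add: papp_diff)
    finally have "qn (poly (P j - P k)) = 2 * D (P j) + 2 * D (P k) - 4 * D (smult (1/2) (P j + P k))"
      by (simp add: qn_poly D_def)
    also have "\<dots> \<le> 2 * (1/16) ^ j + 2 * (1/16) ^ k"
      using P[of j] P[of k] dle[of "smult (1/2) (P j + P k)"] by linarith
    also have "(1/16::real) ^ j \<le> (1/16) ^ k" using that by (intro power_decreasing) auto
    finally show ?thesis by (simp add: poly_diff[abs_def])
  qed
  obtain h where h: "sqint h" "(\<lambda>k. qn (\<lambda>x. poly (P k) x - h x)) \<longlonglongrightarrow> 0"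
    using L2_complete[of P, OF cauchy] by blast
  have "inner (papp q) w = (LINT x|\<mu>. poly q x * h x)" for q
  proof -
    \<comment> \<open>The approximate first-order condition at an almost minimiser: moving along
      \<open>q\<close> lowers \<open>D\<close> by less than \<open>(1/16) ^ k\<close>, so a
      discriminant bounds the derivative.\<close>
    have "(inner (papp q) (w - papp (P k)))\<^sup>2 \<le> (1/16) ^ k * (norm (papp q))\<^sup>2" for k
    proof (rule quadratic_nonneg_imp)
      fix t
      have "d \<le> D (P k - smult t q)" by (rule dle)
      also have "\<dots> = D (P k) + 2 * t * inner (papp q) (w - papp (P k)) + t\<^sup>2 * (norm (papp q))\<^sup>2"
        unfolding D_def papp_diff papp_smult power2_norm_eq_inner
        by (simp add: inner_diff_left inner_diff_right inner_commute power2_eq_square algebra_simps)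
      finally show "0 \<le> (1/16) ^ k + 2 * t * inner (papp q) (w - papp (P k)) + t\<^sup>2 * (norm (papp q))\<^sup>2"
        using P[of k] by linarith
    qed simp
    hence le: "\<bar>inner (papp q) (w - papp (P k))\<bar> \<le> sqrt ((1/16) ^ k * (norm (papp q))\<^sup>2)" for k
      by (metis real_sqrt_abs real_sqrt_le_mono)
    have "(\<lambda>k. inner (papp q) w - inner (papp q) (papp (P k))) \<longlonglongrightarrow> 0"
    proof (rule Lim_null_comparison)
      have "(\<lambda>k. sqrt ((1/16) ^ k * (norm (papp q))\<^sup>2)) \<longlonglongrightarrow> sqrt (0 * (norm (papp q))\<^sup>2)"
        by (intro tendsto_intros LIMSEQ_realpow_zero) auto
      thus "(\<lambda>k. sqrt ((1/16) ^ k * (norm (papp q))\<^sup>2)) \<longlonglongrightarrow> 0" by simp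
    qed (use le in \<open>simp add: inner_diff_right\<close>)
    moreover have "(\<lambda>k. inner (papp q) (papp (P k))) \<longlonglongrightarrow> (LINT x|\<mu>. poly q x * h x)"
      unfolding inner_papp by (rule tendsto_integral_mult[OF h(1) sqint_poly sqint_poly h(2)])
    ultimately have "(\<lambda>k. (inner (papp q) w - inner (papp q) (papp (P k))) + inner (papp q) (papp (P k))) \<longlonglongrightarrow> 0 + (LINT x|\<mu>. poly q x * h x)"
      by (intro tendsto_add)
    thus ?thesis by (simp add: LIMSEQ_const_iff)
  qed
  thus ?thesis using h unfolding rep_def by blast
qed

lemma rep_zero_AE: assumes "rep h 0" shows "AE x in \<mu>. h x = 0"
proof -
  have "qn h = 0" using rep_norm[OF assms] qn_nonneg[of h] by simp
  moreover have "integrable \<mu> (\<lambda>x. (h x)\<^sup>2)" using assms by (simp add: rep_def sqint_def)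
  ultimately have "AE x in \<mu>. (h x)\<^sup>2 = 0" unfolding qn_def by (subst (asm) integral_nonneg_eq_0_iff_AE) auto
  thus ?thesis by simp
qed

text \<open>Read as a sequence in \<open>n\<close> for fixed \<open>x\<close>, this is the
  generalized eigenfunction of energy \<open>x\<close>. The values 1 and \<i> of \<open>b\<close>
  together span the complex unit vector over the reals.\<close>

definition hker :: "complex \<Rightarrow> int \<Rightarrow> real \<Rightarrow> real" where
  "hker b n = (SOME h. rep h (delta n b))"

lemma rep_hker: "rep (hker b n) (delta n b)"
  unfolding hker_def by (rule someI_ex[OF rep_exists])

lemma norm_delta: "norm (delta n b) = norm b"
  by (simp add: norm_eq_sqrt_inner inner_delta_left)

lemma hker_polynomially_bounded:
  assumes "norm b = 1"
  shows "AE x in \<mu>. \<exists>P. \<forall>n. \<bar>hker b n x\<bar> \<le> P * (1 + \<bar>of_int n\<bar>)"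
proof -
  have s: "sqint (hker b n)" for n using rep_hker[of b n] by (simp add: rep_def)
  have q: "qn (hker b n) \<le> 1" for n using rep_norm[OF rep_hker[of b n]] assms by (simp add: norm_delta)
  have "AE x in \<mu>. \<exists>P\<ge>0. \<forall>n. \<bar>hker b (int n) x\<bar> \<le> P * (1 + real n)"
    by (rule AE_polynomially_bounded[where B = 1]) (use s q in \<open>auto simp: sqint_measurable sqint_def qn_def\<close>)
  moreover have "AE x in \<mu>. \<exists>P\<ge>0. \<forall>n. \<bar>hker b (- int n) x\<bar> \<le> P * (1 + real n)"
    by (rule AE_polynomially_bounded[where B = 1]) (use s q in \<open>auto simp: sqint_measurable sqint_def qn_def\<close>)
  ultimately show ?thesis
  proof eventually_elim
    case (elim x)
    then obtain P Q where P: "P \<ge> 0" "\<And>n. \<bar>hker b (int n) x\<bar> \<le> P * (1 + real n)"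
      and Q: "Q \<ge> 0" "\<And>n. \<bar>hker b (- int n) x\<bar> \<le> Q * (1 + real n)" by blast
    have "\<bar>hker b n x\<bar> \<le> (P + Q) * (1 + \<bar>of_int n\<bar>)" for n
    proof (cases "n \<ge> 0")
      case True
      have "\<bar>hker b n x\<bar> \<le> P * (1 + \<bar>of_int n\<bar>)" using P(2)[of "nat n"] True by simp
      also have "\<dots> \<le> (P + Q) * (1 + \<bar>of_int n\<bar>)" using Q(1) by (intro mult_right_mono) auto
      finally show ?thesis .
    next
      case False
      have "\<bar>hker b n x\<bar> \<le> Q * (1 + \<bar>of_int n\<bar>)" using Q(2)[of "nat (- n)"] False by simp
      also have "\<dots> \<le> (P + Q) * (1 + \<bar>of_int n\<bar>)" using P(1) by (intro mult_right_mono) auto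
      finally show ?thesis .
    qed
    thus ?case by blast
  qed
qed

text \<open>Since \<open>1\<close> represents \<open>u\<close>, it is the limit of combinations of the kernels \<open>hker b n\<close>.\<close>

lemma null_set_if_hker_zero:
  assumes A: "A \<in> sets borel" and zero: "AE x in \<mu>. x \<in> A \<longrightarrow> (\<forall>n. hker 1 n x = 0 \<and> hker \<i> n x = 0)"
  shows "emeasure \<mu> A = 0"
proof -
  interpret finite_measure \<mu> by (rule finite_mu)
  have "measure \<mu> A \<le> \<epsilon>" if eps: "\<epsilon> > 0" for \<epsilon>
  proof -
    have "(\<lambda>n. (norm (coord u n))\<^sup>2) summable_on UNIV" using l2_coord[of u] by (simp add: l2_def)
    from infsum_finite_approximation[OF this eps] obtain F where F: "finite F"
      "dist (\<Sum>n\<in>F. (norm (coord u n))\<^sup>2) (infsum (\<lambda>n. (norm (coord u n))\<^sup>2) UNIV) \<le> \<epsilon>" by blast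
    have nu: "infsum (\<lambda>n. (norm (coord u n))\<^sup>2) UNIV = (norm u)\<^sup>2"
      unfolding power2_norm_eq_inner inner_ell2_def ..
    \<comment> \<open>\<open>S F\<close> truncates \<open>u\<close> to \<open>F\<close>, and
      \<open>1 - g F\<close> represents the remainder. Almost everywhere on \<open>A\<close> the
      kernels vanish and this function is 1, so the mass of \<open>A\<close> is at most the squared
      norm of the remainder.\<close>
    define S where "S F = (\<Sum>n\<in>F. Re (coord u n) *\<^sub>R delta n 1 + Im (coord u n) *\<^sub>R delta n \<i>)" for F
    define g where "g F x = (\<Sum>n\<in>F. Re (coord u n) * hker 1 n x + Im (coord u n) * hker \<i> n x)" for F x
    have repS: "rep (\<lambda>x. 1 - g F x) (u - S F)" if "finite F" for F
      using that
    proof (induction F rule: finite_induct)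
      case empty
      show ?case using rep_1 by (simp add: g_def S_def)
    next
      case (insert n F)
      have "rep (\<lambda>x. Re (coord u n) * hker 1 n x + Im (coord u n) * hker \<i> n x) (Re (coord u n) *\<^sub>R delta n 1 + Im (coord u n) *\<^sub>R delta n \<i>)"
        by (intro rep_lincomb rep_hker)
      from rep_lincomb[OF insert.IH this, of 1 "- 1"] show ?case
        using insert.hyps by (simp add: g_def S_def algebra_simps)
    qed
    have coordS: "coord (S F) m = (if m \<in> F then coord u m else 0)" if "finite F" for F m
      using that
    proof (induction F rule: finite_induct)
      case (insert n F)
      thus ?case by (auto simp: S_def complex_eq_iff)
    qed (simp add: S_def)
    have "norm (u - S F) \<le> sqrt \<epsilon>"
    proof (rule norm_ell2_leI)
      fix F' :: "int set" assume F': "finite F'"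
      have "(\<Sum>n\<in>F'. (norm (coord (u - S F) n))\<^sup>2) = (\<Sum>n\<in>F'. if n \<in> F then 0 else (norm (coord u n))\<^sup>2)"
        using F(1) by (intro sum.cong) (auto simp: coordS)
      also have "\<dots> = (\<Sum>n\<in>F' - F. (norm (coord u n))\<^sup>2)"
        using F' by (intro sum.mono_neutral_cong_right) auto
      also have "\<dots> = (\<Sum>n\<in>F' \<union> F. (norm (coord u n))\<^sup>2) - (\<Sum>n\<in>F. (norm (coord u n))\<^sup>2)"
        using F(1) F' sum.subset_diff[of F "F' \<union> F" "\<lambda>n. (norm (coord u n))\<^sup>2"] by (simp add: Un_Diff)
      also have "\<dots> \<le> (norm u)\<^sup>2 - (\<Sum>n\<in>F. (norm (coord u n))\<^sup>2)"
        using F(1) F' by (intro diff_right_mono sum_norm_coord_le) auto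
      also have "\<dots> \<le> \<epsilon>" using F(2) unfolding nu dist_real_def by linarith
      finally show "(\<Sum>n\<in>F'. (norm (coord (u - S F) n))\<^sup>2) \<le> (sqrt \<epsilon>)\<^sup>2" using eps by simp
    qed (use eps in simp)
    hence "(norm (u - S F))\<^sup>2 \<le> (sqrt \<epsilon>)\<^sup>2" by (intro power_mono) auto
    hence q: "qn (\<lambda>x. 1 - g F x) \<le> \<epsilon>" using rep_norm[OF repS[OF F(1)]] eps by simp
    have "measure \<mu> A = (LINT x|\<mu>. indicator A x)" by simp
    also have "\<dots> \<le> qn (\<lambda>x. 1 - g F x)"
      unfolding qn_def
    proof (rule integral_mono_AE)
      show "AE x in \<mu>. indicator A x \<le> (1 - g F x)\<^sup>2"
        using zero by eventually_elim (auto simp: indicator_def g_def)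
      show "integrable \<mu> (\<lambda>x. (1 - g F x)\<^sup>2)" using repS[OF F(1)] by (simp add: rep_def sqint_def)
    qed (use A in \<open>auto simp: sets_mu emeasure_eq_measure\<close>)
    finally show ?thesis using q by linarith
  qed
  hence "measure \<mu> A \<le> 0" by (rule field_le_epsilon[of _ 0, simplified])
  thus ?thesis by (simp add: emeasure_eq_measure measure_le_0_iff)
qed

end

section \<open>Localization\<close>

lemma sin_ge_half: assumes "0 \<le> y" "y \<le> pi / 2" shows "y / 2 \<le> sin y"
proof (cases "y \<le> pi / 3")
  case True
  have "\<exists>D. ((\<lambda>x. sin x - x / 2) has_real_derivative D) (at x) \<and> 0 \<le> D" if "0 \<le> x" "x \<le> y" for x
  proof (intro exI conjI)
    show "((\<lambda>x. sin x - x / 2) has_real_derivative (cos x - 1 / 2)) (at x)" by (auto intro!: derivative_eq_intros)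
    have "cos (pi / 3) \<le> cos x" using that True by (intro cos_monotone_0_pi_le) auto
    thus "0 \<le> cos x - 1 / 2" by (simp add: cos_60)
  qed
  from DERIV_nonneg_imp_nondecreasing[OF assms(1) this] show ?thesis by simp
next
  case False
  have "sin (pi / 3) \<le> sin y" using False assms by (intro sin_monotone_2pi_le) auto
  moreover have "pi / 4 \<le> sqrt 3 / 2"
  proof -
    have "pi \<le> 16 / 5" using pi_approx by simp
    hence "pi * pi \<le> (16 / 5) * (16 / 5)" by (intro mult_mono) auto
    hence "pi / 2 \<le> sqrt 3" by (intro real_le_rsqrt) (simp add: power2_eq_square)
    thus ?thesis by simp
  qed
  ultimately show ?thesis using assms by (simp add: sin_60)
qed

lemma tnorm_le_chord: "tnorm x \<le> chord x"
proof -
  define t where "t = x - of_int (round x)"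
  have t: "\<bar>t\<bar> \<le> 1 / 2" using of_int_round_abs_le[of x] by (simp add: t_def abs_minus_commute)
  let ?n = "of_int (round x) :: real"
  have s0: "sin (pi * ?n) = 0" by (simp add: sin_zero_iff_int2 mult.commute)
  hence "(cos (pi * ?n))\<^sup>2 = 1" by (simp add: cos_squared_eq)
  hence c1: "\<bar>cos (pi * ?n)\<bar> = 1" by (simp add: power2_eq_1_iff abs_if)
  have x: "pi * x = pi * t + pi * ?n" by (simp add: t_def algebra_simps)
  have "\<bar>sin (pi * x)\<bar> = \<bar>sin (pi * t)\<bar>" unfolding x sin_add using s0 c1 by (simp add: abs_mult)
  also have "\<dots> = \<bar>sin (pi * \<bar>t\<bar>)\<bar>" by (simp add: abs_if)
  also have "\<dots> \<ge> pi * \<bar>t\<bar> / 2"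
    using sin_ge_half[of "pi * \<bar>t\<bar>"] t by (simp add: mult_left_le)
  finally have "pi * \<bar>t\<bar> / 2 \<le> \<bar>sin (pi * x)\<bar>" .
  moreover have "\<bar>t\<bar> \<le> pi * \<bar>t\<bar>" using pi_gt3 by (simp add: mult_le_cancel_right1)
  ultimately show ?thesis by (simp add: chord_def tnorm_def t_def)
qed

lemma powr_le_chord_power:
  assumes "\<eta> * \<bar>of_int k\<bar> powr (- \<sigma>) \<le> tnorm x" "k \<noteq> (0::int)" "\<sigma> \<le> real N" "\<eta> > 0"
  shows "\<eta> \<le> chord x * \<bar>of_int k\<bar> ^ N"
proof -
  let ?k = "\<bar>of_int k\<bar> :: real"
  have k: "?k \<ge> 1" using assms(2) by simp
  have "1 \<le> ?k powr (real N - \<sigma>)" using k assms(3) by (simp add: ge_one_powr_ge_zero)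
  also have "?k powr (real N - \<sigma>) = ?k powr (- \<sigma>) * ?k ^ N"
    using k by (simp add: powr_add[symmetric] powr_realpow[symmetric])
  finally have "\<eta> * 1 \<le> \<eta> * (?k powr (- \<sigma>) * ?k ^ N)" using assms(4) by (intro mult_left_mono) auto
  also have "\<dots> = (\<eta> * ?k powr (- \<sigma>)) * ?k ^ N" by simp
  also have "\<dots> \<le> chord x * ?k ^ N"
    using order.trans[OF assms(1) tnorm_le_chord] k by (intro mult_right_mono) auto
  finally show ?thesis by simp
qed

text \<open>The frequency doubles because the reduced equation lives on every second site. The
  maximum with 1 supplies the positive exponent that \<open>dioph\<close> demands, and rounding up
  is harmless since nonzero integers have modulus at least 1.\<close>

lemma DC_imp_dioph:
  assumes "\<alpha> \<in> DC \<gamma> \<sigma>"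
  shows "dioph (2 * \<alpha>) (\<gamma> / 2 ^ nat \<lceil>max \<sigma> 1\<rceil>) (nat \<lceil>max \<sigma> 1\<rceil>)"
proof -
  let ?N = "nat \<lceil>max \<sigma> 1\<rceil>"
  have g: "\<gamma> > 0" and DC: "\<And>k::int. k \<noteq> 0 \<Longrightarrow> \<gamma> * \<bar>of_int k\<bar> powr (- \<sigma>) \<le> tnorm (of_int k * \<alpha>)"
    using assms by (auto simp: DC_def)
  have N: "\<sigma> \<le> real ?N" "?N \<ge> 1" by linarith+
  show ?thesis unfolding dioph_def
  proof (intro conjI allI impI)
    fix d :: int assume d: "d \<noteq> 0"
    have "\<gamma> \<le> chord (of_int (2 * d) * \<alpha>) * \<bar>of_int (2 * d)\<bar> ^ ?N"
      by (rule powr_le_chord_power[OF DC]) (use d N g in auto)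
    thus "\<gamma> / 2 ^ ?N \<le> chord (of_int d * (2 * \<alpha>)) * \<bar>of_int d\<bar> ^ ?N"
      by (simp add: field_simps abs_mult power_mult_distrib)
  qed (use g N in auto)
qed

text \<open>Multiples of \<open>2 * \<alpha>\<close> are the even multiples of \<alpha>, so the
  condition is used at \<open>- 2 * k\<close>; the doubling costs a power of 2.\<close>

lemma Theta_imp_nonres:
  assumes "\<theta> \<in> Theta \<alpha> \<sigma>"
  obtains b where "nonres (2 * \<alpha>) \<theta> b (nat \<lceil>max \<sigma> 1\<rceil>) 0"
proof -
  let ?N = "nat \<lceil>max \<sigma> 1\<rceil>"
  obtain \<eta> where e: "\<eta> > 0" and T: "\<And>k::int. k \<noteq> 0 \<Longrightarrow> \<eta> / \<bar>of_int k\<bar> powr \<sigma> \<le> tnorm (2 * \<theta> - of_int k * \<alpha>)"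
    using assms by (auto simp: Theta_def)
  have N: "\<sigma> \<le> real ?N" by linarith
  show ?thesis
  proof (rule that[of "\<eta> / 2 ^ ?N"], unfold nonres_def, intro conjI allI impI)
    fix k :: int assume k: "int 0 < \<bar>k\<bar>"
    have "\<eta> \<le> chord (2 * \<theta> - of_int (- 2 * k) * \<alpha>) * \<bar>of_int (- 2 * k)\<bar> ^ ?N"
    proof (rule powr_le_chord_power)
      show "\<eta> * \<bar>of_int (- 2 * k)\<bar> powr (- \<sigma>) \<le> tnorm (2 * \<theta> - of_int (- 2 * k) * \<alpha>)"
        using T[of "- 2 * k"] k by (simp add: powr_minus divide_inverse)
    qed (use k N e in auto)
    thus "\<eta> / 2 ^ ?N \<le> chord (2 * \<theta> + of_int k * (2 * \<alpha>)) * \<bar>of_int k\<bar> ^ ?N"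
      by (simp add: field_simps abs_mult power_mult_distrib)
  qed (use e in auto)
qed

text \<open>Eliminating the hopping \<open>lam\<close> between the sites \<open>2 m - 1\<close> and \<open>2 m\<close> turns the eigenvalue equation
  for \<open>h\<close> into the equation \<open>sol\<close> for \<open>\<psi> m = w m * (h (2 m) + h (2 m + 1))\<close>.\<close>

lemma eigenfunction_exp_decay:
  fixes h :: "int \<Rightarrow> real"
  assumes lam: "lam > 0" and DC: "\<alpha> \<in> DC \<gamma> \<sigma>" and Th: "\<theta> \<in> Theta \<alpha> \<sigma>" and x: "\<bar>x\<bar> > lam"
    and eq: "\<And>n. x * h n = cof lam \<alpha> \<theta> n * h (n + 1) + cof lam \<alpha> \<theta> (n - 1) * h (n - 1) + vpot \<alpha> \<theta> n * h n"
    and P: "\<And>n. \<bar>h n\<bar> \<le> P * (1 + \<bar>of_int n\<bar>)"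
  shows "\<exists>C r. C \<ge> 0 \<and> r > 0 \<and> (\<forall>n. \<bar>h n\<bar> \<le> C * exp (- r * \<bar>of_int n\<bar>))"
proof -
  define w where "w = wcos (2 * \<alpha>) \<theta>"
  define a b where "a m = h (2 * m)" and "b m = h (2 * m + 1)" for m
  define \<psi> where "\<psi> m = w m * (a m + b m)" for m
  define q where "q = x\<^sup>2 - lam\<^sup>2"
  have "lam\<^sup>2 < \<bar>x\<bar>\<^sup>2" using lam x by (intro power_strict_mono) auto
  hence q: "q > 0" by (simp add: q_def)
  have w: "cof lam \<alpha> \<theta> (2 * m) = w m" "vpot \<alpha> \<theta> (2 * m) = w m" "vpot \<alpha> \<theta> (2 * m + 1) = w m"
      "cof lam \<alpha> \<theta> (2 * m + 1) = lam" for m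
    by (simp_all add: w_def wcos_def cof_def vpot_def algebra_simps)
  have idx: "2 * m - 1 = 2 * (m - 1) + 1" "2 * m + 1 - 1 = 2 * m" "2 * m + 1 + 1 = 2 * (m + 1)" for m :: int
    by simp_all
  have ea: "x * a m = \<psi> m + lam * b (m - 1)" for m
    using eq[of "2 * m"] unfolding idx w by (simp add: a_def b_def \<psi>_def distrib_left)
  have eb: "x * b m = \<psi> m + lam * a (m + 1)" for m
    using eq[of "2 * m + 1"] unfolding idx w by (simp add: a_def b_def \<psi>_def distrib_left)
  \<comment> \<open>The equations \<open>ea\<close> at \<open>m\<close> and \<open>eb\<close> at
    \<open>m - 1\<close> form a 2 by 2 system for the sites \<open>2 * m\<close> and
    \<open>2 * m - 1\<close> with determinant \<open>q\<close>. As \<open>q > 0\<close>, the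
    eigenfunction is recovered from \<psi> without dividing by any cosine.\<close>
  have a_eq: "q * a m = x * \<psi> m + lam * \<psi> (m - 1)" for m
  proof -
    have "q * a m = x * (x * a m) - lam * (lam * a m)" by (simp add: q_def power2_eq_square algebra_simps)
    also have "lam * a m = x * b (m - 1) - \<psi> (m - 1)" using eb[of "m - 1"] by simp
    finally show ?thesis unfolding ea by (simp add: algebra_simps)
  qed
  have b_eq: "q * b m = x * \<psi> m + lam * \<psi> (m + 1)" for m
  proof -
    have "q * b m = x * (x * b m) - lam * (lam * b m)" by (simp add: q_def power2_eq_square algebra_simps)
    also have "lam * b m = x * a (m + 1) - \<psi> (m + 1)" using ea[of "m + 1"] by simp
    finally show ?thesis unfolding eb by (simp add: algebra_simps)
  qed
  have S: "sol (q / lam) (2 * x / lam) (wcos (2 * \<alpha>) \<theta>) \<psi>"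
    unfolding sol_def w_def[symmetric]
  proof
    fix m
    have "q * \<psi> m = w m * (q * a m + q * b m)" by (simp add: \<psi>_def algebra_simps)
    also have "\<dots> = w m * (lam * \<psi> (m + 1) + lam * \<psi> (m - 1) + 2 * x * \<psi> m)"
      unfolding a_eq b_eq by (simp add: algebra_simps)
    finally show "w m * (\<psi> (m + 1) + \<psi> (m - 1) + 2 * x / lam * \<psi> m) = q / lam * \<psi> m"
      using lam by (simp add: field_simps)
  qed
  have e: "\<bar>2 * x / lam\<bar> > 2" using lam x by (simp add: abs_mult field_simps)
  have P0: "P \<ge> 0" using P[of 0] by simp
  have P\<psi>: "\<bar>\<psi> m\<bar> \<le> (4 * P) * (1 + \<bar>of_int m\<bar>)" for m
  proof -
    have "\<bar>\<psi> m\<bar> \<le> 1 * \<bar>a m + b m\<bar>"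
      unfolding \<psi>_def abs_mult w_def by (intro mult_right_mono abs_wcos_le) auto
    also have "\<dots> \<le> \<bar>a m\<bar> + \<bar>b m\<bar>" by simp
    also have "\<dots> \<le> P * (1 + \<bar>of_int (2 * m)\<bar>) + P * (1 + \<bar>of_int (2 * m + 1)\<bar>)"
      unfolding a_def b_def by (intro add_mono P)
    also have "\<dots> = P * ((1 + \<bar>of_int (2 * m)\<bar>) + (1 + \<bar>of_int (2 * m + 1)\<bar>))" by (simp only: distrib_left)
    also have "\<dots> \<le> P * (4 * (1 + \<bar>of_int m\<bar>))"
    proof (rule mult_left_mono[OF _ P0])
      have "(1 + \<bar>2 * y\<bar>) + (1 + \<bar>2 * y + 1\<bar>) \<le> 4 * (1 + \<bar>y\<bar>)" for y :: real
        using abs_triangle_ineq[of "2 * y" 1] by (simp add: abs_mult)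
      from this[of "of_int m"] show "(1 + \<bar>of_int (2 * m)\<bar>) + (1 + \<bar>of_int (2 * m + 1)\<bar>) \<le> 4 * (1 + \<bar>of_int m :: real\<bar>)"
        by simp
    qed
    finally show ?thesis by (simp only: mult_ac)
  qed
  obtain bb where NR: "nonres (2 * \<alpha>) \<theta> bb (nat \<lceil>max \<sigma> 1\<rceil>) 0" using Theta_imp_nonres[OF Th] by blast
  obtain C r where r: "r > 0" and C: "C \<ge> 0" "\<And>m. \<bar>\<psi> m\<bar> \<le> C * exp (- r * \<bar>of_int m\<bar>)"
    using sol_exp_decay[OF DC_imp_dioph[OF DC] NR e S P\<psi>] by blast
  define A where "A = (\<bar>x\<bar> + lam * exp r) * C / q"
  have qA: "q * A = (\<bar>x\<bar> + lam * exp r) * C" using q by (simp add: A_def)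
  have A0: "A \<ge> 0" using lam C(1) q by (simp add: A_def)
  have nb: "\<bar>x * \<psi> m + lam * \<psi> m'\<bar> \<le> q * A * exp (- r * \<bar>of_int m\<bar>)" if "\<bar>m - m'\<bar> \<le> 1" for m m'
  proof -
    have "\<bar>\<psi> m'\<bar> \<le> C * exp (r + - r * \<bar>of_int m\<bar>)"
    proof -
      have "\<bar>of_int m\<bar> - 1 \<le> \<bar>of_int m' :: real\<bar>" using that by linarith
      hence "r * (\<bar>of_int m\<bar> - 1) \<le> r * \<bar>of_int m'\<bar>" using r by (intro mult_left_mono) auto
      hence "C * exp (- r * \<bar>of_int m'\<bar>) \<le> C * exp (r + - r * \<bar>of_int m\<bar>)"
        using C(1) by (intro mult_left_mono) (auto simp: algebra_simps)
      thus ?thesis using C(2)[of m'] by linarith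
    qed
    hence "\<bar>x\<bar> * \<bar>\<psi> m\<bar> + lam * \<bar>\<psi> m'\<bar> \<le> \<bar>x\<bar> * (C * exp (- r * \<bar>of_int m\<bar>)) + lam * (C * exp (r + - r * \<bar>of_int m\<bar>))"
      using lam C(2)[of m] by (intro add_mono mult_left_mono) auto
    also have "\<dots> = q * A * exp (- r * \<bar>of_int m\<bar>)"
      unfolding qA exp_add by (simp only: distrib_right distrib_left mult_ac)
    finally show ?thesis using lam abs_triangle_ineq[of "x * \<psi> m" "lam * \<psi> m'"] by (simp add: abs_mult)
  qed
  have da: "\<bar>a m\<bar> \<le> A * exp (- r * \<bar>of_int m\<bar>)" for m
  proof -
    have "q * \<bar>a m\<bar> = \<bar>q * a m\<bar>" using q by (simp add: abs_mult)
    also have "\<dots> \<le> q * A * exp (- r * \<bar>of_int m\<bar>)" unfolding a_eq by (intro nb) simp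
    finally show ?thesis using q by (simp add: mult.assoc)
  qed
  have db: "\<bar>b m\<bar> \<le> A * exp (- r * \<bar>of_int m\<bar>)" for m
  proof -
    have "q * \<bar>b m\<bar> = \<bar>q * b m\<bar>" using q by (simp add: abs_mult)
    also have "\<dots> \<le> q * A * exp (- r * \<bar>of_int m\<bar>)" unfolding b_eq by (intro nb) simp
    finally show ?thesis using q by (simp add: mult.assoc)
  qed
  \<comment> \<open>Two sites correspond to one index of the reduced equation, so the rate is
    halved.\<close>
  have "\<bar>h n\<bar> \<le> A * exp (r / 2) * exp (- (r / 2) * \<bar>of_int n\<bar>)" for n
  proof -
    define m where "m = n div 2"
    have "n = 2 * m \<or> n = 2 * m + 1" unfolding m_def by presburger
    hence hn: "\<bar>h n\<bar> \<le> A * exp (- r * \<bar>of_int m\<bar>)" and m: "\<bar>of_int n\<bar> \<le> 2 * \<bar>of_int m :: real\<bar> + 1"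
      using da[of m] db[of m] by (auto simp: a_def b_def)
    note hn
    also have "A * exp (- r * \<bar>of_int m\<bar>) \<le> A * exp (r / 2 + - (r / 2) * \<bar>of_int n\<bar>)"
    proof -
      have "(r / 2) * \<bar>of_int n\<bar> \<le> (r / 2) * (2 * \<bar>of_int m\<bar> + 1)" using m r by (intro mult_left_mono) auto
      thus ?thesis using A0 by (intro mult_left_mono) (auto simp: algebra_simps)
    qed
    finally show ?thesis by (simp only: exp_add mult.assoc)
  qed
  thus ?thesis using A0 r by (intro exI[of _ "A * exp (r / 2)"] exI[of _ "r / 2"]) auto
qed

lemma l2_exp_decay:
  assumes r: "r > 0" and C: "\<And>n. norm (u n) \<le> C * exp (- r * \<bar>of_int n\<bar>)"
  shows "l2 u"
proof (rule l2_finite_sums)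
  define s where "s = exp (- 2 * r)"
  have s: "0 < s" "s < 1" using r by (auto simp: s_def)
  \<comment> \<open>The comparison with a geometric series indexes by the absolute value, which is
    injective only on each half-line; hence two parts.\<close>
  have part: "(\<Sum>n\<in>F. (norm (u n))\<^sup>2) \<le> C\<^sup>2 * (\<Sum>k. s ^ k)" if F: "finite F" and inj: "inj_on (\<lambda>n. nat \<bar>n\<bar>) F" for F
  proof -
    have "(\<Sum>n\<in>F. (norm (u n))\<^sup>2) \<le> (\<Sum>n\<in>F. C\<^sup>2 * s ^ nat \<bar>n\<bar>)"
    proof (rule sum_mono)
      fix n
      have "(norm (u n))\<^sup>2 \<le> (C * exp (- r * \<bar>of_int n\<bar>))\<^sup>2" using C[of n] by (intro power_mono) auto
      also have "\<dots> = C\<^sup>2 * s ^ nat \<bar>n\<bar>"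
        by (simp add: power_mult_distrib s_def exp_of_nat_mult[symmetric] exp_double[symmetric])
      finally show "(norm (u n))\<^sup>2 \<le> C\<^sup>2 * s ^ nat \<bar>n\<bar>" .
    qed
    also have "\<dots> = C\<^sup>2 * (\<Sum>k\<in>(\<lambda>n. nat \<bar>n\<bar>) ` F. s ^ k)"
      using inj by (simp add: sum_distrib_left sum.reindex)
    also have "\<dots> \<le> C\<^sup>2 * (\<Sum>k. s ^ k)"
      using s F by (intro mult_left_mono sum_le_suminf summable_geometric) auto
    finally show ?thesis .
  qed
  fix F :: "int set" assume F: "finite F"
  have "(\<Sum>n\<in>F. (norm (u n))\<^sup>2) = (\<Sum>n\<in>F \<inter> {0..}. (norm (u n))\<^sup>2) + (\<Sum>n\<in>F - {0..}. (norm (u n))\<^sup>2)"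
    using F by (rule sum.Int_Diff)
  also have "\<dots> \<le> C\<^sup>2 * (\<Sum>k. s ^ k) + C\<^sup>2 * (\<Sum>k. s ^ k)"
    using F by (intro add_mono part) (auto simp: inj_on_def)
  finally show "(\<Sum>n\<in>F. (norm (u n))\<^sup>2) \<le> C\<^sup>2 * (\<Sum>k. s ^ k) + C\<^sup>2 * (\<Sum>k. s ^ k)" .
qed

section \<open>The operator on the Hilbert space and the conclusion\<close>

definition shiftop :: "(int \<Rightarrow> real) \<Rightarrow> int \<Rightarrow> ell2 \<Rightarrow> ell2" where
  "shiftop c k u = mk_ell2 (\<lambda>n. of_real (c n) * coord u (n + k))"

lemma coord_shiftop:
  assumes "\<And>n. \<bar>c n\<bar> \<le> B"
  shows "coord (shiftop c k u) n = of_real (c n) * coord u (n + k)"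
proof -
  have "l2 (\<lambda>n. of_real (c n) * coord u (n + k))"
    by (rule l2_bound[OF l2_shift[OF l2_coord[of u], of k], where c = B]) (use assms in \<open>auto simp: norm_mult mult_right_mono\<close>)
  thus ?thesis by (simp add: shiftop_def)
qed

lemma norm_shiftop_le:
  assumes "\<And>n. \<bar>c n\<bar> \<le> B"
  shows "norm (shiftop c k u) \<le> B * norm u"
proof (rule norm_ell2_leI)
  have B: "0 \<le> B" using order.trans[OF abs_ge_zero assms] .
  thus "0 \<le> B * norm u" by simp
  fix F :: "int set" assume F: "finite F"
  have "(\<Sum>n\<in>F. (norm (coord (shiftop c k u) n))\<^sup>2) \<le> (\<Sum>n\<in>F. B\<^sup>2 * (norm (coord u (n + k)))\<^sup>2)"
  proof (rule sum_mono)
    fix n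
    have "\<bar>c n\<bar>\<^sup>2 \<le> B\<^sup>2" using assms[of n] by (intro power_mono) auto
    thus "(norm (coord (shiftop c k u) n))\<^sup>2 \<le> B\<^sup>2 * (norm (coord u (n + k)))\<^sup>2"
      by (simp add: coord_shiftop[OF assms] norm_mult power_mult_distrib mult_right_mono)
  qed
  also have "\<dots> = B\<^sup>2 * (\<Sum>n\<in>(\<lambda>n. n + k) ` F. (norm (coord u n))\<^sup>2)"
    by (simp add: sum_distrib_left sum.reindex)
  also have "\<dots> \<le> B\<^sup>2 * (norm u)\<^sup>2" using F by (intro mult_left_mono sum_norm_coord_le) auto
  finally show "(\<Sum>n\<in>F. (norm (coord (shiftop c k u) n))\<^sup>2) \<le> (B * norm u)\<^sup>2" by (simp add: power_mult_distrib)
qed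

lemma inner_shiftop:
  assumes "\<And>n. \<bar>c n\<bar> \<le> B"
  shows "inner (shiftop c k u) v = inner u (shiftop (\<lambda>n. c (n - k)) (- k) v)"
proof -
  have "inner (shiftop c k u) v = infsum (\<lambda>n. c n * inner (coord u (n + k)) (coord v n)) UNIV"
    unfolding inner_ell2_def coord_shiftop[OF assms] by (intro infsum_cong) (simp add: inner_complex_def algebra_simps)
  also have "\<dots> = infsum (\<lambda>n. c (n - k) * inner (coord u n) (coord v (n - k))) UNIV"
    by (rule infsum_reindex_bij_witness[of _ "\<lambda>n. n - k" "\<lambda>n. n + k"]) auto
  also have "\<dots> = inner u (shiftop (\<lambda>n. c (n - k)) (- k) v)"
    unfolding inner_ell2_def coord_shiftop[of "\<lambda>n. c (n - k)" B, OF assms] by (intro infsum_cong) (simp add: inner_complex_def algebra_simps)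
  finally show ?thesis .
qed

definition Hell :: "real \<Rightarrow> real \<Rightarrow> real \<Rightarrow> ell2 \<Rightarrow> ell2" where
  "Hell lam \<alpha> \<theta> u = shiftop (cof lam \<alpha> \<theta>) 1 u + shiftop (\<lambda>n. cof lam \<alpha> \<theta> (n - 1)) (- 1) u + shiftop (vpot \<alpha> \<theta>) 0 u"

lemma selfadjoint_Hell:
  assumes "lam > 0"
  shows "selfadjoint_op (Hop lam \<alpha> \<theta>) (Hell lam \<alpha> \<theta>) (2 * (lam + 1) + 1)"
proof
  have c: "\<bar>cof lam \<alpha> \<theta> n\<bar> \<le> lam + 1" for n using assms by (auto simp: cof_def intro: order.trans[OF abs_cos_le_one])
  have v: "\<bar>vpot \<alpha> \<theta> n\<bar> \<le> 1" for n by (auto simp: vpot_def)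
  note cs = coord_shiftop[OF c] coord_shiftop[OF v] coord_shiftop[of "\<lambda>n. cof lam \<alpha> \<theta> (n - 1)", OF c]
  fix u v :: ell2 and z
  show "coord (Hell lam \<alpha> \<theta> u) = Hop lam \<alpha> \<theta> (coord u)"
    by (rule ext) (simp add: Hell_def Hop_def cs)
  show "Hell lam \<alpha> \<theta> (u + v) = Hell lam \<alpha> \<theta> u + Hell lam \<alpha> \<theta> v"
    by (rule ell2_eqI) (simp add: Hell_def cs algebra_simps)
  show "Hell lam \<alpha> \<theta> (cmul z u) = cmul z (Hell lam \<alpha> \<theta> u)"
    by (rule ell2_eqI) (simp add: Hell_def cs algebra_simps)
  \<comment> \<open>The two hopping terms are adjoint to each other and the potential term to
    itself.\<close>
  show "inner (Hell lam \<alpha> \<theta> u) v = inner u (Hell lam \<alpha> \<theta> v)"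
    unfolding Hell_def inner_add_left inner_add_right inner_shiftop[OF c] inner_shiftop[of "\<lambda>n. cof lam \<alpha> \<theta> (n - 1)", OF c]
      inner_shiftop[of "vpot \<alpha> \<theta>" 1, OF \<open>\<And>n. \<bar>vpot \<alpha> \<theta> n\<bar> \<le> 1\<close>] by simp
  have "norm (Hell lam \<alpha> \<theta> u) \<le> (lam + 1) * norm u + (lam + 1) * norm u + 1 * norm u"
    unfolding Hell_def
    by (intro norm_triangle_mono norm_shiftop_le c \<open>\<And>n. \<bar>vpot \<alpha> \<theta> n\<bar> \<le> 1\<close>)
  thus "norm (Hell lam \<alpha> \<theta> u) \<le> (2 * (lam + 1) + 1) * norm u" by (simp add: algebra_simps)
  show "2 * (lam + 1) + 1 > 0" using assms by simp
qed

theorem theorem3p10: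
  fixes lam \<alpha> \<gamma> \<sigma> \<theta> :: real
  assumes "lam > 0"
    and "\<alpha> \<in> DC \<gamma> \<sigma>"
    and "\<theta> \<in> Theta \<alpha> \<sigma>"
  shows "anderson_localization (Hop lam \<alpha> \<theta>) (spec (Hop lam \<alpha> \<theta>) - {-lam..lam})"
proof -
  let ?H = "Hell lam \<alpha> \<theta>" and ?M = "2 * (lam + 1) + 1"
  let ?I = "spec (Hop lam \<alpha> \<theta>) - {-lam..lam}"
  interpret selfadjoint_op "Hop lam \<alpha> \<theta>" ?H ?M by (rule selfadjoint_Hell[OF assms(1)])
  note decay = eigenfunction_exp_decay[OF assms]
  define Eig where "Eig = {E. \<exists>g. g \<noteq> 0 \<and> ?H g = E *\<^sub>R g}"
  show ?thesis
    unfolding anderson_localization_def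
  proof (intro conjI ballI allI impI)
    fix E u assume E: "E \<in> ?I" and u: "l2 u" "u \<noteq> (\<lambda>_. 0)" "\<forall>n. Hop lam \<alpha> \<theta> u n = complex_of_real E * u n"
    have E': "\<bar>E\<bar> > lam" using E by auto
    have bd: "norm (u n) \<le> norm (mk_ell2 u) * (1 + \<bar>of_int n\<bar>)" for n
    proof -
      have "norm (u n) \<le> norm (mk_ell2 u) * 1" using norm_coord_le[of "mk_ell2 u" n] u(1) by simp
      also have "\<dots> \<le> norm (mk_ell2 u) * (1 + \<bar>of_int n\<bar>)" by (intro mult_left_mono) auto
      finally show ?thesis .
    qed
    \<comment> \<open>The coefficients and the energy are real, so real and imaginary parts solve
      the equation separately.\<close>
    have "\<exists>C r. C \<ge> 0 \<and> r > 0 \<and> (\<forall>n. \<bar>Re (u n)\<bar> \<le> C * exp (- r * \<bar>of_int n\<bar>))"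
    proof (rule decay[OF E'])
      fix n show "E * Re (u n) = cof lam \<alpha> \<theta> n * Re (u (n + 1)) + cof lam \<alpha> \<theta> (n - 1) * Re (u (n - 1)) + vpot \<alpha> \<theta> n * Re (u n)"
        using u(3)[rule_format, of n] by (simp add: Hop_def complex_eq_iff)
      show "\<bar>Re (u n)\<bar> \<le> norm (mk_ell2 u) * (1 + \<bar>of_int n\<bar>)" using bd[of n] abs_Re_le_cmod[of "u n"] by linarith
    qed
    moreover have "\<exists>C r. C \<ge> 0 \<and> r > 0 \<and> (\<forall>n. \<bar>Im (u n)\<bar> \<le> C * exp (- r * \<bar>of_int n\<bar>))"
    proof (rule decay[OF E'])
      fix n show "E * Im (u n) = cof lam \<alpha> \<theta> n * Im (u (n + 1)) + cof lam \<alpha> \<theta> (n - 1) * Im (u (n - 1)) + vpot \<alpha> \<theta> n * Im (u n)"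
        using u(3)[rule_format, of n] by (simp add: Hop_def complex_eq_iff)
      show "\<bar>Im (u n)\<bar> \<le> norm (mk_ell2 u) * (1 + \<bar>of_int n\<bar>)" using bd[of n] abs_Im_le_cmod[of "u n"] by linarith
    qed
    ultimately obtain C r C' r' where 1: "C \<ge> 0" "r > 0" "\<And>n. \<bar>Re (u n)\<bar> \<le> C * exp (- r * \<bar>of_int n\<bar>)"
      and 2: "C' \<ge> 0" "r' > 0" "\<And>n. \<bar>Im (u n)\<bar> \<le> C' * exp (- r' * \<bar>of_int n\<bar>)" by blast
    have "norm (u n) \<le> (C + C') * exp (- (min r r') * \<bar>of_int n\<bar>)" for n
    proof -
      have "norm (u n) \<le> \<bar>Re (u n)\<bar> + \<bar>Im (u n)\<bar>" by (rule cmod_le)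
      also have "\<dots> \<le> C * exp (- r * \<bar>of_int n\<bar>) + C' * exp (- r' * \<bar>of_int n\<bar>)" by (intro add_mono 1 2)
      also have "\<dots> \<le> C * exp (- (min r r') * \<bar>of_int n\<bar>) + C' * exp (- (min r r') * \<bar>of_int n\<bar>)"
        using 1(1) 2(1) by (intro add_mono mult_left_mono) (auto simp: mult_right_mono)
      finally show ?thesis by (simp add: distrib_right)
    qed
    thus "exp_decay u" unfolding exp_decay_def using 1(2) 2(2)
      by (intro exI[of _ "C + C'"] exI[of _ "min r r'"]) auto
  next
    show "pure_point_in (Hop lam \<alpha> \<theta>) ?I"
      unfolding pure_point_in_def
    proof (intro allI impI)
      fix u \<mu> assume u: "l2 u" and sm: "is_spectral_measure (Hop lam \<alpha> \<theta>) u \<mu>"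
      interpret spectral_measure "Hop lam \<alpha> \<theta>" ?H ?M "mk_ell2 u" \<mu>
        by unfold_locales (use u sm in simp)
      let ?c = "cof lam \<alpha> \<theta>" and ?v = "vpot \<alpha> \<theta>"
      \<comment> \<open>Both sides represent \<open>H\<close> applied to the unit vector at
        \<open>n\<close>: the left through \<open>rep_mult_x\<close>, the right through the column
        of the matrix. A function representing 0 vanishes almost everywhere, and countably many
        \<open>n\<close> allow one common null set.\<close>
      have eq_AE: "AE x in \<mu>. \<forall>n. x * hker b n x = ?c n * hker b (n + 1) x + ?c (n - 1) * hker b (n - 1) x + ?v n * hker b n x" for b
        unfolding AE_all_countable
      proof
        fix n
        let ?D = "1 *\<^sub>R (?c n *\<^sub>R delta (n + 1) b + ?c (n - 1) *\<^sub>R delta (n - 1) b) + ?v n *\<^sub>R delta n b"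
        let ?h = "\<lambda>x. 1 * (?c n * hker b (n + 1) x + ?c (n - 1) * hker b (n - 1) x) + ?v n * hker b n x"
        have "?H (delta n b) = ?D"
        proof (rule ell2_eqI)
          fix m
          consider "m = n" | "m = n + 1" | "m = n - 1" | "m \<noteq> n" "m \<noteq> n + 1" "m \<noteq> n - 1" by blast
          thus "coord (?H (delta n b)) m = coord ?D m"
            by cases (simp_all add: coord_H Hop_def scaleR_conv_of_real)
        qed
        hence D: "1 *\<^sub>R ?H (delta n b) + (- 1) *\<^sub>R ?D = 0" by (simp only: scaleR_minus1_left scaleR_one right_minus)
        have "rep (\<lambda>x. 1 * (x * hker b n x) + (- 1) * ?h x) (1 *\<^sub>R ?H (delta n b) + (- 1) *\<^sub>R ?D)"
          by (intro rep_lincomb rep_mult_x rep_hker)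
        hence "AE x in \<mu>. 1 * (x * hker b n x) + (- 1) * ?h x = 0"
          unfolding D by (rule rep_zero_AE)
        thus "AE x in \<mu>. x * hker b n x = ?c n * hker b (n + 1) x + ?c (n - 1) * hker b (n - 1) x + ?v n * hker b n x"
          by eventually_elim simp
      qed
      \<comment> \<open>The polynomially bounded kernel decays exponentially, hence is square
        summable; were it nonzero, \<open>x\<close> would be an eigenvalue.\<close>
      have zero: "AE x in \<mu>. x \<in> - {- lam..lam} - Eig \<longrightarrow> (\<forall>n. hker b n x = 0)" if b: "norm b = 1" for b
        using eq_AE[of b] hker_polynomially_bounded[OF b]
      proof eventually_elim
        case (elim x)
        show ?case
        proof
          assume x: "x \<in> - {- lam..lam} - Eig"
          hence x': "\<bar>x\<bar> > lam" by auto
          from elim(2) obtain P where "\<And>n. \<bar>hker b n x\<bar> \<le> P * (1 + \<bar>of_int n\<bar>)" by blast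
          from decay[OF x', of "\<lambda>n. hker b n x", OF elim(1)[rule_format] this]
          obtain C r where C: "r > 0" "\<And>n. \<bar>hker b n x\<bar> \<le> C * exp (- r * \<bar>of_int n\<bar>)" by blast
          define g where "g = mk_ell2 (\<lambda>n. complex_of_real (hker b n x))"
          have cg: "coord g = (\<lambda>n. complex_of_real (hker b n x))"
            unfolding g_def by (rule coord_mk[OF l2_exp_decay[OF C(1)]]) (use C(2) in simp)
          have "?H g = x *\<^sub>R g"
          proof (rule ell2_eqI)
            fix n
            have "coord (?H g) n = complex_of_real (?c n * hker b (n + 1) x + ?c (n - 1) * hker b (n - 1) x + ?v n * hker b n x)"
              by (simp add: coord_H Hop_def cg)
            also have "\<dots> = complex_of_real (x * hker b n x)" using elim(1)[rule_format, of n] by simp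
            finally show "coord (?H g) n = coord (x *\<^sub>R g) n" by (simp add: cg scaleR_conv_of_real)
          qed
          hence "g = 0" using x by (auto simp: Eig_def)
          hence "coord g n = 0" for n by simp
          thus "\<forall>n. hker b n x = 0" by (simp add: cg)
        qed
      qed
      have Ec: "countable Eig" unfolding Eig_def by (rule countable_eigenvalues)
      have A: "- {- lam..lam} - Eig \<in> sets borel"
        using sets.countable[OF _ Ec, of borel] by (intro sets.Diff) auto
      have "emeasure \<mu> (- {- lam..lam} - Eig) = 0"
      proof (rule null_set_if_hker_zero[OF A])
        show "AE x in \<mu>. x \<in> - {- lam..lam} - Eig \<longrightarrow> (\<forall>n. hker 1 n x = 0 \<and> hker \<i> n x = 0)"
          using zero[OF norm_one] zero[OF norm_ii] by eventually_elim blast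
      qed
      moreover have "?I - Eig \<subseteq> - {- lam..lam} - Eig" by auto
      moreover have "- {- lam..lam} - Eig \<in> sets \<mu>" using A by (simp add: sets_mu)
      ultimately have null: "emeasure \<mu> (?I - Eig) = 0" using emeasure_mono[of "?I - Eig" "- {- lam..lam} - Eig" \<mu>] by simp
      \<comment> \<open>Closedness of the spectrum, and with it the argument by symmetric inverses,
        serves to make this set measurable.\<close>
      have sets: "?I - Eig \<in> sets \<mu>"
        using borel_closed[OF closed_spec] sets.countable[OF _ Ec, of borel] by (simp add: sets_mu)
      show "\<exists>C. countable C \<and> C \<subseteq> ?I \<and> ?I - C \<in> sets \<mu> \<and> emeasure \<mu> (?I - C) = 0"
      proof (intro exI[of _ "Eig \<inter> ?I"] conjI)
        show "countable (Eig \<inter> ?I)" using Ec by (rule countable_subset[rotated]) auto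
        have "?I - Eig \<inter> ?I = ?I - Eig" by auto
        thus "?I - Eig \<inter> ?I \<in> sets \<mu>" "emeasure \<mu> (?I - Eig \<inter> ?I) = 0" using sets null by simp_all
      qed auto
    qed
  qed
qed

end
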